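(* Let $0<\alpha\le1$. Assume (Pur) holds. Then the operator $\Pi$ is a quasi-compact operator on $(C^\alpha(\mathrm P(\mathbb C^k),\mathbb C),\|\cdot\|_\alpha)$. Moreover, $\rho_\alpha(\Pi)=1$.
   Context: Let $k\in\mathbb N=\{1,2,\dots\}$ be fixed; $\mathbb C^k$ carries its canonical inner product and norm $\|\cdot\|$. $\mathrm P(\mathbb C^k)$ is the projective space; $\hat x$ is the class of a nonzero vector $x$, and given $\hat x$, $x$ denotes a unit-norm representative. The metric is $d(\hat x,\hat y)=\sqrt{1-|\langle x,y\rangle|^2}$. For $v\in\mathrm M_k(\mathbb C)$ with $vx\ne0$, $v\cdot\hat x$ is the class of $vx$. $C^\alpha(\mathrm P(\mathbb C^k),\mathbb C)$ is the Banach space of $\alpha$-Hölder functions with norm $\|f\|_\alpha=\|f\|_\infty+m_\alpha(f)$, $m_\alpha(f)=\sup_{\hat x\ne\hat y}|f(\hat x)-f(\hat y)|/d(\hat x,\hat y)^\alpha$; $\rho_\alpha$ is the spectral radius of bounded operators on it. $\mu$ is a (not necessarily finite) Borel measure on $\mathrm M_k(\mathbb C)$ with $\int\|v\|^2d\mu(v)<\infty$ and $\int v^*v\,d\mu(v)=\mathrm{Id}_{\mathbb C^k}$. The Markov operator is $\Pi f(\hat x)=\int_{\mathrm M_k(\mathbb C)}f(v\cdot\hat x)\|vx\|^2d\mu(v)$ (integrand $0$ when $vx=0$). (Pur): any nonzero orthogonal projector $\pi$ on $\mathbb C^k$ such that, for every $n\in\mathbb N$, $\pi v_1^*\cdots v_n^*v_n\cdots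 v_1\pi\propto\pi$ (proportionality constant $0$ allowed) for $\mu^{\otimes n}$-almost every $(v_1,\dots,v_n)$, is of rank one. A bounded operator $Q$ on a Banach space $\mathcal B$ is quasi-compact if there is a decomposition $\mathcal B=\mathcal F\oplus\mathcal H$ into closed $Q$-invariant subspaces with trivial intersection, where $\mathcal F$ is finite dimensional, all eigenvalues of $Q|_{\mathcal F}$ have modulus $\rho(Q)$, and $\rho(Q|_{\mathcal H})<\rho(Q)$, $\rho$ being the spectral radius. *)

theory Defs
  imports "HOL-Analysis.Analysis" "HOL-Library.Function_Algebras"
begin

section \<open>Projective space\<close>

definition proj_rel :: "complex^'k \<Rightarrow> complex^'k \<Rightarrow> bool" where
  "proj_rel x y \<longleftrightarrow> x \<noteq> 0 \<and> y \<noteq> 0 \<and> (\<exists>c. y = c *s x)"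

lemma part_equivp_proj_rel: "part_equivp (proj_rel :: complex^'k \<Rightarrow> complex^'k \<Rightarrow> bool)"
proof (rule part_equivpI)
  show "\<exists>x :: complex^'k. proj_rel x x"
    by (rule exI[of _ "axis undefined 1"])
      (auto simp: proj_rel_def axis_eq_0_iff intro!: exI[of _ 1])
  show "symp (proj_rel :: complex^'k \<Rightarrow> complex^'k \<Rightarrow> bool)"
  proof (rule sympI)
    fix x y :: "complex^'k"
    assume "proj_rel x y"
    then obtain c where *: "x \<noteq> 0" "y \<noteq> 0" "y = c *s x"
      by (auto simp: proj_rel_def)
    then have "c \<noteq> 0" by auto
    then have "x = inverse c *s y" using * by simp
    with * show "proj_rel y x" unfolding proj_rel_def by blast
  qed
  show "transp (proj_rel :: complex^'k \<Rightarrow> complex^'k \<Rightarrow> bool)"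
    by (rule transpI) (auto simp: proj_rel_def)
qed

text \<open>The quotient is partial: \<open>proj_class x\<close> is meaningful only for \<open>x \<noteq> 0\<close>.\<close>

quotient_type 'k proj = "complex^'k" / partial: "proj_rel"
  morphisms rep_proj proj_class
  by (rule part_equivp_proj_rel)

lemma proj_class_eq_iff:
  assumes "x \<noteq> 0" "y \<noteq> 0"
  shows "proj_class x = proj_class y \<longleftrightarrow> (\<exists>c. y = c *s x)"
proof -
  have "proj_rel x x" "proj_rel y y"
    using assms by (auto simp: proj_rel_def intro!: exI[of _ 1])
  then show ?thesis
    using Quotient_rel[OF Quotient_proj, of x y] assms by (auto simp: proj_rel_def)
qed

definition unit_rep :: "('k::finite) proj \<Rightarrow> complex^'k" where
  "unit_rep p = (SOME x. norm x = 1 \<and> proj_class x = p)"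

lemma norm_vec_scale: "norm (c *s x) = cmod c * norm (x :: complex^'k)"
  by (simp add: norm_vec_def vector_scalar_mult_def norm_mult L2_set_right_distrib)

lemma unit_rep: "norm (unit_rep p) = 1" "proj_class (unit_rep p) = p"
proof -
  obtain x where x: "proj_rel x x" "proj_class x = p"
    by (metis Quotient_abs_rep[OF Quotient_proj] Quotient_rep_reflp[OF Quotient_proj])
  then have nz: "x \<noteq> 0" by (simp add: proj_rel_def)
  define y where "y = complex_of_real (inverse (norm x)) *s x"
  have "norm y = 1" using nz by (simp add: y_def norm_vec_scale del: of_real_inverse)
  moreover have "proj_class y = p"
    using nz x \<open>norm y = 1\<close> proj_class_eq_iff[of x y] by (auto simp: y_def)
  ultimately have "norm y = 1 \<and> proj_class y = p" by simp
  then have "norm (unit_rep p) = 1 \<and> proj_class (unit_rep p) = p"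
    unfolding unit_rep_def by (rule someI)
  then show "norm (unit_rep p) = 1" "proj_class (unit_rep p) = p" by auto
qed

lemma unit_rep_proj_class:
  assumes "norm x = 1"
  obtains c where "cmod c = 1" "unit_rep (proj_class x) = c *s x"
proof -
  have "x \<noteq> 0" using assms by auto
  moreover have "unit_rep (proj_class x) \<noteq> 0"
    using unit_rep(1)[of "proj_class x"] by (metis norm_zero zero_neq_one)
  ultimately obtain c where c: "unit_rep (proj_class x) = c *s x"
    using proj_class_eq_iff[of x "unit_rep (proj_class x)"] unit_rep(2)[of "proj_class x"] by auto
  moreover have "cmod c = 1"
    using unit_rep(1)[of "proj_class x"] assms by (simp add: c norm_vec_scale)
  ultimately show ?thesis using that by blast
qed

definition cinner :: "complex^'k \<Rightarrow> complex^'k \<Rightarrow> complex" where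
  "cinner x y = (\<Sum>i\<in>UNIV. cnj (x $ i) * y $ i)"

definition proj_dist :: "('k::finite) proj \<Rightarrow> 'k proj \<Rightarrow> real" where
  "proj_dist p q = sqrt (1 - (cmod (cinner (unit_rep p) (unit_rep q)))\<^sup>2)"

lemma proj_dist_proj_class:
  assumes "norm x = 1" "norm y = 1"
  shows "proj_dist (proj_class x) (proj_class y) = sqrt (1 - (cmod (cinner x y))\<^sup>2)"
proof -
  obtain c where c: "cmod c = 1" "unit_rep (proj_class x) = c *s x"
    using unit_rep_proj_class[OF assms(1)] .
  obtain d where d: "cmod d = 1" "unit_rep (proj_class y) = d *s y"
    using unit_rep_proj_class[OF assms(2)] .
  have "cinner (c *s x) (d *s y) = cnj c * d * cinner x y"
    by (simp add: cinner_def sum_distrib_left mult_ac)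
  then show ?thesis
    using c d by (simp add: proj_dist_def norm_mult)
qed

definition proj_act :: "complex^'k^'k \<Rightarrow> ('k::finite) proj \<Rightarrow> 'k proj" where
  "proj_act v p = proj_class (v *v unit_rep p)"

lemma proj_act_proj_class:
  assumes "norm x = 1" "v *v x \<noteq> 0"
  shows "proj_act v (proj_class x) = proj_class (v *v x)"
proof -
  obtain c where c: "cmod c = 1" "unit_rep (proj_class x) = c *s x"
    using unit_rep_proj_class[OF assms(1)] .
  have *: "v *v (c *s x) = c *s (v *v x)"
    by (simp add: vec_eq_iff matrix_vector_mult_def sum_distrib_left mult_ac)
  have "c *s (v *v x) \<noteq> 0"
    using c(1) assms(2) by auto
  then have "proj_class (v *v x) = proj_class (c *s (v *v x))"
    using assms(2) by (subst proj_class_eq_iff) auto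
  then show ?thesis
    by (simp add: proj_act_def c(2) *)
qed


section \<open>Hoelder functions\<close>

text \<open>The norm takes values in \<open>ennreal\<close> so that it is defined for every function, and so that the
  supremum over the empty set is \<open>0\<close> (this occurs in \<open>m\<^sub>\<alpha>\<close> when \<open>k = 1\<close>).\<close>

definition sup_enorm :: "('p \<Rightarrow> complex) \<Rightarrow> ennreal" where
  "sup_enorm f = (SUP p. ennreal (cmod (f p)))"

definition holder_seminorm :: "real \<Rightarrow> (('k::finite) proj \<Rightarrow> complex) \<Rightarrow> ennreal" where
  "holder_seminorm \<alpha> f =
     (SUP (p, q) \<in> {(p, q). p \<noteq> q}. ennreal (cmod (f p - f q) / proj_dist p q powr \<alpha>))"

definition holder_enorm :: "real \<Rightarrow> (('k::finite) proj \<Rightarrow> complex) \<Rightarrow> ennreal" where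
  "holder_enorm \<alpha> f = sup_enorm f + holder_seminorm \<alpha> f"

definition holder_space :: "real \<Rightarrow> (('k::finite) proj \<Rightarrow> complex) set" where
  "holder_space \<alpha> = {f. holder_enorm \<alpha> f < \<infinity>}"

definition holder_norm :: "real \<Rightarrow> (('k::finite) proj \<Rightarrow> complex) \<Rightarrow> real" where
  "holder_norm \<alpha> f = enn2real (holder_enorm \<alpha> f)"


section \<open>Bounded operators on normed spaces of functions\<close>

text \<open>A complex normed space is given by a carrier \<open>V\<close>, a linear subspace of the space of
  all functions, and a norm \<open>N\<close> of which only the values on \<open>V\<close> matter. Likewise only the values
  of an operator \<open>Q\<close> on \<open>V\<close> matter, so the restriction of \<open>Q\<close> to an invariant subspace \<open>H\<close> is
  \<open>Q\<close> considered on the carrier \<open>H\<close>.\<close>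

definition fscale :: "complex \<Rightarrow> ('p \<Rightarrow> complex) \<Rightarrow> 'p \<Rightarrow> complex" where
  "fscale c f = (\<lambda>p. c * f p)"

interpretation fun_vs: vector_space fscale
  by standard (auto simp: fscale_def algebra_simps)

lemma holder_enorm_zero: "holder_enorm \<alpha> 0 = 0"
  by (auto simp: holder_enorm_def sup_enorm_def holder_seminorm_def SUP_eq_iff intro!: antisym SUP_least)

lemma holder_enorm_triangle: "holder_enorm \<alpha> (f + g) \<le> holder_enorm \<alpha> f + holder_enorm \<alpha> g"
proof -
  have "sup_enorm (f + g) \<le> sup_enorm f + sup_enorm g"
    unfolding sup_enorm_def
  proof (rule SUP_least)
    fix p
    have "ennreal (cmod ((f + g) p)) \<le> ennreal (cmod (f p)) + ennreal (cmod (g p))"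
      by (simp add: ennreal_plus[symmetric] norm_triangle_ineq ennreal_leI del: ennreal_plus)
    also have "\<dots> \<le> (SUP p. ennreal (cmod (f p))) + (SUP p. ennreal (cmod (g p)))"
      by (intro add_mono SUP_upper) auto
    finally show "ennreal (cmod ((f + g) p)) \<le> \<dots>" .
  qed
  moreover have "holder_seminorm \<alpha> (f + g) \<le> holder_seminorm \<alpha> f + holder_seminorm \<alpha> g"
    unfolding holder_seminorm_def
  proof (rule SUP_least, clarify)
    fix p q :: "'a proj" assume "p \<noteq> q"
    let ?h = "\<lambda>f. \<lambda>(p, q). ennreal (cmod (f p - f q) / proj_dist p q powr \<alpha>)"
    have "cmod ((f + g) p - (f + g) q) \<le> cmod (f p - f q) + cmod (g p - g q)"
      using norm_triangle_ineq[of "f p - f q" "g p - g q"] by (simp add: algebra_simps)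
    then have "?h (f + g) (p, q) \<le> ?h f (p, q) + ?h g (p, q)"
      by (simp add: ennreal_plus[symmetric] add_divide_distrib[symmetric] divide_right_mono ennreal_leI
          del: ennreal_plus)
    also have "\<dots> \<le> (SUP x\<in>{(p, q). p \<noteq> q}. ?h f x) + (SUP x\<in>{(p, q). p \<noteq> q}. ?h g x)"
      using \<open>p \<noteq> q\<close> by (intro add_mono SUP_upper) auto
    finally show "ennreal (cmod ((f + g) p - (f + g) q) / proj_dist p q powr \<alpha>) \<le> \<dots>" by simp
  qed
  ultimately show ?thesis
    unfolding holder_enorm_def by (metis (no_types, lifting) add.assoc add.left_commute add_mono)
qed

lemma holder_enorm_fscale: "holder_enorm \<alpha> (fscale c f) = ennreal (cmod c) * holder_enorm \<alpha> f"
proof -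
  have "cmod (c * f p - c * f q) = cmod c * cmod (f p - f q)" for p q
    by (simp add: right_diff_distrib[symmetric] norm_mult)
  then show ?thesis
    by (simp add: holder_enorm_def sup_enorm_def holder_seminorm_def fscale_def norm_mult ennreal_mult
        SUP_mult_left_ennreal distrib_left case_prod_unfold times_divide_eq_right[symmetric]
        del: times_divide_eq_right)
qed

lemma subspace_holder_space: "fun_vs.subspace (holder_space \<alpha>)"
  unfolding fun_vs.subspace_def
proof (intro conjI ballI allI)
  show "0 \<in> holder_space \<alpha>"
    by (simp add: holder_space_def holder_enorm_zero)
  show "f + g \<in> holder_space \<alpha>" if "f \<in> holder_space \<alpha>" "g \<in> holder_space \<alpha>" for f g :: "'a proj \<Rightarrow> complex"
    using that holder_enorm_triangle[of \<alpha> f g]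
    by (auto simp: holder_space_def intro: le_less_trans)
  show "fscale c f \<in> holder_space \<alpha>" if "f \<in> holder_space \<alpha>" for c and f :: "'a proj \<Rightarrow> complex"
    using that by (simp add: holder_space_def holder_enorm_fscale ennreal_mult_less_top)
qed

lemma Metric_space_holder: "Metric_space (holder_space \<alpha>) (\<lambda>f g. holder_norm \<alpha> (f - g))"
proof
  fix f g :: "'a proj \<Rightarrow> complex"
  show "0 \<le> holder_norm \<alpha> (f - g)"
    by (simp add: holder_norm_def)
  have "f - g = fscale (-1) (g - f)"
    by (auto simp: fscale_def)
  then have "holder_enorm \<alpha> (f - g) = ennreal (cmod (- 1)) * holder_enorm \<alpha> (g - f)"
    by (metis holder_enorm_fscale)
  then show "holder_norm \<alpha> (f - g) = holder_norm \<alpha> (g - f)"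
    by (simp add: holder_norm_def)
next
  fix f g :: "'a proj \<Rightarrow> complex"
  assume "f \<in> holder_space \<alpha>" "g \<in> holder_space \<alpha>"
  then have "f - g \<in> holder_space \<alpha>"
    by (rule fun_vs.subspace_diff[OF subspace_holder_space])
  then have "holder_norm \<alpha> (f - g) = 0 \<longleftrightarrow> holder_enorm \<alpha> (f - g) = 0"
    by (auto simp: holder_norm_def holder_space_def enn2real_eq_0_iff)
  also have "\<dots> \<longleftrightarrow> f = g"
  proof
    assume "holder_enorm \<alpha> (f - g) = 0"
    then have "sup_enorm (f - g) = 0"
      by (simp add: holder_enorm_def)
    then have "ennreal (cmod ((f - g) p)) \<le> 0" for p
      unfolding sup_enorm_def by (metis SUP_upper UNIV_I)
    then show "f = g" by (auto simp: fun_eq_iff)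
  next
    assume "f = g"
    then have "f - g = 0" by simp
    then show "holder_enorm \<alpha> (f - g) = 0" by (simp only: holder_enorm_zero)
  qed
  finally show "holder_norm \<alpha> (f - g) = 0 \<longleftrightarrow> f = g" .
next
  fix f g h :: "'a proj \<Rightarrow> complex"
  assume "f \<in> holder_space \<alpha>" "g \<in> holder_space \<alpha>" "h \<in> holder_space \<alpha>"
  then have *: "f - g \<in> holder_space \<alpha>" "g - h \<in> holder_space \<alpha>"
    by (auto intro: fun_vs.subspace_diff[OF subspace_holder_space])
  have "f - h = (f - g) + (g - h)" by simp
  then have "holder_enorm \<alpha> (f - h) \<le> holder_enorm \<alpha> (f - g) + holder_enorm \<alpha> (g - h)"
    by (metis holder_enorm_triangle)
  then show "holder_norm \<alpha> (f - h) \<le> holder_norm \<alpha> (f - g) + holder_norm \<alpha> (g - h)"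
    using * by (simp add: holder_norm_def holder_space_def enn2real_plus[symmetric] enn2real_mono
        del: enn2real_plus)
qed

definition bounded_op ::
    "('p \<Rightarrow> complex) set \<Rightarrow> (('p \<Rightarrow> complex) \<Rightarrow> real) \<Rightarrow> (('p \<Rightarrow> complex) \<Rightarrow> 'p \<Rightarrow> complex) \<Rightarrow> bool" where
  "bounded_op V N Q \<longleftrightarrow>
     (\<forall>f\<in>V. Q f \<in> V) \<and>
     (\<forall>f\<in>V. \<forall>g\<in>V. Q (f + g) = Q f + Q g) \<and>
     (\<forall>c. \<forall>f\<in>V. Q (fscale c f) = fscale c (Q f)) \<and>
     (\<exists>C. \<forall>f\<in>V. N (Q f) \<le> C * N f)"

definition op_spectrum ::
    "('p \<Rightarrow> complex) set \<Rightarrow> (('p \<Rightarrow> complex) \<Rightarrow> real) \<Rightarrow> (('p \<Rightarrow> complex) \<Rightarrow> 'p \<Rightarrow> complex) \<Rightarrow> complex set"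
    where
  "op_spectrum V N Q =
     {z. \<not> (\<exists>R. bounded_op V N R \<and>
             (\<forall>f\<in>V. R (fscale z f - Q f) = f \<and> fscale z (R f) - Q (R f) = f))}"

text \<open>With values in \<open>ennreal\<close>, the spectral radius on the zero space (empty spectrum) is \<open>0\<close>.\<close>

definition spectral_radius ::
    "('p \<Rightarrow> complex) set \<Rightarrow> (('p \<Rightarrow> complex) \<Rightarrow> real) \<Rightarrow> (('p \<Rightarrow> complex) \<Rightarrow> 'p \<Rightarrow> complex) \<Rightarrow> ennreal"
    where
  "spectral_radius V N Q = (SUP z \<in> op_spectrum V N Q. ennreal (cmod z))"

definition closed_subspace ::
    "('p \<Rightarrow> complex) set \<Rightarrow> (('p \<Rightarrow> complex) \<Rightarrow> real) \<Rightarrow> ('p \<Rightarrow> complex) set \<Rightarrow> bool" where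
  "closed_subspace V N S \<longleftrightarrow>
     fun_vs.subspace S \<and> closedin (Metric_space.mtopology V (\<lambda>f g. N (f - g))) S"

definition quasi_compact ::
    "('p \<Rightarrow> complex) set \<Rightarrow> (('p \<Rightarrow> complex) \<Rightarrow> real) \<Rightarrow> (('p \<Rightarrow> complex) \<Rightarrow> 'p \<Rightarrow> complex) \<Rightarrow> bool" where
  "quasi_compact V N Q \<longleftrightarrow>
     bounded_op V N Q \<and>
     (\<exists>F H.
        closed_subspace V N F \<and> closed_subspace V N H \<and>
        Q ` F \<subseteq> F \<and> Q ` H \<subseteq> H \<and>
        F \<inter> H = {0} \<and> {f + h | f h. f \<in> F \<and> h \<in> H} = V \<and>
        (\<exists>B. finite B \<and> F = fun_vs.span B) \<and>
        (\<forall>z. \<forall>f\<in>F. f \<noteq> 0 \<and> Q f = fscale z f \<longrightarrow> ennreal (cmod z) = spectral_radius V N Q) \<and>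
        spectral_radius H N Q < spectral_radius V N Q)"


section \<open>The Markov operator and purification\<close>

definition madj :: "complex^'m^'n \<Rightarrow> complex^'n^'m" where
  "madj A = (\<chi> i j. cnj (A $ j $ i))"

text \<open>The case distinction is needed as \<open>proj_class 0\<close> is arbitrary; the factor
  \<open>(norm (v *v x))\<^sup>2\<close> vanishes there anyway.\<close>

definition markov_op :: "(complex^'k^'k) measure \<Rightarrow> (('k::finite) proj \<Rightarrow> complex) \<Rightarrow> 'k proj \<Rightarrow> complex"
    where
  "markov_op \<mu> f p =
     (\<integral>v. (if v *v unit_rep p = 0 then 0
           else f (proj_act v p) * complex_of_real ((norm (v *v unit_rep p))\<^sup>2)) \<partial>\<mu>)"

text \<open>The \<open>n\<close>-fold product measure, on functions indexed by \<open>{..<n}\<close>. It is built from binary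
  products rather than with \<open>PiM\<close>, because \<open>PiM\<close> is a product measure only for
  \<open>\<sigma>\<close>-finite factors. A measure on matrices with \<open>\<integral>\<parallel>v\<parallel>\<^sup>2 d\<mu> < \<infinity>\<close> is \<open>\<sigma>\<close>-finite away from the
  zero matrix, but may have infinite mass there; it is then still a countable sum of finite
  measures, which is enough for the binary product to be the usual one.\<close>

primrec power_measure :: "'a measure \<Rightarrow> nat \<Rightarrow> (nat \<Rightarrow> 'a) measure" where
  "power_measure M 0 = PiM {} (\<lambda>_. M)"
| "power_measure M (Suc n) =
     distr (power_measure M n \<Otimes>\<^sub>M M) (PiM {..<Suc n} (\<lambda>_. M)) (\<lambda>(w, v). w(n := v))"

lemma power_measure_eq_PiM:
  assumes "sigma_finite_measure M"
  shows "power_measure M n = PiM {..<n} (\<lambda>_. M)"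
proof (induction n)
  case 0
  show ?case by simp
next
  case (Suc n)
  interpret sigma_finite_measure M by fact
  interpret product_sigma_finite "\<lambda>_. M" by standard
  have meas: "(\<lambda>(w, v). w(n := v)) \<in> PiM {..<n} (\<lambda>_. M) \<Otimes>\<^sub>M M \<rightarrow>\<^sub>M PiM {..<Suc n} (\<lambda>_. M)"
    using measurable_add_dim[of n "{..<n}" "\<lambda>_. M"] by (simp add: lessThan_Suc)
  show ?case
  proof (rule PiM_eqI)
    fix A assume A: "\<And>i. i \<in> {..<Suc n} \<Longrightarrow> A i \<in> sets M"
    have *: "(\<lambda>(w, v). w(n := v)) -` Pi\<^sub>E {..<Suc n} A \<inter> space (PiM {..<n} (\<lambda>_. M) \<Otimes>\<^sub>M M)
        = Pi\<^sub>E {..<n} A \<times> A n"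
      using A[THEN sets.sets_into_space]
      by (auto simp: space_pair_measure space_PiM PiE_iff extensional_def less_Suc_eq split: if_splits)
    show "emeasure (power_measure M (Suc n)) (Pi\<^sub>E {..<Suc n} A) = (\<Prod>i\<in>{..<Suc n}. emeasure M (A i))"
    proof -
      have "Pi\<^sub>E {..<Suc n} A \<in> sets (PiM {..<Suc n} (\<lambda>_. M))"
        using A by (intro sets_PiM_I_finite) auto
      then have "emeasure (power_measure M (Suc n)) (Pi\<^sub>E {..<Suc n} A) =
          emeasure (PiM {..<n} (\<lambda>_. M) \<Otimes>\<^sub>M M) (Pi\<^sub>E {..<n} A \<times> A n)"
        using meas by (simp add: Suc emeasure_distr * del: prod.lessThan_Suc)
      also have "\<dots> = emeasure (PiM {..<n} (\<lambda>_. M)) (Pi\<^sub>E {..<n} A) * emeasure M (A n)"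
        using A by (intro emeasure_pair_measure_Times sets_PiM_I_finite) auto
      also have "\<dots> = (\<Prod>i\<in>{..<Suc n}. emeasure M (A i))"
        using A by (subst emeasure_PiM) auto
      finally show ?thesis .
    qed
  qed simp_all
qed

text \<open>\<open>mat_prod n v\<close> is \<open>v\<^sub>n \<dots> v\<^sub>1\<close>, where \<open>v\<^sub>i\<close> is \<open>v (i - 1)\<close>.\<close>

primrec mat_prod :: "nat \<Rightarrow> (nat \<Rightarrow> complex^'k^'k) \<Rightarrow> complex^'k^'k" where
  "mat_prod 0 v = mat 1"
| "mat_prod (Suc n) v = v n ** mat_prod n v"

definition orth_projector :: "complex^'k^'k \<Rightarrow> bool" where
  "orth_projector P \<longleftrightarrow> P ** P = P \<and> madj P = P"

definition purification :: "(complex^'k^'k) measure \<Rightarrow> bool" where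
  "purification \<mu> \<longleftrightarrow>
     (\<forall>P. orth_projector P \<and> P \<noteq> 0 \<and>
        (\<forall>n\<ge>1. AE v in power_measure \<mu> n.
           \<exists>c. P ** madj (mat_prod n v) ** mat_prod n v ** P = (\<chi> i j. c * P $ i $ j))
        \<longrightarrow> rank P = 1)"

end

theory Submission
  imports Defs "HOL-Library.Diagonal_Subsequence" "HOL-Complex_Analysis.Great_Picard"
begin

text \<open>
  For \<open>x, y \<in> \<complex>\<^sup>k\<close> put \<open>F\<^sub>n(x, y) = \<integral> \<parallel>v\<^sub>n\<dots>v\<^sub>1x \<and> v\<^sub>n\<dots>v\<^sub>1y\<parallel>\<close>. Cauchy--Schwarz and \<open>\<integral> v\<^sup>*v = 1\<close> give
  \<open>F\<^sub>n(x, y) \<le> \<parallel>x \<and> y\<parallel>\<close>, and \<open>F\<^sub>n\<close> decreases in \<open>n\<close>. If \<open>F\<^sub>n(x, y) = 1\<close> for all \<open>n\<close> and an orthonormal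
  pair, then all products of matrices in the support of the measure are conformal on the plane of
  \<open>x, y\<close>, against (Pur); so by compactness \<open>F\<^sub>n \<le> \<kappa> \<parallel>x \<and> y\<parallel>\<close> for some \<open>n\<close> and \<open>\<kappa> < 1\<close>, and then
  \<open>F\<^sub>n \<le> \<kappa>\<^sub>n \<parallel>x \<and> y\<parallel>\<close> with \<open>\<kappa>\<^sub>n \<rightarrow> 0\<close>. Comparing \<open>f(x)\<parallel>x\<parallel>\<^sup>2\<close> with \<open>f(y)\<parallel>y\<parallel>\<^sup>2\<close> and interpolating
  yields the Doeblin--Fortet inequality \<open>\<parallel>\<Pi>\<^sup>nf\<parallel>\<^sub>\<alpha> \<le> \<kappa>\<^sub>n\<^sup>\<alpha>\<parallel>f\<parallel>\<^sub>\<alpha> + 3\<parallel>f\<parallel>\<^sub>\<infinity>\<close>.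

  Since Hoelder balls are compact in the supremum norm, suitable powers of \<open>\<Pi>\<close> converge strongly
  to an idempotent \<open>P\<close> commuting with \<open>\<Pi>\<close>. On the range of \<open>P\<close> the inequality bounds the Hoelder norm by the
  supremum norm, so the range is finite dimensional and \<open>\<Pi>\<close> is recurrent there; on the kernel of \<open>P\<close>
  the iterates tend to \<open>0\<close>, uniformly by compactness, hence geometrically.
\<close>

section \<open>Spaces of functions\<close>

text \<open>The measure may be infinite, so constants need not be integrable: every integrand is
  dominated by multiples of the squared norms of \<open>v *v x\<close>, and F_n is an iterated
  integral. The supremum norm alone gives no gain, since constants are fixed. The gain sits in the
  homogeneous extension: its increment between x and y is at most a geometric mean of the wedge norm
  and \<open>norm x * norm y\<close>, with exponents \<alpha> and 1 - \<alpha>, plus a multiple of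
  \<open>norm (x - y) * norm (x + y)\<close>. Averaging shrinks the wedge norm by the contraction
  factor, whose power \<alpha> survives the interpolation, and by Cauchy-Schwarz it does not
  increase products of norms. The last term is never contracted; at suitable unit representatives it
  contributes 2 to the constant 3, and the supremum norm of the image contributes 1. The idempotent
  separates recurrent from decaying functions without prior knowledge of the peripheral spectrum. It
  exists because supremum norm contractions form an equicontinuous family with relatively compact
  orbits.\<close>

lemma sum_fun_apply: "(\<Sum>i\<in>I. f i) p = (\<Sum>i\<in>I. f i p)"
  by (induction I rule: infinite_finite_induct) auto


lemma uniform_limit_bound:
  fixes fs :: "nat \<Rightarrow> 'p \<Rightarrow> complex"
  assumes "uniform_limit UNIV fs f sequentially" "\<And>n. cmod (fs n p) \<le> c"
  shows "cmod (f p) \<le> c"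
proof (rule LIMSEQ_le_const2)
  show "(\<lambda>n. cmod (fs n p)) \<longlonglongrightarrow> cmod (f p)"
    using tendsto_uniform_limitI[OF assms(1), of p] by (auto intro: tendsto_norm)
qed (use assms in auto)

lemma uniform_limit_fscale:
  assumes "uniform_limit UNIV fs f sequentially"
  shows "uniform_limit UNIV (\<lambda>n. fscale c (fs n)) (fscale c f) sequentially"
  unfolding fscale_def using assms by (intro uniform_limit_intros)

lemma uniform_limit_plus_fun:
  fixes f g :: "'p \<Rightarrow> complex"
  assumes "uniform_limit UNIV fs f sequentially" "uniform_limit UNIV gs g sequentially"
  shows "uniform_limit UNIV (\<lambda>n. fs n + gs n) (f + g) sequentially"
  using uniform_limit_add[OF assms] by (simp add: plus_fun_def)

lemma uniform_limit_minus_fun: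
  fixes f g :: "'p \<Rightarrow> complex"
  assumes "uniform_limit UNIV fs f sequentially" "uniform_limit UNIV gs g sequentially"
  shows "uniform_limit UNIV (\<lambda>n. fs n - gs n) (f - g) sequentially"
  using uniform_limit_minus[OF assms] by (simp add: fun_diff_def)

lemma uniform_limit_subseq:
  fixes r :: "nat \<Rightarrow> nat"
  assumes "uniform_limit UNIV fs f sequentially" "\<And>n. n \<le> r n"
  shows "uniform_limit UNIV (\<lambda>n. fs (r n)) f sequentially"
  using assms unfolding uniform_limit_sequentially_iff by (meson order_trans)

lemma uniform_limit_eq_fun:
  fixes f g :: "'p \<Rightarrow> complex"
  assumes "uniform_limit UNIV fs f sequentially" "uniform_limit UNIV fs g sequentially"
  shows "f = g"
proof
  fix p
  show "f p = g p"
    using tendsto_uniform_limitI[OF assms(1), of p] tendsto_uniform_limitI[OF assms(2), of p]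
    by (auto intro: LIMSEQ_unique)
qed

text \<open>Functions in a finite-dimensional space are determined by their values at finitely many
  nodes \<open>I\<close>, and \<open>b\<close> is the basis dual to evaluation there. As the
  coefficients are values, pointwise convergence alone controls them.\<close>

lemma finite_span_interpolation:
  fixes B :: "('p \<Rightarrow> complex) set"
  assumes "finite B"
  shows "\<exists>I b. finite I \<and> (\<forall>i\<in>I. \<forall>j\<in>I. b i j = (if i = j then 1 else 0)) \<and>
    b ` I \<subseteq> fun_vs.span B \<and> (\<forall>f\<in>fun_vs.span B. \<forall>p. f p = (\<Sum>i\<in>I. f i * b i p))"
  using assms
proof (induction rule: finite_induct)
  case empty
  show ?case by (intro exI[of _ "{}"]) auto
next
  case (insert g B)
  then obtain I b where I: "finite I"
    and b': "\<forall>i\<in>I. \<forall>j\<in>I. b i j = (if i = j then 1 else 0)"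
    and bB: "b ` I \<subseteq> fun_vs.span B"
    and f': "\<forall>f\<in>fun_vs.span B. \<forall>p. f p = (\<Sum>i\<in>I. f i * b i p)"
    by (elim exE conjE) (rule that; assumption)
  have b: "b i j = (if i = j then 1 else 0)" if "i \<in> I" "j \<in> I" for i j
    using b' that by simp
  have f: "f p = (\<Sum>i\<in>I. f i * b i p)" if "f \<in> fun_vs.span B" for f p
    using f' that by blast
  \<comment> \<open>Remainder of the new generator after interpolation at the old nodes. If it
    vanishes, the span has not grown; otherwise a point where it is nonzero becomes a node.\<close>
  define g' where "g' p = g p - (\<Sum>i\<in>I. g i * b i p)" for p
  have g'I: "g' j = 0" if "j \<in> I" for j
  proof -
    have "(\<Sum>i\<in>I. g i * b i j) = (\<Sum>i\<in>I. if i = j then g i else 0)"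
      using b that by (intro sum.cong) auto
    then show ?thesis using I that by (simp add: g'_def)
  qed
  have sp: "\<exists>c. \<forall>p. f p - c * g p = (\<Sum>i\<in>I. (f i - c * g i) * b i p)"
    if "f \<in> fun_vs.span (insert g B)" for f
  proof -
    from that obtain c where "f - fscale c g \<in> fun_vs.span B"
      using fun_vs.span_breakdown_eq by blast
    note eq = f[OF this]
    show ?thesis
    proof (intro exI[of _ c] allI)
      fix p
      show "f p - c * g p = (\<Sum>i\<in>I. (f i - c * g i) * b i p)" using eq[of p] by (simp add: fscale_def)
    qed
  qed
  have sp': "\<exists>c. \<forall>p. f p = c * g' p + (\<Sum>i\<in>I. f i * b i p)"
    if F: "f \<in> fun_vs.span (insert g B)" for f
  proof -
    obtain c where c: "\<And>p. f p - c * g p = (\<Sum>i\<in>I. (f i - c * g i) * b i p)" using sp[OF F] by (elim exE) (rule that, erule spec)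
    show ?thesis
    proof (intro exI[of _ c] allI)
      fix p
      have "f p = c * g p + (\<Sum>i\<in>I. (f i - c * g i) * b i p)" using c[of p] by (simp add: algebra_simps)
      then show "f p = c * g' p + (\<Sum>i\<in>I. f i * b i p)"
        by (simp add: g'_def algebra_simps sum_subtractf sum_distrib_left)
    qed
  qed
  have g'B: "g' \<in> fun_vs.span (insert g B)"
  proof -
    have "g' = g - (\<Sum>i\<in>I. fscale (g i) (b i))"
      by (auto simp: g'_def fscale_def fun_eq_iff sum_fun_apply)
    moreover have "b i \<in> fun_vs.span (insert g B)" if "i \<in> I" for i
      using bB that fun_vs.span_mono[of B "insert g B"] by blast
    ultimately show ?thesis
      by (simp only:) (intro fun_vs.span_diff fun_vs.span_sum fun_vs.span_scale fun_vs.span_base[OF insertI1])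
  qed
  have bB': "b ` I \<subseteq> fun_vs.span (insert g B)"
    using bB fun_vs.span_mono[of B "insert g B"] by blast
  show ?case
  proof (cases "\<forall>p. g' p = 0")
    case True
    have "f p = (\<Sum>i\<in>I. f i * b i p)" if F: "f \<in> fun_vs.span (insert g B)" for f p
    proof -
      obtain c where c: "\<And>p. f p = c * g' p + (\<Sum>i\<in>I. f i * b i p)" using sp'[OF F] by (elim exE) (rule that, erule spec)
      show ?thesis using c[of p] True[rule_format, of p] by (simp only: mult_zero_right add_0)
    qed
    with I b bB' show ?thesis by (intro exI[of _ I] exI[of _ b]) simp
  next
    case False
    then obtain q where q: "g' q \<noteq> 0" by blast
    then have qI: "q \<notin> I" using g'I by blast
    \<comment> \<open>The remainder is normalised at the new node \<open>q\<close>, and each old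
      basis function is corrected to vanish there.\<close>
    define b' where "b' i p = (if i = q then g' p / g' q else b i p - b i q * (g' p / g' q))" for i p
    have sumb: "(\<Sum>i\<in>insert q I. f i * b' i p)
        = (\<Sum>i\<in>I. f i * b i p) + (f q - (\<Sum>i\<in>I. f i * b i q)) * (g' p / g' q)" for f p
    proof -
      have "(\<Sum>i\<in>insert q I. f i * b' i p) = f q * (g' p / g' q)
          + (\<Sum>i\<in>I. f i * (b i p - b i q * (g' p / g' q)))"
        using qI I by (auto simp: b'_def intro!: sum.cong)
      also have "(\<Sum>i\<in>I. f i * (b i p - b i q * (g' p / g' q)))
          = (\<Sum>i\<in>I. f i * b i p) - (\<Sum>i\<in>I. f i * b i q) * (g' p / g' q)"
        by (simp only: right_diff_distrib sum_subtractf sum_distrib_right mult.assoc)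
      finally show ?thesis by (simp add: algebra_simps)
    qed
    show ?thesis
    proof (intro exI[of _ "insert q I"] exI[of _ b'] conjI ballI allI)
      show "finite (insert q I)" using I by simp
      show "b' i j = (if i = j then 1 else 0)" if "i \<in> insert q I" "j \<in> insert q I" for i j
        using that q qI b g'I by (auto simp: b'_def)
      have "b' i = (if i = q then fscale (1 / g' q) g' else b i - fscale (b i q / g' q) g')" for i
        by (auto simp: b'_def fscale_def fun_eq_iff)
      then show "b' ` insert q I \<subseteq> fun_vs.span (insert g B)"
        using bB' g'B by (auto intro!: fun_vs.span_diff fun_vs.span_scale)
      show "f p = (\<Sum>i\<in>insert q I. f i * b' i p)" if F: "f \<in> fun_vs.span (insert g B)" for f p
      proof -
        obtain c where c: "\<And>p. f p = c * g' p + (\<Sum>i\<in>I. f i * b i p)" using sp'[OF F] by (elim exE) (rule that, erule spec)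
        have "f q - (\<Sum>i\<in>I. f i * b i q) = c * g' q" using c[of q] by (simp add: algebra_simps)
        then show ?thesis unfolding sumb using q c[of p] by simp
      qed
    qed
  qed
qed

lemma closed_finite_span:
  fixes B :: "('p \<Rightarrow> complex) set"
  assumes "finite B" "\<And>n. fs n \<in> fun_vs.span B" "\<And>p. (\<lambda>n. fs n p) \<longlonglongrightarrow> f p"
  shows "f \<in> fun_vs.span B"
proof -
  obtain I b where I: "finite I" and bB: "b ` I \<subseteq> fun_vs.span B"
    and b: "\<forall>f\<in>fun_vs.span B. \<forall>p. f p = (\<Sum>i\<in>I. f i * b i p)"
    using finite_span_interpolation[OF assms(1)] by (elim exE conjE) (rule that; assumption)
  have eq: "f p = (\<Sum>i\<in>I. f i * b i p)" for p
  proof (rule LIMSEQ_unique[OF assms(3)])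
    have "(\<lambda>n. \<Sum>i\<in>I. fs n i * b i p) \<longlonglongrightarrow> (\<Sum>i\<in>I. f i * b i p)"
      by (intro tendsto_sum tendsto_mult assms tendsto_const)
    moreover have "(\<Sum>i\<in>I. fs n i * b i p) = fs n p" for n
      by (rule bspec[OF b assms(2), THEN spec, symmetric])
    ultimately show "(\<lambda>n. fs n p) \<longlonglongrightarrow> (\<Sum>i\<in>I. f i * b i p)" by simp
  qed
  have "f = (\<Sum>i\<in>I. fscale (f i) (b i))"
  proof
    fix p
    show "f p = (\<Sum>i\<in>I. fscale (f i) (b i)) p"
      using eq[of p] by (simp add: fscale_def sum_fun_apply)
  qed
  moreover have "\<dots> \<in> fun_vs.span B"
    using bB by (intro fun_vs.span_sum fun_vs.span_scale) blast
  ultimately show ?thesis by simp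
qed

section \<open>Convergent subsequences of powers\<close>

lemma uniform_limit_sequentiallyE:
  assumes "uniform_limit UNIV fs f sequentially" "\<epsilon> > 0"
  obtains M where "\<And>n p. n \<ge> M \<Longrightarrow> dist (fs n p) (f p) < \<epsilon>"
proof -
  have "\<exists>M. \<forall>n\<ge>M. \<forall>p\<in>UNIV. dist (fs n p) (f p) < \<epsilon>"
    using assms unfolding uniform_limit_sequentially_iff by blast
  then obtain M where "\<forall>n\<ge>M. \<forall>p\<in>UNIV. dist (fs n p) (f p) < \<epsilon>" by (elim exE) (rule that)
  then show ?thesis by (intro that[of M]) auto
qed

text \<open>In \<open>compact\<close> the limit keeps the bound \<open>B\<close>: this encodes lower
  semicontinuity of \<open>N\<close> under uniform convergence and also does the work of
  completeness. The bound \<open>e n \<le> 1\<close> makes the powers of \<open>Q\<close> uniformly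
  bounded, and the fixed constant function puts 1 in the spectrum.\<close>

locale doeblin_fortet =
  fixes V :: "('p \<Rightarrow> complex) set" and N :: "('p \<Rightarrow> complex) \<Rightarrow> real"
    and Q :: "('p \<Rightarrow> complex) \<Rightarrow> 'p \<Rightarrow> complex" and e :: "nat \<Rightarrow> real" and C :: real
  assumes subspace: "fun_vs.subspace V"
    and N_triangle: "\<And>f g. f \<in> V \<Longrightarrow> g \<in> V \<Longrightarrow> N (f + g) \<le> N f + N g"
    and N_homogeneous: "\<And>c f. N (fscale c f) = cmod c * N f"
    and N_ge_0: "\<And>f. 0 \<le> N f"
    and norm_le_N: "\<And>f p. f \<in> V \<Longrightarrow> cmod (f p) \<le> N f"
    and compact: "\<And>fs B. (\<And>n. fs n \<in> V) \<Longrightarrow> (\<And>n. N (fs n) \<le> B) \<Longrightarrow>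
      \<exists>f s. f \<in> V \<and> N f \<le> B \<and> strict_mono (s :: nat \<Rightarrow> nat) \<and>
        uniform_limit UNIV (\<lambda>n. fs (s n)) f sequentially"
    and Q_in: "\<And>f. f \<in> V \<Longrightarrow> Q f \<in> V"
    and Q_add: "\<And>f g. f \<in> V \<Longrightarrow> g \<in> V \<Longrightarrow> Q (f + g) = Q f + Q g"
    and Q_fscale: "\<And>c f. f \<in> V \<Longrightarrow> Q (fscale c f) = fscale c (Q f)"
    and Q_contraction: "\<And>f c p. f \<in> V \<Longrightarrow> (\<And>p. cmod (f p) \<le> c) \<Longrightarrow> cmod (Q f p) \<le> c"
    and doeblin_fortet: "\<And>f c n. f \<in> V \<Longrightarrow> (\<And>p. cmod (f p) \<le> c) \<Longrightarrow> N ((Q ^^ n) f) \<le> e n * N f + C * c"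
    and e: "e \<longlonglongrightarrow> 0" "\<And>n. 0 \<le> e n" "\<And>n. e n \<le> 1"
    and C: "0 \<le> C"
    and one: "(\<lambda>_. 1) \<in> V" "Q (\<lambda>_. 1) = (\<lambda>_. 1)"
begin

lemmas V_closed = fun_vs.subspace_0[OF subspace] fun_vs.subspace_add[OF subspace]
  fun_vs.subspace_diff[OF subspace] fun_vs.subspace_scale[OF subspace]

lemma diff_eq: "f - g = f + fscale (-1) g"
  by (auto simp: fscale_def)

lemma N_diff_le: "f \<in> V \<Longrightarrow> g \<in> V \<Longrightarrow> N (f - g) \<le> N f + N g"
  using N_triangle[of f "fscale (-1) g"] N_homogeneous[of "-1" g] V_closed(4)[of g "-1"]
  unfolding diff_eq by simp

lemma N_zero: "N 0 = 0"
  using N_homogeneous[of 0 0] by (simp add: fscale_def zero_fun_def)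

lemma N_eq_0: "f \<in> V \<Longrightarrow> N f = 0 \<Longrightarrow> f = 0"
  using norm_le_N[of f] by (auto simp: fun_eq_iff)

lemma N_sum_le: "(\<And>i. i \<in> I \<Longrightarrow> f i \<in> V) \<Longrightarrow> N (\<Sum>i\<in>I. f i) \<le> (\<Sum>i\<in>I. N (f i))"
proof (induction I rule: infinite_finite_induct)
  case (insert x F)
  have "(\<Sum>i\<in>F. f i) \<in> V" using insert by (intro fun_vs.subspace_sum[OF subspace]) auto
  then have "N (f x + (\<Sum>i\<in>F. f i)) \<le> N (f x) + N (\<Sum>i\<in>F. f i)" using insert by (intro N_triangle) auto
  also have "\<dots> \<le> N (f x) + (\<Sum>i\<in>F. N (f i))" using insert by auto
  finally show ?case using insert by (simp add: plus_fun_def)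
qed (auto simp: N_zero)

lemma Q_diff: "f \<in> V \<Longrightarrow> g \<in> V \<Longrightarrow> Q (f - g) = Q f - Q g"
  using Q_add[of f "fscale (-1) g"] Q_fscale[of g "-1"] V_closed(4)[of g "-1"]
  unfolding diff_eq by simp

lemma Qn_in: "f \<in> V \<Longrightarrow> (Q ^^ n) f \<in> V"
  by (induction n) (auto simp: Q_in)

lemma Qn_add: "f \<in> V \<Longrightarrow> g \<in> V \<Longrightarrow> (Q ^^ n) (f + g) = (Q ^^ n) f + (Q ^^ n) g"
  by (induction n) (auto simp: Q_add Qn_in)

lemma Qn_fscale: "f \<in> V \<Longrightarrow> (Q ^^ n) (fscale c f) = fscale c ((Q ^^ n) f)"
  by (induction n) (auto simp: Q_fscale Qn_in)

lemma Qn_diff: "f \<in> V \<Longrightarrow> g \<in> V \<Longrightarrow> (Q ^^ n) (f - g) = (Q ^^ n) f - (Q ^^ n) g"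
  by (induction n) (auto simp: Q_diff Qn_in)

lemma Qn_contraction:
  "f \<in> V \<Longrightarrow> (\<And>p. cmod (f p) \<le> c) \<Longrightarrow> cmod ((Q ^^ n) f p) \<le> c"
  by (induction n arbitrary: p) (auto intro!: Q_contraction Qn_in)

lemma Qn_commute: "(Q ^^ m) ((Q ^^ n) f) = (Q ^^ n) ((Q ^^ m) f)"
  by (simp add: funpow_add[symmetric, unfolded comp_def, THEN fun_cong] add.commute)

lemma Qn_add_exp: "(Q ^^ (m + n)) f = (Q ^^ m) ((Q ^^ n) f)"
  by (simp add: funpow_add)

lemma N_Qn_le:
  assumes "f \<in> V" shows "N ((Q ^^ n) f) \<le> (1 + C) * N f"
proof -
  have "N ((Q ^^ n) f) \<le> e n * N f + C * N f"
    using assms norm_le_N by (intro doeblin_fortet) auto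
  also have "\<dots> \<le> 1 * N f + C * N f"
    using e(3) N_ge_0[of f] by (intro add_right_mono mult_right_mono)
  finally show ?thesis by (simp add: algebra_simps)
qed

text \<open>All powers are contractions in the supremum norm, hence equicontinuous, so the exponent
  may vary along with the function. This permits limits in products of powers.\<close>

lemma Qn_uniform_limit:
  assumes "uniform_limit UNIV fs f sequentially" "\<And>n. fs n \<in> V" "f \<in> V"
  shows "uniform_limit UNIV (\<lambda>n. (Q ^^ k n) (fs n) - (Q ^^ k n) f) (\<lambda>_. 0) sequentially"
  unfolding uniform_limit_sequentially_iff
proof (intro allI impI)
  fix \<epsilon> :: real assume "\<epsilon> > 0"
  then obtain M where M: "\<And>n p. n \<ge> M \<Longrightarrow> dist (fs n p) (f p) < \<epsilon> / 2"
    using uniform_limit_sequentiallyE[OF assms(1) half_gt_zero] by blast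
  have "dist (((Q ^^ k n) (fs n) - (Q ^^ k n) f) p) 0 < \<epsilon>" if "n \<ge> M" for n p
  proof -
    have "cmod ((fs n - f) q) \<le> \<epsilon> / 2" for q
      using M[OF that, of q] by (simp add: dist_norm)
    then have "cmod ((Q ^^ k n) (fs n - f) p) \<le> \<epsilon> / 2"
      using assms V_closed by (intro Qn_contraction) auto
    then show ?thesis using assms \<open>\<epsilon> > 0\<close> by (simp add: Qn_diff dist_norm)
  qed
  then show "\<exists>M. \<forall>n\<ge>M. \<forall>p\<in>UNIV. dist (((Q ^^ k n) (fs n) - (Q ^^ k n) f) p) 0 < \<epsilon>" by blast
qed

lemma compactE:
  assumes "\<And>n. fs n \<in> V" "\<And>n. N (fs n) \<le> B"
  obtains f s where "f \<in> V" "N f \<le> B" "strict_mono (s :: nat \<Rightarrow> nat)"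
    "uniform_limit UNIV (\<lambda>n. fs (s n)) f sequentially"
  using compact[of fs B, OF assms] by (elim exE conjE) (rule that)

text \<open>By \<open>compact\<close> some subsequence converges to a limit obeying the bound, and
  that limit can only be \<open>f\<close>.\<close>

lemma uniform_limit_N_le:
  assumes "uniform_limit UNIV fs f sequentially" "\<And>n. n \<ge> n0 \<Longrightarrow> fs n \<in> V" "\<And>n. n \<ge> n0 \<Longrightarrow> N (fs n) \<le> B"
  shows "f \<in> V" "N f \<le> B"
proof -
  define gs where "gs n = fs (n + n0)" for n
  have "gs n \<in> V" "N (gs n) \<le> B" for n using assms(2,3) by (auto simp: gs_def)
  then obtain g s where g: "g \<in> V" "N g \<le> B" "strict_mono (s :: nat \<Rightarrow> nat)"
      "uniform_limit UNIV (\<lambda>n. gs (s n)) g sequentially"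
    by (rule compactE)
  have "n \<le> s n + n0" for n using seq_suble[OF g(3), of n] by simp
  then have "uniform_limit UNIV (\<lambda>n. gs (s n)) f sequentially"
    using uniform_limit_subseq[OF assms(1), of "\<lambda>n. s n + n0"] by (simp add: gs_def)
  then have "f = g" using g(4) by (rule uniform_limit_eq_fun)
  then show "f \<in> V" "N f \<le> B" using g by auto
qed

text \<open>Without a finite net, an \<epsilon>-separated sequence in \<open>S\<close> could be
  chosen recursively, against \<open>compact\<close>.\<close>

lemma finite_net:
  assumes S: "S \<subseteq> {f \<in> V. N f \<le> B}" and \<epsilon>: "\<epsilon> > 0"
  shows "\<exists>T. finite T \<and> T \<subseteq> S \<and> (\<forall>f\<in>S. \<exists>g\<in>T. \<forall>p. cmod (f p - g p) \<le> \<epsilon>)"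
proof (rule ccontr)
  assume contra: "\<not> ?thesis"
  define P where "P fs n f \<longleftrightarrow> f \<in> S \<and> (\<forall>m<n. \<exists>p. cmod (f p - fs m p) > \<epsilon>)"
    for fs :: "nat \<Rightarrow> 'p \<Rightarrow> complex" and n f
  have "\<exists>fs. \<forall>n. P fs n (fs n)"
  proof (rule dependent_wellorder_choice)
    show "P fs n r = P gs n r" if "\<And>y. y < n \<Longrightarrow> fs y = gs y" for fs gs n r
      using that by (simp add: P_def)
    show "\<exists>r. P fs n r" if *: "\<And>y. y < n \<Longrightarrow> P fs y (fs y)" for n fs
    proof -
      have "finite (fs ` {..<n})" "fs ` {..<n} \<subseteq> S" using * by (auto simp: P_def)
      then obtain f where f: "f \<in> S" "\<forall>g\<in>fs ` {..<n}. \<not> (\<forall>p. cmod (f p - g p) \<le> \<epsilon>)"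
        using contra by metis
      then have "P fs n f" unfolding P_def by (auto simp: not_le)
      then show ?thesis by (rule exI[of _ f])
    qed
  qed
  then obtain fs where Pfs: "P fs n (fs n)" for n by blast
  have fs: "fs n \<in> S" "m < n \<Longrightarrow> \<exists>p. cmod (fs n p - fs m p) > \<epsilon>" for m n
    using Pfs[of n] by (auto simp: P_def)
  have "fs n \<in> V" "N (fs n) \<le> B" for n using fs(1)[of n] S by auto
  then obtain f s where "f \<in> V" "N f \<le> B" and f: "strict_mono (s :: nat \<Rightarrow> nat)"
      "uniform_limit UNIV (\<lambda>n. fs (s n)) f sequentially"
    by (rule compactE)
  obtain M where M: "\<And>n p. n \<ge> M \<Longrightarrow> dist (fs (s n) p) (f p) < \<epsilon> / 2"
    using uniform_limit_sequentiallyE[OF f(2) half_gt_zero[OF \<epsilon>]] by blast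
  obtain p where p: "cmod (fs (s (Suc M)) p - fs (s M) p) > \<epsilon>"
    using fs(2)[of "s M" "s (Suc M)"] f(1) by (auto simp: strict_mono_def)
  have "dist (fs (s (Suc M)) p) (fs (s M) p) < \<epsilon>"
    using M[of "Suc M" p] M[of M p] dist_triangle_half_r[of "f p"] by (metis dist_commute dist_triangle_half_l le_SucI order_refl)
  with p show False by (simp add: dist_norm)
qed

text \<open>Finite nets of all balls of integer radius, at all scales \<open>1 / (j + 1)\<close>,
  are collected. The diagonal extraction of convergent powers rests on this separability.\<close>

lemma countable_dense:
  "\<exists>D :: nat \<Rightarrow> 'p \<Rightarrow> complex. range D \<subseteq> V \<and> (\<forall>f\<in>V. \<forall>\<epsilon>>0. \<exists>n. \<forall>p. cmod (f p - D n p) \<le> \<epsilon>)"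
proof -
  define net where "net i j T \<longleftrightarrow> finite T \<and> T \<subseteq> {f \<in> V. N f \<le> real i} \<and>
      (\<forall>f\<in>{f \<in> V. N f \<le> real i}. \<exists>g\<in>T. \<forall>p. cmod (f p - g p) \<le> inverse (real (Suc j)))" for i j T
  have "\<exists>T. finite T \<and> T \<subseteq> {f \<in> V. N f \<le> real i} \<and>
      (\<forall>f\<in>{f \<in> V. N f \<le> real i}. \<exists>g\<in>T. \<forall>p. cmod (f p - g p) \<le> inverse (real (Suc j)))" for i j
    by (rule finite_net) auto
  then have "\<exists>T. net i j T" for i j unfolding net_def .
  then have "net i j (SOME T. net i j T)" for i j by (rule someI_ex)
  define T where "T i j = (SOME T. net i j T)" for i j
  have "net i j (T i j)" for i j unfolding T_def by fact
  then have T: "finite (T i j)" "T i j \<subseteq> {f \<in> V. N f \<le> real i}"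
      "f \<in> V \<Longrightarrow> N f \<le> real i \<Longrightarrow> \<exists>g\<in>T i j. \<forall>p. cmod (f p - g p) \<le> inverse (real (Suc j))" for i j f
    unfolding net_def by blast+
  define D where "D = (\<Union>i. \<Union>j. T i j) \<union> {0}"
  have "countable D"
    unfolding D_def by (intro countable_Un countable_UN countableI_type countable_finite[OF T(1)]) auto
  moreover have "D \<noteq> {}" by (simp add: D_def)
  moreover have "D \<subseteq> V" unfolding D_def using T(2) V_closed(1) by blast
  ultimately have D: "countable D" "D \<noteq> {}" "D \<subseteq> V" by auto
  show ?thesis
  proof (intro exI[of _ "from_nat_into D"] conjI ballI allI impI)
    show "range (from_nat_into D) \<subseteq> V" using D by (simp add: range_from_nat_into)
    fix f and \<epsilon> :: real assume f: "f \<in> V" and "\<epsilon> > 0"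
    obtain i where i: "N f \<le> real i" using real_arch_simple by blast
    obtain j where j: "inverse (real (Suc j)) < \<epsilon>" using \<open>\<epsilon> > 0\<close> reals_Archimedean by blast
    obtain g where g: "g \<in> T i j" "\<And>p. cmod (f p - g p) \<le> inverse (real (Suc j))"
      using T(3)[OF f i] by blast
    have "g \<in> D" using g by (auto simp: D_def)
    then obtain n where "from_nat_into D n = g" using D by (metis from_nat_into_surj)
    then show "\<exists>n. \<forall>p. cmod (f p - from_nat_into D n p) \<le> \<epsilon>"
      using g(2) j by (intro exI[of _ n]) (meson less_imp_le order_trans)
  qed
qed

text \<open>A diagonal sequence makes the powers converge on a countable dense set; equicontinuity
  extends this to \<open>V\<close>, and \<open>compact\<close> places the limit in
  \<open>V\<close>.\<close>

lemma convergent_powers_subseq: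
  fixes k :: "nat \<Rightarrow> nat"
  shows "\<exists>r. strict_mono (r :: nat \<Rightarrow> nat) \<and>
    (\<forall>f\<in>V. \<exists>g\<in>V. uniform_limit UNIV (\<lambda>n. (Q ^^ k (r n)) f) g sequentially)"
proof -
  obtain D :: "nat \<Rightarrow> 'p \<Rightarrow> complex" where "range D \<subseteq> V"
    and dense': "\<forall>f\<in>V. \<forall>\<epsilon>>0. \<exists>n. \<forall>p. cmod (f p - D n p) \<le> \<epsilon>"
    using countable_dense by (elim exE conjE) (rule that)
  then have DV: "D n \<in> V" for n by auto
  have dense: "\<exists>n. \<forall>p. cmod (f p - D n p) \<le> \<epsilon>" if "f \<in> V" "\<epsilon> > 0" for f \<epsilon>
    using dense' that by blast
  define conv where "conv i s \<longleftrightarrow> (\<exists>g. uniform_limit UNIV (\<lambda>n. (Q ^^ k (s n)) (D i)) g sequentially)"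
    for i and s :: "nat \<Rightarrow> nat"
  interpret subseqs conv
  proof
    fix n and s :: "nat \<Rightarrow> nat"
    show "\<exists>r'. strict_mono r' \<and> conv n (s \<circ> r')"
      unfolding conv_def comp_def
      by (rule compactE[of "\<lambda>j. (Q ^^ k (s j)) (D n)" "(1 + C) * N (D n)", OF Qn_in[OF DV] N_Qn_le[OF DV]])
        blast
  qed
  have conv: "conv i (diagseq \<circ> ((+) (Suc i)))" for i
  proof (rule diagseq_holds)
    fix r s :: "nat \<Rightarrow> nat" and n assume r: "strict_mono r" and "conv n s"
    then obtain g where "uniform_limit UNIV (\<lambda>j. (Q ^^ k (s j)) (D n)) g sequentially"
      unfolding conv_def by (elim exE)
    then have "uniform_limit UNIV (\<lambda>j. (Q ^^ k (s (r j))) (D n)) g sequentially"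
      using seq_suble[OF r] by (rule uniform_limit_subseq)
    then show "conv n (s \<circ> r)" unfolding conv_def comp_def by (rule exI[of _ g])
  qed
  show ?thesis
  proof (intro exI[of _ diagseq] conjI ballI subseq_diagseq)
    fix f assume f: "f \<in> V"
    define F where "F n = (Q ^^ k (diagseq n)) f" for n
    have "F n \<in> V" "N (F n) \<le> (1 + C) * N f" for n
      using Qn_in[OF f] N_Qn_le[OF f] by (auto simp: F_def)
    then obtain g s where "g \<in> V" "N g \<le> (1 + C) * N f" "strict_mono (s :: nat \<Rightarrow> nat)"
        "uniform_limit UNIV (\<lambda>n. F (s n)) g sequentially"
      by (rule compactE)
    note g = this(1,3,4)
    have "uniform_limit UNIV F g sequentially"
      unfolding uniform_limit_sequentially_iff
    proof (intro allI impI)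
      fix \<epsilon> :: real assume "\<epsilon> > 0"
      \<comment> \<open>Passing from \<open>f\<close> to \<open>D i\<close> and on to the limit
        \<open>h\<close> costs 2/5 of \<epsilon>. This is done at the index \<open>n\<close> and at
        \<open>s j\<close>; the last fifth is the distance from \<open>F (s j)\<close> to
        \<open>g\<close>.\<close>
      then have "\<epsilon> / 5 > 0" by simp
      then obtain i where i: "\<And>p. cmod (f p - D i p) \<le> \<epsilon> / 5" using dense[OF f] by blast
      have approx: "dist ((Q ^^ m) f p) ((Q ^^ m) (D i) p) \<le> \<epsilon> / 5" for m p
      proof -
        have "cmod ((Q ^^ m) (f - D i) p) \<le> \<epsilon> / 5"
          using i f DV V_closed by (intro Qn_contraction) auto
        then show ?thesis using f DV by (simp add: Qn_diff dist_norm)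
      qed
      obtain h where h: "uniform_limit UNIV (\<lambda>n. (Q ^^ k (diagseq (Suc i + n))) (D i)) h sequentially"
        using conv[of i, unfolded comp_def] unfolding conv_def[of i "\<lambda>x. diagseq (Suc i + x)"]
        by (elim exE) (rule that)
      obtain M where M: "\<And>n p. n \<ge> M \<Longrightarrow> dist ((Q ^^ k (diagseq (Suc i + n))) (D i) p) (h p) < \<epsilon> / 5"
        using uniform_limit_sequentiallyE[OF h \<open>\<epsilon> / 5 > 0\<close>] by blast
      obtain M' where M': "\<And>n p. n \<ge> M' \<Longrightarrow> dist (F (s n) p) (g p) < \<epsilon> / 5"
        using uniform_limit_sequentiallyE[OF g(3) \<open>\<epsilon> / 5 > 0\<close>] by blast
      have near: "dist (F n p) (h p) < 2 * \<epsilon> / 5" if "n \<ge> Suc i + M" for n p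
        using approx[of "k (diagseq n)" p] M[of "n - Suc i" p] that dist_triangle[of "F n p" "h p" "(Q ^^ k (diagseq n)) (D i) p"]
        unfolding F_def by (simp add: le_diff_conv2 add.commute)
      define j where "j = Suc i + M + M'"
      have sj: "s j \<ge> Suc i + M" "j \<ge> M'" using seq_suble[OF g(2), of j] by (auto simp: j_def)
      have "dist (F n p) (g p) < \<epsilon>" if "n \<ge> Suc i + M" for n p
        using near[OF that, of p] near[OF sj(1), of p] M'[OF sj(2), of p] 
          dist_triangle[of "F n p" "g p" "h p"] dist_triangle[of "h p" "g p" "F (s j) p"]
        by (simp add: dist_commute)
      then show "\<exists>M. \<forall>n\<ge>M. \<forall>p\<in>UNIV. dist (F n p) (g p) < \<epsilon>" by blast
    qed
    then show "\<exists>g\<in>V. uniform_limit UNIV (\<lambda>n. (Q ^^ k (diagseq n)) f) g sequentially"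
      using g(1) unfolding F_def by blast
  qed
qed

lemma convergent_powers_subseqE:
  fixes k :: "nat \<Rightarrow> nat"
  obtains r T where "strict_mono (r :: nat \<Rightarrow> nat)"
    "\<forall>f\<in>V. T f \<in> V \<and> uniform_limit UNIV (\<lambda>n. (Q ^^ k (r n)) f) (T f) sequentially"
proof -
  obtain r where r: "strict_mono (r :: nat \<Rightarrow> nat)"
    and ex: "\<forall>f\<in>V. \<exists>g\<in>V. uniform_limit UNIV (\<lambda>n. (Q ^^ k (r n)) f) g sequentially"
    using convergent_powers_subseq[of k] by (elim exE conjE) (rule that)
  from bchoice[OF ex[unfolded Bex_def]] obtain T
    where "\<forall>f\<in>V. T f \<in> V \<and> uniform_limit UNIV (\<lambda>n. (Q ^^ k (r n)) f) (T f) sequentially" by (elim exE) (rule that)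
  with r show ?thesis by (rule that)
qed

text \<open>The limit \<open>T\<close> of \<open>Q\<^bsup>s n\<^esup>\<close> need not be idempotent. The limit \<open>P\<close> of powers with exponents
  \<open>s (2 * s i) - s i\<close> satisfies \<open>P T = T\<close>, \<open>T P = T\<close> and \<open>ker T \<subseteq> ker P\<close>, which makes it idempotent.\<close>

lemma idempotent_limit:
  "\<exists>P m. (\<forall>j. j \<le> m j) \<and> (\<forall>f\<in>V. P f \<in> V \<and> P (P f) = P f \<and>
     uniform_limit UNIV (\<lambda>j. (Q ^^ m j) f) (P f) sequentially)"
proof -
  obtain s T where s: "strict_mono (s :: nat \<Rightarrow> nat)"
    and T': "\<forall>f\<in>V. T f \<in> V \<and> uniform_limit UNIV (\<lambda>n. (Q ^^ s n) f) (T f) sequentially"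
    by (rule convergent_powers_subseqE[of "\<lambda>n. n"])
  have T: "T f \<in> V" "uniform_limit UNIV (\<lambda>n. (Q ^^ s n) f) (T f) sequentially" if "f \<in> V" for f
    using T' that by blast+
  \<comment> \<open>Composing the powers \<open>d i\<close> and \<open>s i\<close> gives the power
    \<open>s (2 * s i)\<close>, whose limit is again \<open>T\<close>. The factor 2 keeps
    \<open>d i \<ge> i\<close>.\<close>
  define d where "d i = s (2 * s i) - s i" for i
  have sge: "i \<le> s i" for i using s by (rule seq_suble)
  have d: "d i + s i = s (2 * s i)" "i \<le> d i" for i
    using sge[of "2 * s i"] sge[of i] by (auto simp: d_def)
  obtain r P where r: "strict_mono (r :: nat \<Rightarrow> nat)"
    and P': "\<forall>f\<in>V. P f \<in> V \<and> uniform_limit UNIV (\<lambda>n. (Q ^^ d (r n)) f) (P f) sequentially"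
    by (rule convergent_powers_subseqE[of d])
  have P: "P f \<in> V" "uniform_limit UNIV (\<lambda>n. (Q ^^ d (r n)) f) (P f) sequentially" if "f \<in> V" for f
    using P' that by blast+
  have rge: "i \<le> r i" for i using r by (rule seq_suble)
  have PT: "P (T f) = T f" if f: "f \<in> V" for f
  proof (rule uniform_limit_eq_fun)
    show "uniform_limit UNIV (\<lambda>n. (Q ^^ d (r n)) (T f)) (P (T f)) sequentially" using P(2) T(1) f by blast
    have "uniform_limit UNIV (\<lambda>n. (Q ^^ s (r n)) f) (T f) sequentially"
      using T(2)[OF f] rge by (rule uniform_limit_subseq)
    then have 1: "uniform_limit UNIV (\<lambda>n. (Q ^^ d (r n)) ((Q ^^ s (r n)) f) - (Q ^^ d (r n)) (T f)) (\<lambda>_. 0) sequentially"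
      by (rule Qn_uniform_limit[of _ _ "\<lambda>n. d (r n)", OF _ Qn_in[OF f] T(1)[OF f]])
    have 2: "uniform_limit UNIV (\<lambda>n. (Q ^^ s (2 * s (r n))) f) (T f) sequentially"
    proof (rule uniform_limit_subseq[OF T(2)[OF f]])
      show "n \<le> 2 * s (r n)" for n using rge[of n] sge[of "r n"] by linarith
    qed
    show "uniform_limit UNIV (\<lambda>n. (Q ^^ d (r n)) (T f)) (T f) sequentially"
      using uniform_limit_minus_fun[OF 2 1] d(1) by (simp add: Qn_add_exp[symmetric] fun_diff_def)
  qed
  have Tlin: "T (f - g) = T f - T g" if "f \<in> V" "g \<in> V" for f g
    by (rule uniform_limit_eq_fun[OF T(2)]) (use that V_closed uniform_limit_minus_fun[OF T(2) T(2)] in \<open>auto simp: Qn_diff\<close>)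
  have TP: "T (P f) = T f" if f: "f \<in> V" for f
  proof (rule uniform_limit_eq_fun)
    show "uniform_limit UNIV (\<lambda>n. (Q ^^ s n) (P f)) (T (P f)) sequentially" using P T f by blast
    have PQ: "P ((Q ^^ n) f) = (Q ^^ n) (P f)" for n
    proof (rule uniform_limit_eq_fun)
      show "uniform_limit UNIV (\<lambda>j. (Q ^^ d (r j)) ((Q ^^ n) f)) (P ((Q ^^ n) f)) sequentially"
        using P(2) Qn_in f by blast
      have 1: "uniform_limit UNIV (\<lambda>j. (Q ^^ n) ((Q ^^ d (r j)) f) - (Q ^^ n) (P f)) (\<lambda>_. 0) sequentially"
        by (rule Qn_uniform_limit[of _ _ "\<lambda>_. n", OF P(2)[OF f] Qn_in[OF f] P(1)[OF f]])
      show "uniform_limit UNIV (\<lambda>j. (Q ^^ d (r j)) ((Q ^^ n) f)) ((Q ^^ n) (P f)) sequentially"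
        using uniform_limit_plus_fun[OF 1 uniform_limit_const[where c = "(Q ^^ n) (P f)" and S = UNIV]]
        by (simp add: Qn_commute[of _ n] plus_fun_def)
    qed
    have "uniform_limit UNIV (\<lambda>n. P ((Q ^^ s n) f)) (P (T f)) sequentially"
      unfolding uniform_limit_sequentially_iff
    proof (intro allI impI)
      fix \<epsilon> :: real assume "\<epsilon> > 0"
      then obtain M where M: "\<And>n p. n \<ge> M \<Longrightarrow> dist ((Q ^^ s n) f p) (T f p) < \<epsilon> / 2"
        using uniform_limit_sequentiallyE[OF T(2)[OF f] half_gt_zero] by blast
      have "dist (P ((Q ^^ s n) f) p) (P (T f) p) < \<epsilon>" if "n \<ge> M" for n p
      proof -
        have "cmod ((P ((Q ^^ s n) f) - P (T f)) p) \<le> \<epsilon> / 2"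
        proof (rule uniform_limit_bound[where f = "P ((Q ^^ s n) f) - P (T f)" and p = p])
          show "uniform_limit UNIV (\<lambda>j. (Q ^^ d (r j)) ((Q ^^ s n) f) - (Q ^^ d (r j)) (T f)) (P ((Q ^^ s n) f) - P (T f)) sequentially"
            using P(2) Qn_in f T by (intro uniform_limit_minus_fun) auto
          have "cmod (((Q ^^ s n) f - T f) q) \<le> \<epsilon> / 2" for q
            using M[OF that, of q] by (simp add: dist_norm)
          then have "cmod ((Q ^^ d (r j)) ((Q ^^ s n) f - T f) p) \<le> \<epsilon> / 2" for j
            using f T Qn_in V_closed by (intro Qn_contraction) auto
          then show "cmod (((Q ^^ d (r j)) ((Q ^^ s n) f) - (Q ^^ d (r j)) (T f)) p) \<le> \<epsilon> / 2" for j
            using f T Qn_in by (simp add: Qn_diff)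
        qed
        then show ?thesis using \<open>\<epsilon> > 0\<close> by (simp add: dist_norm)
      qed
      then show "\<exists>M. \<forall>n\<ge>M. \<forall>p\<in>UNIV. dist (P ((Q ^^ s n) f) p) (P (T f) p) < \<epsilon>" by blast
    qed
    then show "uniform_limit UNIV (\<lambda>n. (Q ^^ s n) (P f)) (T f) sequentially"
      using PQ PT[OF f] by simp
  qed
  \<comment> \<open>Contractivity propagates smallness: once one power of \<open>f\<close> is
    uniformly small, so are all later ones.\<close>
  have ker: "P f = 0" if f: "f \<in> V" and T0: "T f = 0" for f
  proof (rule uniform_limit_eq_fun[OF P(2)[OF f]])
    show "uniform_limit UNIV (\<lambda>n. (Q ^^ d (r n)) f) 0 sequentially"
      unfolding uniform_limit_sequentially_iff
    proof (intro allI impI)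
      fix \<epsilon> :: real assume "\<epsilon> > 0"
      then obtain M where M: "\<And>p. dist ((Q ^^ s M) f p) 0 < \<epsilon> / 2"
        using uniform_limit_sequentiallyE[OF T(2)[OF f] half_gt_zero[OF \<open>\<epsilon> > 0\<close>]] T0 by (metis order_refl zero_fun_apply)
      have "dist ((Q ^^ d (r n)) f p) (0 p) < \<epsilon>" if "n \<ge> s M" for n p
      proof -
        have "d (r n) = (d (r n) - s M) + s M"
          using that d(2)[of "r n"] rge[of n] by simp
        then have "(Q ^^ d (r n)) f = (Q ^^ (d (r n) - s M)) ((Q ^^ s M) f)"
          by (metis Qn_add_exp)
        moreover have "cmod ((Q ^^ (d (r n) - s M)) ((Q ^^ s M) f) p) \<le> \<epsilon> / 2"
          using M f by (intro Qn_contraction[of "(Q ^^ s M) f"] Qn_in) (auto intro: less_imp_le)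
        ultimately show ?thesis using \<open>\<epsilon> > 0\<close> by simp
      qed
      then show "\<exists>M. \<forall>n\<ge>M. \<forall>p\<in>UNIV. dist ((Q ^^ d (r n)) f p) (0 p) < \<epsilon>" by blast
    qed
  qed
  \<comment> \<open>\<open>T\<close> does not distinguish \<open>P f\<close> from \<open>f\<close>,
    so their difference lies in the kernel of \<open>T\<close>, hence in that of
    \<open>P\<close>.\<close>
  have idem: "P (P f) = P f" if f: "f \<in> V" for f
  proof -
    have "P (P f - f) = P (P f) - P f"
      by (rule uniform_limit_eq_fun[OF P(2)])
        (use f P V_closed uniform_limit_minus_fun[OF P(2) P(2)] in \<open>auto simp: Qn_diff\<close>)
    moreover have "P (P f - f) = 0"
      using f P V_closed by (intro ker) (auto simp: Tlin TP)
    ultimately show ?thesis by simp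
  qed
  show ?thesis
    by (intro exI[of _ P] exI[of _ "\<lambda>n. d (r n)"]) (use P idem d(2) rge order_trans in blast)
qed

end

section \<open>Resolvents\<close>

lemma spectral_radius_le:
  assumes "\<And>z. \<rho> < cmod z \<Longrightarrow> z \<notin> op_spectrum V N Q"
  shows "spectral_radius V N Q \<le> ennreal \<rho>"
  unfolding spectral_radius_def by (intro SUP_least ennreal_leI) (use assms not_le in blast)

lemma sum_power_interval_le:
  fixes q :: real
  assumes "0 \<le> q" "q < 1" "n \<le> m"
  shows "(\<Sum>i=n..<m. q ^ i) \<le> q ^ n / (1 - q)"
proof -
  have "(1 - q) * (\<Sum>i=n..<m. q ^ i) = q ^ n - q ^ m"
    using assms(3)
  proof (induction rule: dec_induct)
    case (step m)
    then have "(1 - q) * (\<Sum>i=n..<Suc m. q ^ i) = (q ^ n - q ^ m) + (1 - q) * q ^ m"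
      by (simp add: distrib_left del: power_Suc)
    then show ?case by (simp add: left_diff_distrib)
  qed simp
  then have "(\<Sum>i=n..<m. q ^ i) = (q ^ n - q ^ m) / (1 - q)"
    using assms(2) by (simp add: field_simps)
  also have "\<dots> \<le> q ^ n / (1 - q)" using assms by (intro divide_right_mono) auto
  finally show ?thesis .
qed

lemma le_power_imp_nonpos:
  fixes x :: real
  assumes "0 \<le> q" "q < 1" "\<And>n. x \<le> K * q ^ n"
  shows "x \<le> 0"
proof (rule LIMSEQ_le_const)
  have "(\<lambda>n. q ^ n) \<longlonglongrightarrow> 0" using assms(1,2) by (intro LIMSEQ_power_zero) auto
  then show "(\<lambda>n. K * q ^ n) \<longlonglongrightarrow> 0" by (rule tendsto_mult_right_zero)
qed (use assms(3) in blast)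

context doeblin_fortet
begin

lemma N_commute: "N (f - g) = N (g - f)"
proof -
  have "N (fscale (-1) (g - f)) = cmod (-1) * N (g - f)" by (rule N_homogeneous)
  moreover have "fscale (-1) (g - f) = f - g" by (auto simp: fscale_def)
  ultimately show ?thesis by simp
qed

lemma closed_subspaceI:
  assumes "fun_vs.subspace S" "S \<subseteq> V"
    and closed: "\<And>fs l. (\<And>n. fs n \<in> S) \<Longrightarrow> l \<in> V \<Longrightarrow> (\<lambda>n. N (fs n - l)) \<longlonglongrightarrow> 0 \<Longrightarrow> l \<in> S"
  shows "closed_subspace V N S"
proof -
  interpret M: Metric_space V "\<lambda>f g. N (f - g)"
  proof
    fix f g h
    show "N (f - g) = N (g - f)" by (rule N_commute)
    show "0 \<le> N (f - g)" by (rule N_ge_0)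
    show "(N (f - g) = 0) = (f = g)" if "f \<in> V" "g \<in> V"
      using N_eq_0[of "f - g"] V_closed(3)[OF that] N_zero by auto
    show "N (f - h) \<le> N (f - g) + N (g - h)" if "f \<in> V" "g \<in> V" "h \<in> V"
      using N_triangle[of "f - g" "g - h"] that V_closed by simp
  qed
  show ?thesis
    unfolding closed_subspace_def M.metric_closedin_iff_sequentially_closed M.limitin_metric_dist_null
  proof (intro conjI allI impI assms(1,2))
    fix \<sigma> l
    assume *: "range \<sigma> \<subseteq> S \<and> l \<in> V \<and> (\<forall>\<^sub>F x in sequentially. \<sigma> x \<in> V) \<and> (\<lambda>x. N (\<sigma> x - l)) \<longlonglongrightarrow> 0"
    show "l \<in> S"
    proof (rule closed)
      show "\<sigma> n \<in> S" for n using * by blast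
    qed (use * in auto)
  qed
qed

text \<open>The resolvent is the Neumann series of terms \<open>inverse z ^ Suc i\<close> times
  \<open>(Q ^^ i) f\<close>, geometrically convergent with ratio \<open>\<rho> / cmod z\<close>. A
  uniformly convergent subsequence of partial sums supplies the limit. A general invariant
  \<open>S\<close> covers both the whole space and the kernel of the idempotent.\<close>

lemma not_in_op_spectrum:
  assumes S: "fun_vs.subspace S" "S \<subseteq> V" "\<And>f. f \<in> S \<Longrightarrow> Q f \<in> S"
    and closed: "\<And>fs l. (\<And>n. fs n \<in> S) \<Longrightarrow> l \<in> V \<Longrightarrow> (\<lambda>n. N (fs n - l)) \<longlonglongrightarrow> 0 \<Longrightarrow> l \<in> S"
    and bound: "\<And>n f. f \<in> S \<Longrightarrow> N ((Q ^^ n) f) \<le> D * \<rho> ^ n * N f"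
    and D: "0 \<le> D" and \<rho>: "0 \<le> \<rho>" "\<rho> < cmod z"
  shows "z \<notin> op_spectrum S N Q"
proof -
  define q where "q = \<rho> / cmod z"
  have z: "cmod z > 0" "z \<noteq> 0" using \<rho> by auto
  have q: "0 \<le> q" "q < 1" using \<rho> z by (auto simp: q_def)
  have SV: "f \<in> V" if "f \<in> S" for f using S(2) that by blast
  have QnS: "(Q ^^ n) f \<in> S" if "f \<in> S" for n f using that S(3) by (induction n) auto
  define B where "B = D / cmod z / (1 - q)"
  have B: "0 \<le> B" using D z q by (simp add: B_def)
  have ex: "\<exists>g. g \<in> S \<and> fscale z g - Q g = f \<and> N g \<le> B * N f" if f: "f \<in> S" for f
  proof -
    define t where "t i = fscale (inverse z ^ Suc i) ((Q ^^ i) f)" for i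
    define s where "s n = (\<Sum>i<n. t i)" for n
    have tS: "t i \<in> S" for i unfolding t_def using QnS f S(1) by (intro fun_vs.subspace_scale)
    have sS: "s n \<in> S" for n unfolding s_def by (intro fun_vs.subspace_sum S tS)
    have Nt: "N (t i) \<le> (D / cmod z * N f) * q ^ i" for i
    proof -
      have "N (t i) = inverse (cmod z) ^ Suc i * N ((Q ^^ i) f)"
        unfolding t_def using N_homogeneous by (simp add: norm_power norm_inverse norm_mult)
      also have "\<dots> \<le> inverse (cmod z) ^ Suc i * (D * \<rho> ^ i * N f)"
        using bound[OF f, of i] by (intro mult_left_mono) auto
      also have "\<dots> = (D / cmod z * N f) * q ^ i"
        by (simp add: q_def power_divide field_simps)
      finally show ?thesis .
    qed
    have Ns: "N (s m - s n) \<le> (B * N f) * q ^ n" if "n \<le> m" for n m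
    proof -
      have "s m = s n + (\<Sum>i=n..<m. t i)"
        using sum.atLeastLessThan_concat[of 0 n m t] that by (simp add: s_def lessThan_atLeast0)
      then have "N (s m - s n) = N (\<Sum>i=n..<m. t i)" by simp
      also have "\<dots> \<le> (\<Sum>i=n..<m. N (t i))" using tS SV by (intro N_sum_le) auto
      also have "\<dots> \<le> (\<Sum>i=n..<m. (D / cmod z * N f) * q ^ i)" by (intro sum_mono Nt)
      also have "\<dots> = (D / cmod z * N f) * (\<Sum>i=n..<m. q ^ i)" by (simp add: sum_distrib_left)
      also have "\<dots> \<le> (D / cmod z * N f) * (q ^ n / (1 - q))"
        using D N_ge_0[of f] q that by (intro mult_left_mono sum_power_interval_le) auto
      also have "\<dots> = (B * N f) * q ^ n" by (simp add: B_def)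
      finally show ?thesis .
    qed
    have s0: "s 0 = 0" by (simp add: s_def)
    have "s n \<in> V" "N (s n) \<le> B * N f" for n
      using SV[OF sS] Ns[of 0 n] s0 by auto
    then obtain g \<sigma> where g: "g \<in> V" "N g \<le> B * N f" and \<sigma>: "strict_mono (\<sigma> :: nat \<Rightarrow> nat)"
        and lim: "uniform_limit UNIV (\<lambda>n. s (\<sigma> n)) g sequentially"
      by (rule compactE)
    \<comment> \<open>Lower semicontinuity of \<open>N\<close> turns the uniform limit of partial
      sums into a limit in \<open>N\<close>, with the tail bound intact.\<close>
    have Ng: "N (g - s n) \<le> (B * N f) * q ^ n" for n
    proof (rule uniform_limit_N_le)
      show "uniform_limit UNIV (\<lambda>j. s (\<sigma> j) - s n) (g - s n) sequentially"
        using uniform_limit_minus_fun[OF lim uniform_limit_const[where c = "s n" and S = UNIV]]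
        by (simp add: fun_diff_def)
      show "s (\<sigma> j) - s n \<in> V" for j by (intro V_closed SV sS)
      show "N (s (\<sigma> j) - s n) \<le> (B * N f) * q ^ n" if "n \<le> j" for j
        using seq_suble[OF \<sigma>, of j] that by (intro Ns) simp
    qed
    have gS: "g \<in> S"
    proof (rule closed[OF sS g(1)])
      have Nsg: "N (s n - g) \<le> (B * N f) * q ^ n" for n
        using Ng[of n] N_commute[of g] by simp
      show "(\<lambda>n. N (s n - g)) \<longlonglongrightarrow> 0"
      proof (rule Lim_null_comparison[rotated])
        show "(\<lambda>n. (B * N f) * q ^ n) \<longlonglongrightarrow> 0"
          using q by (intro tendsto_mult_right_zero LIMSEQ_power_zero) auto
      qed (simp add: N_ge_0 Nsg)
    qed
    \<comment> \<open>Telescoping: the partial sum inverts \<open>z - Q\<close> up to a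
      geometrically small remainder.\<close>
    have Qs: "fscale z (s n) - Q (s n) = f - fscale (inverse z ^ n) ((Q ^^ n) f)" for n
    proof (induction n)
      case 0
      have Q0: "Q 0 = 0" using Q_diff[OF V_closed(1) V_closed(1)] by simp
      show ?case unfolding s0 Q0 by (intro ext) (simp add: fscale_def)
    next
      case (Suc n)
      have sSuc: "s (Suc n) = s n + t n" by (simp add: s_def)
      then have QSuc: "Q (s (Suc n)) = Q (s n) + fscale (inverse z ^ Suc n) (Q ((Q ^^ n) f))"
        using SV[OF sS] SV[OF tS] SV[OF QnS[OF f]] by (simp add: Q_add t_def Q_fscale del: power_Suc)
      have "fscale z (s (Suc n)) - Q (s (Suc n)) =
          (fscale z (s n) - Q (s n)) + fscale z (t n) - fscale (inverse z ^ Suc n) ((Q ^^ Suc n) f)"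
        unfolding QSuc unfolding sSuc by (intro ext) (simp add: fscale_def algebra_simps)
      also have "fscale z (t n) = fscale (inverse z ^ n) ((Q ^^ n) f)"
        unfolding t_def using z by (intro ext) (simp add: fscale_def)
      finally show ?case using Suc.IH by simp
    qed
    have "N (fscale z g - Q g - f) \<le> (cmod z * (B * N f) + (1 + C) * (B * N f) + D * N f) * q ^ n" for n
    proof -
      let ?h = "g - s n"
      have hV: "?h \<in> V" by (intro V_closed g SV sS)
      have 1: "N (fscale z ?h) \<le> cmod z * ((B * N f) * q ^ n)"
        using N_homogeneous Ng[of n] by (simp add: mult_left_mono)
      have 2: "N (Q ?h) \<le> (1 + C) * ((B * N f) * q ^ n)"
        using N_Qn_le[OF hV, of 1] Ng[of n] C
        by (simp, meson add_nonneg_nonneg mult_left_mono order_trans zero_le_one)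
      have "N (fscale (inverse z ^ n) ((Q ^^ n) f)) = inverse (cmod z) ^ n * N ((Q ^^ n) f)"
        using N_homogeneous by (simp add: norm_power norm_inverse)
      also have "\<dots> \<le> inverse (cmod z) ^ n * (D * \<rho> ^ n * N f)"
        using bound[OF f, of n] by (intro mult_left_mono) auto
      also have "\<dots> = D * N f * q ^ n" by (simp add: q_def power_divide field_simps)
      finally have 3: "N (fscale (inverse z ^ n) ((Q ^^ n) f)) \<le> D * N f * q ^ n" .
      have "fscale z g - Q g - f = (fscale z ?h - Q ?h) + (fscale z (s n) - Q (s n) - f)"
        unfolding Q_diff[OF g(1) SV[OF sS]] by (auto simp: fscale_def fun_eq_iff algebra_simps)
      also have "\<dots> = (fscale z ?h - Q ?h) - fscale (inverse z ^ n) ((Q ^^ n) f)"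
        unfolding Qs by simp
      finally have "N (fscale z g - Q g - f) \<le> N (fscale z ?h - Q ?h) + N (fscale (inverse z ^ n) ((Q ^^ n) f))"
        by (simp only:) (intro N_diff_le V_closed hV Q_in Qn_in SV f)
      also have "N (fscale z ?h - Q ?h) \<le> N (fscale z ?h) + N (Q ?h)"
        by (intro N_diff_le V_closed hV Q_in)
      finally show ?thesis using 1 2 3 by (simp add: algebra_simps)
    qed
    then have "N (fscale z g - Q g - f) \<le> 0" by (rule le_power_imp_nonpos[OF q])
    moreover have dV: "fscale z g - Q g - f \<in> V" by (intro V_closed g Q_in SV f)
    ultimately have "fscale z g - Q g - f = 0" using N_ge_0[of "fscale z g - Q g - f"] by (intro N_eq_0) auto
    then show ?thesis using gS g(2) by auto
  qed
  \<comment> \<open>An eigenfunction for \<open>z\<close> would grow like \<open>cmod z ^ n\<close>,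
    faster than the assumed bound allows. Uniqueness also makes the chosen inverse \<open>R\<close>
    linear.\<close>
  have uniq: "g = 0" if g: "g \<in> S" and eq: "fscale z g = Q g" for g
  proof -
    have "(Q ^^ n) g = fscale (z ^ n) g" for n
    proof (induction n)
      case (Suc n)
      then have "(Q ^^ Suc n) g = fscale (z ^ n) (Q g)" using SV[OF g] by (simp add: Q_fscale)
      then show ?case unfolding eq[symmetric] by (simp add: fscale_def mult_ac)
    qed (simp add: fscale_def)
    then have "cmod z ^ n * N g \<le> D * \<rho> ^ n * N g" for n
      using bound[OF g, of n] N_homogeneous by (simp add: norm_power)
    then have "N g \<le> (D * N g) * q ^ n" for n
      using z by (simp add: q_def power_divide field_simps)
    then have "N g \<le> 0" by (rule le_power_imp_nonpos[OF q])
    then show ?thesis using N_ge_0[of g] SV[OF g] by (intro N_eq_0) auto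
  qed
  define R where "R f = (SOME g. g \<in> S \<and> fscale z g - Q g = f \<and> N g \<le> B * N f)" for f
  have R: "R f \<in> S \<and> fscale z (R f) - Q (R f) = f \<and> N (R f) \<le> B * N f" if "f \<in> S" for f
    unfolding R_def by (rule someI_ex[OF ex[OF that]])
  have RI: "R f = g" if "f \<in> S" "g \<in> S" "fscale z g - Q g = f" for f g
  proof -
    have dS: "R f - g \<in> S" using R[OF that(1)] that S(1) by (intro fun_vs.subspace_diff) auto
    have "Q (R f - g) = Q (R f) - Q g" using R[OF that(1)] that SV by (intro Q_diff) auto
    also have "\<dots> = fscale z (R f) - fscale z g"
      using R[OF that(1)] that(3) by (metis diff_diff_eq2 add_diff_cancel_left' diff_add_cancel)
    finally have "fscale z (R f - g) = Q (R f - g)" by (simp only: fun_vs.scale_right_diff_distrib)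
    from uniq[OF dS this] show ?thesis by simp
  qed
  have "bounded_op S N R"
    unfolding bounded_op_def
  proof (intro conjI ballI allI exI[of _ B])
    fix f g c assume f: "f \<in> S" and g: "g \<in> S"
    show "R (f + g) = R f + R g"
    proof (rule RI)
      show "fscale z (R f + R g) - Q (R f + R g) = f + g"
        using R[OF f] R[OF g] SV Q_add[of "R f" "R g"] fun_vs.scale_right_distrib[of z "R f" "R g"]
        by (metis add_diff_add)
    qed (use f g S R in \<open>auto intro!: fun_vs.subspace_add\<close>)
    show "R (fscale c f) = fscale c (R f)"
    proof (rule RI)
      have "Q (fscale c (R f)) = fscale c (Q (R f))"
        using R[OF f] SV by (intro Q_fscale) auto
      then have "fscale z (fscale c (R f)) - Q (fscale c (R f)) = fscale c (fscale z (R f) - Q (R f))"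
        by (simp only: fun_vs.scale_right_diff_distrib fun_vs.scale_left_commute)
      then show "fscale z (fscale c (R f)) - Q (fscale c (R f)) = fscale c f" using R[OF f] by simp
    qed (use f S R in \<open>auto intro!: fun_vs.subspace_scale\<close>)
  qed (use R in auto)
  moreover have "R (fscale z f - Q f) = f \<and> fscale z (R f) - Q (R f) = f" if f: "f \<in> S" for f
    using R[OF f] f S by (auto intro!: RI fun_vs.subspace_diff fun_vs.subspace_scale)
  ultimately show ?thesis unfolding op_spectrum_def by blast
qed

lemma bounded_op_Q: "bounded_op V N Q"
  unfolding bounded_op_def
proof (intro conjI ballI allI exI[of _ "1 + C"])
  show "N (Q f) \<le> (1 + C) * N f" if "f \<in> V" for f using N_Qn_le[OF that, of 1] by simp
qed (auto intro: Q_in Q_add Q_fscale)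

text \<open>Power boundedness bounds the spectrum by 1. Conversely, \<open>1 - Q\<close> kills the
  constant function, so an inverse at 1 would send 0 to it.\<close>

lemma spectral_radius_eq_1: "spectral_radius V N Q = 1"
proof (rule antisym)
  have "spectral_radius V N Q \<le> ennreal 1"
  proof (rule spectral_radius_le)
    fix z assume "1 < cmod z"
    then show "z \<notin> op_spectrum V N Q"
      using C N_Qn_le by (intro not_in_op_spectrum[where D = "1 + C" and \<rho> = 1] subspace Q_in) auto
  qed
  then show "spectral_radius V N Q \<le> 1" by simp
  have "1 \<in> op_spectrum V N Q"
    unfolding op_spectrum_def
  proof (rule CollectI, rule notI, elim exE conjE)
    fix R assume "bounded_op V N R" and R: "\<forall>f\<in>V. R (fscale 1 f - Q f) = f \<and> fscale 1 (R f) - Q (R f) = f"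
    have "R (fscale 1 (\<lambda>_. 1) - Q (\<lambda>_. 1)) = (\<lambda>_. 1)" using R one(1) by blast
    moreover have "fscale 1 (\<lambda>_. 1) - Q (\<lambda>_. 1) = 0" unfolding one(2) by (auto simp: fscale_def)
    moreover have "R 0 = 0"
      using \<open>bounded_op V N R\<close> V_closed(1) unfolding bounded_op_def
      by (metis fun_vs.scale_zero_left)
    ultimately have "(\<lambda>_. 1 :: complex) = (0 :: 'p \<Rightarrow> complex)" by metis
    then show False by (simp add: fun_eq_iff)
  qed
  then have "ennreal (cmod 1) \<le> spectral_radius V N Q"
    unfolding spectral_radius_def by (rule SUP_upper)
  then show "1 \<le> spectral_radius V N Q" by simp
qed

end

section \<open>The spectral decomposition\<close>

text \<open>The condition on \<open>m\<close> makes the exponents tend to infinity: then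
  \<open>e (m j)\<close> vanishes in the limit, and eigenvalues inside the unit disc cannot
  recur.\<close>

locale doeblin_fortet_projection = doeblin_fortet +
  fixes P :: "('a \<Rightarrow> complex) \<Rightarrow> 'a \<Rightarrow> complex" and m :: "nat \<Rightarrow> nat"
  assumes m: "\<And>j. j \<le> m j"
    and P_in: "\<And>f. f \<in> V \<Longrightarrow> P f \<in> V"
    and P_idem: "\<And>f. f \<in> V \<Longrightarrow> P (P f) = P f"
    and P_lim: "\<And>f. f \<in> V \<Longrightarrow> uniform_limit UNIV (\<lambda>j. (Q ^^ m j) f) (P f) sequentially"
begin

lemma P_eqI: "f \<in> V \<Longrightarrow> uniform_limit UNIV (\<lambda>j. (Q ^^ m j) f) g sequentially \<Longrightarrow> P f = g"
  using P_lim uniform_limit_eq_fun by blast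

lemma P_add: "P (f + g) = P f + P g" if "f \<in> V" "g \<in> V"
proof (rule P_eqI)
  show "uniform_limit UNIV (\<lambda>j. (Q ^^ m j) (f + g)) (P f + P g) sequentially"
    unfolding Qn_add[OF that] by (intro uniform_limit_plus_fun P_lim that)
qed (intro V_closed that)

lemma P_diff: "P (f - g) = P f - P g" if "f \<in> V" "g \<in> V"
proof (rule P_eqI)
  show "uniform_limit UNIV (\<lambda>j. (Q ^^ m j) (f - g)) (P f - P g) sequentially"
    unfolding Qn_diff[OF that] by (intro uniform_limit_minus_fun P_lim that)
qed (intro V_closed that)

lemma P_fscale: "P (fscale c f) = fscale c (P f)" if "f \<in> V"
proof (rule P_eqI)
  show "uniform_limit UNIV (\<lambda>j. (Q ^^ m j) (fscale c f)) (fscale c (P f)) sequentially"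
    unfolding Qn_fscale[OF that] by (intro uniform_limit_fscale P_lim that)
qed (intro V_closed that)

lemma P_Q: "P (Q f) = Q (P f)" if "f \<in> V"
proof (rule P_eqI)
  have "uniform_limit UNIV (\<lambda>j. (Q ^^ 1) ((Q ^^ m j) f) - (Q ^^ 1) (P f)) (\<lambda>_. 0) sequentially"
    by (rule Qn_uniform_limit[of _ _ "\<lambda>_. 1", OF P_lim[OF that] Qn_in[OF that] P_in[OF that]])
  from uniform_limit_plus_fun[OF this uniform_limit_const[where c = "Q (P f)" and S = UNIV]]
  show "uniform_limit UNIV (\<lambda>j. (Q ^^ m j) (Q f)) (Q (P f)) sequentially"
    by (simp add: Qn_commute[of _ 1, simplified] plus_fun_def)
qed (intro Q_in that)

lemma P_le_N: "f \<in> V \<Longrightarrow> cmod (P f p) \<le> N f"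
  by (rule uniform_limit_bound[OF P_lim]) (auto intro: Qn_contraction norm_le_N)

lemma convergent_in_N:
  assumes "\<And>n. fs n \<in> V" "l \<in> V" "(\<lambda>n. N (fs n - l)) \<longlonglongrightarrow> 0"
  shows "(\<lambda>n. fs n p) \<longlonglongrightarrow> l p" "(\<lambda>n. P (fs n) p) \<longlonglongrightarrow> P l p"
proof -
  have "fs n - l \<in> V" for n using assms by (intro V_closed)
  then have le: "cmod (fs n p - l p) \<le> N (fs n - l)" "cmod (P (fs n) p - P l p) \<le> N (fs n - l)" for n
    using norm_le_N[of "fs n - l" p] P_le_N[of "fs n - l" p] assms by (auto simp: P_diff)
  show "(\<lambda>n. fs n p) \<longlonglongrightarrow> l p"
    unfolding LIM_zero_iff[symmetric, of _ "l p"]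
    by (rule Lim_null_comparison[OF _ assms(3)]) (simp add: le)
  show "(\<lambda>n. P (fs n) p) \<longlonglongrightarrow> P l p"
    unfolding LIM_zero_iff[symmetric, of _ "P l p"]
    by (rule Lim_null_comparison[OF _ assms(3)]) (simp add: le)
qed

section \<open>Range and kernel of the limiting idempotent\<close>

definition F where "F = {f \<in> V. P f = f}"
definition H where "H = {f \<in> V. P f = 0}"

lemma P_0: "P 0 = 0"
  using P_diff[OF V_closed(1,1)] by simp

lemma subspace_F: "fun_vs.subspace F"
  unfolding fun_vs.subspace_def F_def using V_closed by (simp add: P_add P_fscale P_0)

lemma subspace_H: "fun_vs.subspace H"
  unfolding fun_vs.subspace_def H_def using V_closed by (simp add: P_add P_fscale P_0)

lemma H_closed:
  assumes "\<And>n. fs n \<in> H" "l \<in> V" "(\<lambda>n. N (fs n - l)) \<longlonglongrightarrow> 0"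
  shows "l \<in> H"
proof -
  have fs: "fs n \<in> V" "P (fs n) = 0" for n using assms(1)[of n] by (auto simp: H_def)
  have "P l p = 0" for p
    using convergent_in_N(2)[OF fs(1) assms(2,3), of p] unfolding fs(2) zero_fun_apply
    by (rule LIMSEQ_unique) (rule tendsto_const)
  then have "P l = 0" by (intro ext) simp
  then show ?thesis using assms(2) by (simp add: H_def)
qed

lemma F_closed:
  assumes "\<And>n. fs n \<in> F" "l \<in> V" "(\<lambda>n. N (fs n - l)) \<longlonglongrightarrow> 0"
  shows "l \<in> F"
proof -
  have fs: "fs n \<in> V" "P (fs n) = fs n" for n using assms(1)[of n] by (auto simp: F_def)
  have "P l p = l p" for p
    using convergent_in_N[OF fs(1) assms(2,3), of p] unfolding fs(2) by (rule LIMSEQ_unique[rotated])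
  then have "P l = l" by (intro ext)
  then show ?thesis using assms(2) by (simp add: F_def)
qed

text \<open>A function of \<open>F\<close> is the limit of its own powers \<open>m j\<close>; in
  their Doeblin-Fortet bounds the \<open>N\<close>-term has a coefficient tending to 0, and
  semicontinuity passes the rest to \<open>f\<close>.\<close>

lemma N_le_on_F:
  assumes f: "f \<in> F" and c: "\<And>p. cmod (f p) \<le> c"
  shows "N f \<le> C * c"
proof (rule field_le_epsilon)
  fix \<epsilon> :: real assume "\<epsilon> > 0"
  have fV: "f \<in> V" and Pf: "P f = f" using f by (auto simp: F_def)
  have "(\<lambda>n. e n * N f) \<longlonglongrightarrow> 0" using e(1) by (rule tendsto_mult_left_zero)
  then have "eventually (\<lambda>n. e n * N f < \<epsilon>) sequentially" using \<open>\<epsilon> > 0\<close> by (rule order_tendstoD)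
  then obtain n0 where n0: "\<And>n. n \<ge> n0 \<Longrightarrow> e n * N f < \<epsilon>"
    unfolding eventually_sequentially by blast
  show "N f \<le> C * c + \<epsilon>"
  proof (rule uniform_limit_N_le(2))
    show "uniform_limit UNIV (\<lambda>j. (Q ^^ m j) f) f sequentially" using P_lim[OF fV] unfolding Pf .
    show "(Q ^^ m j) f \<in> V" for j using fV by (rule Qn_in)
    show "N ((Q ^^ m j) f) \<le> C * c + \<epsilon>" if "n0 \<le> j" for j
      using doeblin_fortet[OF fV c, of "m j"] n0[of "m j"] that m[of j] by force
  qed
qed

text \<open>A \<open>1/2\<close>-net \<open>T\<close> of the unit ball \<open>U\<close> gives \<open>U \<subseteq> span T + U / 2\<close>, hence
  \<open>U \<subseteq> span T + U / 2\<^sup>j\<close> for all \<open>j\<close>; and \<open>span T\<close> is closed.\<close>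

lemma finite_dim_F: "\<exists>B. finite B \<and> F = fun_vs.span B"
proof -
  define U where "U = {f \<in> F. \<forall>p. cmod (f p) \<le> 1}"
  \<comment> \<open>On \<open>F\<close> the supremum norm controls \<open>N\<close>, so its unit
    ball sits in an \<open>N\<close>-ball and is totally bounded.\<close>
  have "U \<subseteq> {f \<in> V. N f \<le> C * 1}"
    using N_le_on_F[of _ 1] by (auto simp: U_def F_def)
  from finite_net[OF this half_gt_zero[OF zero_less_one]]
  obtain T where T: "finite T" "T \<subseteq> U" and net: "\<forall>f\<in>U. \<exists>g\<in>T. \<forall>p. cmod (f p - g p) \<le> 1/2"
    by (elim exE conjE) (rule that; assumption)
  have sub: "fun_vs.span T \<subseteq> F"
    using T(2) by (intro fun_vs.span_minimal subspace_F) (auto simp: U_def)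
  have approx: "\<exists>l\<in>fun_vs.span T. \<exists>u\<in>U. f = l + fscale (1 / 2 ^ j) u" if "f \<in> U" for f and j :: nat
    using that
  proof (induction j)
    case 0
    then show ?case by (intro bexI[of _ 0] bexI[of _ f] fun_vs.span_zero) (auto simp: fscale_def)
  next
    case (Suc j)
    then obtain l u where l: "l \<in> fun_vs.span T" and u: "u \<in> U" and f: "f = l + fscale (1 / 2 ^ j) u" by blast
    obtain g where g: "g \<in> T" "\<And>p. cmod (u p - g p) \<le> 1/2" using net u by blast
    define w where "w = fscale 2 (u - g)"
    have "u \<in> F" "g \<in> F" using u g T by (auto simp: U_def)
    then have "w \<in> F" unfolding w_def by (intro fun_vs.subspace_scale fun_vs.subspace_diff subspace_F)
    moreover have "cmod (w p) \<le> 1" for p proof -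
      have "cmod (w p) = 2 * cmod (u p - g p)"
        unfolding w_def fscale_def by (simp add: norm_mult del: right_diff_distrib_numeral)
      then show ?thesis using g(2)[of p] by simp
    qed
    ultimately have w: "w \<in> U" by (simp add: U_def)
    have "f = (l + fscale (1 / 2 ^ j) g) + fscale (1 / 2 ^ Suc j) w"
      unfolding f w_def by (intro ext) (simp add: fscale_def field_simps)
    moreover have "l + fscale (1 / 2 ^ j) g \<in> fun_vs.span T"
      by (intro fun_vs.span_add fun_vs.span_scale l fun_vs.span_base[OF g(1)])
    ultimately show ?case using w by blast
  qed
  have UT: "f \<in> fun_vs.span T" if f: "f \<in> U" for f
  proof -
    define l where "l j = (SOME l. l \<in> fun_vs.span T \<and> (\<exists>u\<in>U. f = l + fscale (1 / 2 ^ j) u))" for j :: nat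
    have l: "l j \<in> fun_vs.span T \<and> (\<exists>u\<in>U. f = l j + fscale (1 / 2 ^ j) u)" for j
    proof -
      have "\<exists>l. l \<in> fun_vs.span T \<and> (\<exists>u\<in>U. f = l + fscale (1 / 2 ^ j) u)"
        using approx[OF f, of j] by blast
      from someI_ex[OF this] show ?thesis unfolding l_def .
    qed
    show ?thesis
    proof (rule closed_finite_span[OF T(1)])
      show "l j \<in> fun_vs.span T" for j using l by blast
      fix p
      show "(\<lambda>j. l j p) \<longlonglongrightarrow> f p"
        unfolding LIM_zero_iff[symmetric, of _ "f p"]
      proof (rule Lim_null_comparison)
        have "cmod (l j p - f p) \<le> (1 / 2) ^ j" for j
        proof -
          obtain u where u: "u \<in> U" "f = l j + fscale (1 / 2 ^ j) u" using l[of j] by blast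
          from u(2) have "f p = (l j + fscale (1 / 2 ^ j) u) p" by (rule fun_cong)
          then have "l j p - f p = - ((1 / 2) ^ j * u p)" by (simp add: fscale_def power_one_over)
          then have "cmod (l j p - f p) = (1 / 2) ^ j * cmod (u p)" by (simp add: norm_mult norm_power norm_divide)
          also have "\<dots> \<le> (1 / 2) ^ j * 1" using u(1) by (intro mult_left_mono) (auto simp: U_def)
          finally show ?thesis by simp
        qed
        then show "\<forall>\<^sub>F j in sequentially. cmod (l j p - f p) \<le> (1 / 2) ^ j" by simp
        show "(\<lambda>j. (1 / 2 :: real) ^ j) \<longlonglongrightarrow> 0" by (rule LIMSEQ_power_zero) simp
      qed
    qed
  qed
  have "f \<in> fun_vs.span T" if f: "f \<in> F" for f
  proof -
    have fV: "f \<in> V" using f by (simp add: F_def)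
    define c where "c = N f + 1"
    have c: "c > 0" using N_ge_0[of f] by (simp add: c_def)
    have "fscale (1 / c) f \<in> F" using f by (intro fun_vs.subspace_scale subspace_F)
    moreover have "cmod (fscale (1 / c) f p) \<le> 1" for p
      using norm_le_N[OF fV, of p] c by (simp add: fscale_def norm_mult norm_divide c_def)
    ultimately have "fscale (1 / c) f \<in> fun_vs.span T" by (intro UT) (simp add: U_def)
    then have "fscale c (fscale (1 / c) f) \<in> fun_vs.span T" by (rule fun_vs.span_scale)
    moreover have "fscale c (fscale (1 / c) f) = f" using c by (intro ext) (simp add: fscale_def)
    ultimately show ?thesis by simp
  qed
  with sub T(1) show ?thesis by blast
qed

text \<open>The powers \<open>z ^ m j\<close> must bring \<open>f\<close> back to itself, which
  excludes modulus below 1; contractivity excludes modulus above 1.\<close>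

lemma eigenvalue_F:
  assumes f: "f \<in> F" "f \<noteq> 0" and z: "Q f = fscale z f"
  shows "cmod z = 1"
proof -
  have fV: "f \<in> V" and Pf: "P f = f" using f by (auto simp: F_def)
  obtain p where p: "f p \<noteq> 0" using f(2) by (auto simp: fun_eq_iff)
  have Qn: "(Q ^^ n) f = fscale (z ^ n) f" for n
  proof (induction n)
    case (Suc n)
    then have "(Q ^^ Suc n) f = fscale (z ^ n) (Q f)" using fV by (simp add: Q_fscale)
    then show ?case unfolding z by (simp add: fscale_def mult_ac)
  qed (simp add: fscale_def)
  have Qnp: "(Q ^^ n) f p = z ^ n * f p" for n unfolding Qn fscale_def ..
  have lim: "(\<lambda>j. z ^ m j * f p) \<longlonglongrightarrow> f p"
    using tendsto_uniform_limitI[OF P_lim[OF fV], of p] unfolding Pf Qnp by simp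
  have "\<not> cmod z < 1"
  proof
    assume "cmod z < 1"
    then have "(\<lambda>n. z ^ n) \<longlonglongrightarrow> 0" by (rule LIMSEQ_power_zero)
    moreover have "filterlim m at_top sequentially"
      by (rule filterlim_at_top_mono[OF filterlim_ident]) (simp add: m)
    ultimately have "(\<lambda>j. z ^ m j) \<longlonglongrightarrow> 0" by (rule filterlim_compose)
    then have "(\<lambda>j. z ^ m j * f p) \<longlonglongrightarrow> 0" by (rule tendsto_mult_left_zero)
    with lim have "f p = 0" by (rule LIMSEQ_unique)
    with p show False by simp
  qed
  moreover have "\<not> cmod z > 1"
  proof
    assume z1: "cmod z > 1"
    have "cmod z ^ n * cmod (f p) \<le> N f" for n
      using Qn_contraction[OF fV norm_le_N[OF fV], of n p] unfolding Qnp by (simp add: norm_mult norm_power)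
    then have "cmod z ^ n \<le> N f / cmod (f p)" for n using p by (simp add: pos_le_divide_eq)
    moreover obtain n where "N f / cmod (f p) < cmod z ^ n" using real_arch_pow[OF z1] by blast
    ultimately show False using not_le by blast
  qed
  ultimately show ?thesis by simp
qed

lemma QH: "f \<in> H \<Longrightarrow> Q f \<in> H"
  unfolding H_def using Q_in P_Q Q_fscale[OF V_closed(1), of 0] by (auto simp: fun_vs.scale_zero_left)

lemma QnH: "f \<in> H \<Longrightarrow> (Q ^^ n) f \<in> H"
  by (induction n) (auto simp: QH)

text \<open>For a single \<open>g\<close> in \<open>H\<close>, one uniformly small power makes all
  later powers small. A finite net of the unit ball then gives a common exponent.\<close>

lemma H_decay_uniform:
  assumes "\<epsilon> > 0"
  shows "\<exists>n. \<forall>f\<in>H. N f \<le> 1 \<longrightarrow> (\<forall>p. cmod ((Q ^^ n) f p) \<le> \<epsilon>)"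
proof -
  define U where "U = {f \<in> H. N f \<le> 1}"
  have UV: "f \<in> V" "P f = 0" if "f \<in> U" for f using that by (auto simp: U_def H_def)
  have "U \<subseteq> {f \<in> V. N f \<le> 1}" by (auto simp: U_def H_def)
  from finite_net[OF this half_gt_zero[OF assms]]
  obtain T where T: "finite T" "T \<subseteq> U" and net: "\<forall>f\<in>U. \<exists>g\<in>T. \<forall>p. cmod (f p - g p) \<le> \<epsilon> / 2"
    by (elim exE conjE) (rule that; assumption)
  have "\<exists>k. \<forall>n\<ge>k. \<forall>p. cmod ((Q ^^ n) g p) \<le> \<epsilon> / 2" if g: "g \<in> T" for g
  proof -
    have gV: "g \<in> V" "P g = 0" using UV g T by auto
    obtain M where M: "\<And>n p. n \<ge> M \<Longrightarrow> dist ((Q ^^ m n) g p) (P g p) < \<epsilon> / 2"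
      using uniform_limit_sequentiallyE[OF P_lim[OF gV(1)] half_gt_zero[OF assms]] by blast
    have "cmod ((Q ^^ n) g p) \<le> \<epsilon> / 2" if "n \<ge> m M" for n p
    proof -
      have "(Q ^^ n) g = (Q ^^ (n - m M)) ((Q ^^ m M) g)" using that by (simp add: Qn_add_exp[symmetric])
      moreover have "cmod ((Q ^^ (n - m M)) ((Q ^^ m M) g) p) \<le> \<epsilon> / 2"
        using M[of M] gV by (intro Qn_contraction[of "(Q ^^ m M) g"] Qn_in) (auto intro: less_imp_le)
      ultimately show ?thesis by simp
    qed
    then show ?thesis by blast
  qed
  then obtain k where k: "\<forall>g\<in>T. \<forall>n\<ge>k g. \<forall>p. cmod ((Q ^^ n) g p) \<le> \<epsilon> / 2" by metis
  define n where "n = Max (insert 0 (k ` T))"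
  have "cmod ((Q ^^ n) f p) \<le> \<epsilon>" if f: "f \<in> U" for f p
  proof -
    obtain g where g: "g \<in> T" "\<And>p. cmod (f p - g p) \<le> \<epsilon> / 2" using net f by blast
    have V: "f \<in> V" "g \<in> V" using UV f g T by auto
    have "k g \<le> n" unfolding n_def using g T by (intro Max_ge) auto
    then have 1: "cmod ((Q ^^ n) g p) \<le> \<epsilon> / 2" using k g by blast
    have 2: "cmod ((Q ^^ n) (f - g) p) \<le> \<epsilon> / 2"
      using g(2) V by (intro Qn_contraction[of "f - g"] V_closed) auto
    have eq: "(Q ^^ n) f p = (Q ^^ n) (f - g) p + (Q ^^ n) g p" using Qn_diff[OF V] by simp
    show ?thesis unfolding eq using 1 2 norm_triangle_ineq[of "(Q ^^ n) (f - g) p" "(Q ^^ n) g p"] by linarith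
  qed
  then show ?thesis by (auto simp: U_def)
qed

text \<open>The first \<open>n1\<close> steps make the supremum norm small, the following
  \<open>Suc n0\<close> steps make the coefficient of \<open>N\<close> small. \<open>Suc\<close>
  ensures a positive total.\<close>

lemma H_decay: "\<exists>n>0. \<forall>f\<in>H. N ((Q ^^ n) f) \<le> 1/2 * N f"
proof -
  \<comment> \<open>Chosen so that both \<open>\<epsilon> * (1 + C)\<close> and
    \<open>C * \<epsilon>\<close> are at most 1/4.\<close>
  define \<epsilon> where "\<epsilon> = 1 / (4 * (1 + C))"
  have \<epsilon>: "\<epsilon> > 0" "C * \<epsilon> \<le> 1/4" using C by (auto simp: \<epsilon>_def field_simps)
  obtain n1 where n1: "\<And>f p. f \<in> H \<Longrightarrow> N f \<le> 1 \<Longrightarrow> cmod ((Q ^^ n1) f p) \<le> \<epsilon>"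
    using H_decay_uniform[OF \<epsilon>(1)] by blast
  have "eventually (\<lambda>n. e n < \<epsilon>) sequentially" using e(1) \<epsilon>(1) by (rule order_tendstoD)
  then obtain n0 where n0: "\<And>n. n \<ge> n0 \<Longrightarrow> e n < \<epsilon>" unfolding eventually_sequentially by blast
  define n where "n = Suc n0 + n1"
  have unit: "N ((Q ^^ n) f) \<le> 1/2" if f: "f \<in> H" "N f \<le> 1" for f
  proof -
    have fV: "f \<in> V" using f by (simp add: H_def)
    have "N ((Q ^^ n) f) = N ((Q ^^ Suc n0) ((Q ^^ n1) f))" unfolding n_def Qn_add_exp ..
    also have "\<dots> \<le> e (Suc n0) * N ((Q ^^ n1) f) + C * \<epsilon>"
      using n1[OF f] by (intro doeblin_fortet Qn_in fV)
    also have "e (Suc n0) * N ((Q ^^ n1) f) \<le> \<epsilon> * (1 + C)"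
    proof (rule mult_mono)
      show "e (Suc n0) \<le> \<epsilon>" using n0[of "Suc n0"] by simp
      show "N ((Q ^^ n1) f) \<le> 1 + C"
      proof -
        have "(1 + C) * N f \<le> (1 + C) * 1" using f(2) C by (intro mult_left_mono) auto
        from order_trans[OF N_Qn_le[OF fV] this] show ?thesis by simp
      qed
    qed (use \<epsilon> N_ge_0 in auto)
    also have "\<epsilon> * (1 + C) \<le> 1/4" using C by (simp add: \<epsilon>_def)
    finally show ?thesis using \<epsilon>(2) by simp
  qed
  have "N ((Q ^^ n) f) \<le> 1/2 * N f" if f: "f \<in> H" for f
  proof (cases "N f = 0")
    case True
    have fV: "f \<in> V" using f by (simp add: H_def)
    then show ?thesis using N_Qn_le[OF fV, of n] True by simp
  next
    case False
    have fV: "f \<in> V" using f by (simp add: H_def)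
    have pos: "N f > 0" using False N_ge_0[of f] by simp
    have "fscale (1 / N f) f \<in> H" using f by (intro fun_vs.subspace_scale subspace_H)
    moreover have "N (fscale (1 / N f) f) = 1" using pos by (simp add: N_homogeneous norm_divide)
    ultimately have "N ((Q ^^ n) (fscale (1 / N f) f)) \<le> 1/2" by (intro unit) auto
    then show ?thesis using pos by (simp add: Qn_fscale[OF fV] N_homogeneous norm_divide field_simps)
  qed
  then show ?thesis by (intro exI[of _ n]) (simp add: n_def)
qed

lemma spectral_radius_H: "spectral_radius H N Q < 1"
proof -
  obtain n where n: "n > 0" and half: "\<And>f. f \<in> H \<Longrightarrow> N ((Q ^^ n) f) \<le> 1/2 * N f"
    using H_decay by blast
  define \<rho> where "\<rho> = root n (1/2)"
  have \<rho>: "0 \<le> \<rho>" "\<rho> < 1" "\<rho> ^ n = 1/2"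
    using n real_root_lt_1_iff[of n "1/2"] by (auto simp: \<rho>_def real_root_ge_zero real_root_pow_pos)
  have HV: "f \<in> V" if "f \<in> H" for f using that by (simp add: H_def)
  have pow: "N ((Q ^^ (n * k)) f) \<le> (1/2) ^ k * N f" if "f \<in> H" for f k
  proof (induction k)
    case (Suc k)
    have "N ((Q ^^ (n * Suc k)) f) = N ((Q ^^ n) ((Q ^^ (n * k)) f))" by (simp add: Qn_add_exp)
    also have "\<dots> \<le> 1/2 * N ((Q ^^ (n * k)) f)" using that by (intro half QnH)
    finally show ?case using Suc by simp
  qed simp
  \<comment> \<open>The factor 2 pays for the incomplete block: \<open>\<rho> ^ (i mod n)\<close> is
    at least \<open>\<rho> ^ n = 1/2\<close>.\<close>
  have bound: "N ((Q ^^ i) f) \<le> (2 * (1 + C)) * \<rho> ^ i * N f" if f: "f \<in> H" for f i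
  proof -
    have i: "i = n * (i div n) + i mod n" by simp
    have "N ((Q ^^ i) f) = N ((Q ^^ (n * (i div n))) ((Q ^^ (i mod n)) f))"
      by (subst i) (simp only: Qn_add_exp)
    also have "\<dots> \<le> (1/2) ^ (i div n) * N ((Q ^^ (i mod n)) f)" using f by (intro pow QnH)
    also have "\<dots> \<le> (1/2) ^ (i div n) * ((1 + C) * N f)"
      using N_Qn_le[OF HV[OF f]] by (intro mult_left_mono) auto
    also have "\<dots> \<le> (2 * \<rho> ^ i) * ((1 + C) * N f)"
    proof (rule mult_right_mono)
      have "\<rho> ^ n \<le> \<rho> ^ (i mod n)" using \<rho> n by (intro power_decreasing) (auto intro: less_imp_le)
      then have "1 \<le> 2 * \<rho> ^ (i mod n)" using \<rho>(3) by simp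
      then have "(1/2) ^ (i div n) * 1 \<le> (1/2) ^ (i div n) * (2 * \<rho> ^ (i mod n))"
        by (intro mult_left_mono) auto
      also have "\<dots> = 2 * (\<rho> ^ (n * (i div n)) * \<rho> ^ (i mod n))"
        unfolding power_mult \<rho>(3) by simp
      also have "\<dots> = 2 * \<rho> ^ i" unfolding power_add[symmetric] by simp
      finally show "(1/2) ^ (i div n) \<le> 2 * \<rho> ^ i" by simp
    qed (use C N_ge_0[of f] in simp)
    also have "\<dots> = (2 * (1 + C)) * \<rho> ^ i * N f" by (simp only: mult_ac)
    finally show ?thesis .
  qed
  have "spectral_radius H N Q \<le> ennreal \<rho>"
  proof (rule spectral_radius_le)
    fix z assume "\<rho> < cmod z"
    then show "z \<notin> op_spectrum H N Q"
      using C \<rho>(1) HV by (intro not_in_op_spectrum[OF subspace_H _ QH H_closed bound]) auto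
  qed
  also have "\<dots> < 1" using \<rho> by (simp add: ennreal_less_one_iff)
  finally show ?thesis .
qed

lemma quasi_compact: "quasi_compact V N Q"
  unfolding quasi_compact_def spectral_radius_eq_1
proof (rule conjI[OF bounded_op_Q], rule exI[of _ F], rule exI[of _ H], intro conjI)
  show "closed_subspace V N F" by (rule closed_subspaceI[OF subspace_F _ F_closed]) (auto simp: F_def)
  show "closed_subspace V N H" by (rule closed_subspaceI[OF subspace_H _ H_closed]) (auto simp: H_def)
  show "Q ` F \<subseteq> F" unfolding F_def using Q_in P_Q by auto
  show "Q ` H \<subseteq> H" using QH by blast
  show "F \<inter> H = {0}" unfolding F_def H_def using V_closed(1) P_0 by auto
  show "{f + h |f h. f \<in> F \<and> h \<in> H} = V"
  proof (intro equalityI subsetI)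
    fix f assume f: "f \<in> V"
    have "P f \<in> F" using f P_in P_idem by (simp add: F_def)
    moreover have "f - P f \<in> H" using f P_in P_idem P_diff V_closed by (simp add: H_def)
    moreover have "f = P f + (f - P f)" by simp
    ultimately show "f \<in> {f + h |f h. f \<in> F \<and> h \<in> H}" by blast
  qed (auto simp: F_def H_def intro: V_closed)
  show "\<exists>B. finite B \<and> F = fun_vs.span B" by (rule finite_dim_F)
  show "\<forall>z. \<forall>f\<in>F. f \<noteq> 0 \<and> Q f = fscale z f \<longrightarrow> ennreal (cmod z) = 1"
    using eigenvalue_F by simp
  show "spectral_radius H N Q < 1" by (rule spectral_radius_H)
qed

end

theorem (in doeblin_fortet) quasi_compact: "quasi_compact V N Q"
proof -
  obtain P m where "\<forall>j. j \<le> m j"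
    and *: "\<forall>f\<in>V. P f \<in> V \<and> P (P f) = P f \<and> uniform_limit UNIV (\<lambda>j. (Q ^^ m j) f) (P f) sequentially"
    using idempotent_limit by (elim exE conjE) (rule that)
  then interpret doeblin_fortet_projection V N Q e C P m
    by unfold_locales blast+
  show ?thesis by (rule quasi_compact)
qed

section \<open>Geometry of the projective space and Hoelder functions\<close>

lemma norm_vec_squared: "(norm (x :: complex^'k))\<^sup>2 = (\<Sum>i\<in>UNIV. (cmod (x $ i))\<^sup>2)"
  by (simp add: norm_vec_def L2_set_def sum_nonneg)

lemma cinner_self: "cinner x x = complex_of_real ((norm x)\<^sup>2)"
  by (simp add: cinner_def norm_vec_squared complex_norm_square mult.commute del: of_real_power)

lemma cinner_commute: "cinner y x = cnj (cinner x y)"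
  by (simp add: cinner_def mult.commute)

lemma cinner_add_right: "cinner x (y + z) = cinner x y + cinner x z"
  by (simp add: cinner_def distrib_left sum.distrib)

lemma cinner_scale_right: "cinner x (c *s y) = c * cinner x y"
  by (simp add: cinner_def sum_distrib_left mult_ac)

lemma cinner_add_left: "cinner (y + z) x = cinner y x + cinner z x"
  by (simp add: cinner_def distrib_right sum.distrib)

lemma cinner_scale_left: "cinner (c *s y) x = cnj c * cinner y x"
  by (simp add: cinner_def sum_distrib_left mult_ac)

lemma cinner_madj: "cinner x (madj W *v z) = cinner (W *v x) z"
proof -
  have "cinner x (madj W *v z) = (\<Sum>i\<in>UNIV. \<Sum>j\<in>UNIV. cnj (x $ i) * cnj (W $ j $ i) * z $ j)"
    by (simp add: cinner_def madj_def matrix_vector_mult_def sum_distrib_left mult.assoc)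
  also have "\<dots> = (\<Sum>j\<in>UNIV. \<Sum>i\<in>UNIV. cnj (x $ i) * cnj (W $ j $ i) * z $ j)"
    by (rule sum.swap)
  also have "\<dots> = cinner (W *v x) z"
    by (simp add: cinner_def matrix_vector_mult_def sum_distrib_left sum_distrib_right mult_ac)
  finally show ?thesis .
qed

lemma matrix_vector_mult_scale: "v *v (c *s x) = c *s (v *v (x :: complex^'k))"
  by (simp add: vec_eq_iff matrix_vector_mult_def sum_distrib_left mult_ac)

lemma norm_add_squared: "(norm (x + y))\<^sup>2 = (norm x)\<^sup>2 + (norm y)\<^sup>2 + 2 * Re (cinner x y)"
proof -
  have "complex_of_real ((norm (x + y))\<^sup>2) =
      complex_of_real ((norm x)\<^sup>2) + complex_of_real ((norm y)\<^sup>2) + (cinner x y + cnj (cinner x y))"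
    unfolding cinner_self[symmetric] by (simp add: cinner_add_right cinner_add_left cinner_commute[of y x])
  also have "cinner x y + cnj (cinner x y) = complex_of_real (2 * Re (cinner x y))"
    by (rule complex_add_cnj)
  finally show ?thesis by (metis of_real_add of_real_eq_iff)
qed

lemma norm_diff_squared: "(norm (x - y))\<^sup>2 = (norm x)\<^sup>2 + (norm y)\<^sup>2 - 2 * Re (cinner x y)"
proof -
  have "x - y = x + (-1) *s y" by (simp add: vec_eq_iff)
  then show ?thesis using norm_add_squared[of x "(-1) *s y"]
    by (simp only: cinner_scale_right norm_vec_scale) simp
qed

section \<open>Bivectors and the projective distance\<close>

definition wedge :: "complex^'k \<Rightarrow> complex^'k \<Rightarrow> complex^'k^'k" where
  "wedge x y = (\<chi> i j. x $ i * y $ j - x $ j * y $ i)"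

text \<open>Each coordinate of the bivector occurs twice, up to sign, in the antisymmetric matrix;
  hence \<open>sqrt 2\<close>.\<close>

definition wedge_norm :: "complex^'k \<Rightarrow> complex^'k \<Rightarrow> real" where
  "wedge_norm x y = norm (wedge x y) / sqrt 2"

lemma wedge_norm_nonneg [simp]: "0 \<le> wedge_norm x y"
  by (simp add: wedge_norm_def)

text \<open>Lagrange's identity: the squared length of a bivector is the Gram determinant.\<close>

lemma wedge_norm_squared:
  "(wedge_norm x y)\<^sup>2 = (norm x)\<^sup>2 * (norm y)\<^sup>2 - (cmod (cinner x y))\<^sup>2"
proof -
  have "(norm (wedge x y))\<^sup>2 = (\<Sum>i\<in>UNIV. \<Sum>j\<in>UNIV. (cmod (x $ i * y $ j - x $ j * y $ i))\<^sup>2)"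
    unfolding norm_vec_def[of "wedge x y"] by (simp add: L2_set_def sum_nonneg norm_vec_squared wedge_def)
  then have "complex_of_real ((norm (wedge x y))\<^sup>2) =
      (\<Sum>i\<in>UNIV. \<Sum>j\<in>UNIV. (x $ i * y $ j - x $ j * y $ i) * (cnj (x $ i) * cnj (y $ j) - cnj (x $ j) * cnj (y $ i)))"
    by (simp add: complex_norm_square del: of_real_power)
  also have "\<dots> = (\<Sum>i\<in>UNIV. \<Sum>j\<in>UNIV. (cnj (x $ i) * x $ i) * (cnj (y $ j) * y $ j))
      + (\<Sum>i\<in>UNIV. \<Sum>j\<in>UNIV. (cnj (y $ i) * y $ i) * (cnj (x $ j) * x $ j))
      - (\<Sum>i\<in>UNIV. \<Sum>j\<in>UNIV. (cnj (y $ i) * x $ i) * (cnj (x $ j) * y $ j))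
      - (\<Sum>i\<in>UNIV. \<Sum>j\<in>UNIV. (cnj (x $ i) * y $ i) * (cnj (y $ j) * x $ j))"
    unfolding sum.distrib[symmetric] sum_subtractf[symmetric]
    by (intro sum.cong refl) (simp add: algebra_simps)
  also have "\<dots> = cinner x x * cinner y y + cinner y y * cinner x x
      - cinner y x * cinner x y - cinner x y * cinner y x"
    by (simp only: cinner_def sum_product)
  also have "\<dots> = 2 * (cinner x x * cinner y y - cinner x y * cnj (cinner x y))"
    by (simp add: cinner_commute[of y x] algebra_simps)
  also have "\<dots> = complex_of_real (2 * ((norm x)\<^sup>2 * (norm y)\<^sup>2 - (cmod (cinner x y))\<^sup>2))"
    unfolding cinner_self complex_norm_square[symmetric] by simp
  finally have "(norm (wedge x y))\<^sup>2 = 2 * ((norm x)\<^sup>2 * (norm y)\<^sup>2 - (cmod (cinner x y))\<^sup>2)"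
    unfolding of_real_eq_iff .
  then show ?thesis by (simp add: wedge_norm_def power_divide)
qed

lemma wedge_norm_commute: "wedge_norm y x = wedge_norm x y"
proof -
  have "wedge y x = - wedge x y" by (simp add: wedge_def vec_eq_iff mult.commute)
  then show ?thesis by (simp add: wedge_norm_def)
qed

lemma wedge_norm_add_left: "wedge_norm (x + x') y \<le> wedge_norm x y + wedge_norm x' y"
proof -
  have "wedge (x + x') y = wedge x y + wedge x' y" by (simp add: wedge_def vec_eq_iff algebra_simps)
  then show ?thesis
    by (simp add: wedge_norm_def add_divide_distrib[symmetric] divide_right_mono norm_triangle_ineq)
qed

lemma wedge_norm_scale_left: "wedge_norm (c *s x) y = cmod c * wedge_norm x y"
proof -
  have "(wedge_norm (c *s x) y)\<^sup>2 = (cmod c * wedge_norm x y)\<^sup>2"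
    by (simp add: wedge_norm_squared power_mult_distrib cinner_scale_left norm_mult norm_vec_scale algebra_simps)
  then show ?thesis by (intro power2_eq_imp_eq[of "wedge_norm (c *s x) y"]) simp_all
qed

lemma wedge_norm_shear: "wedge_norm x (y + c *s x) = wedge_norm x y"
  by (simp add: wedge_norm_def wedge_def algebra_simps)

lemma wedge_norm_le: "wedge_norm x y \<le> norm x * norm y"
  by (rule power2_le_imp_le) (simp_all add: wedge_norm_squared power_mult_distrib)

lemma wedge_norm_self: "wedge_norm x x = 0"
  by (simp add: wedge_norm_def wedge_def mult.commute vec_eq_iff)

lemma wedge_norm_orthogonal: "cinner x y = 0 \<Longrightarrow> wedge_norm x y = norm x * norm y"
  by (rule power2_eq_imp_eq) (simp_all add: wedge_norm_squared power_mult_distrib)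

text \<open>The difference is the real inner product of \<open>x - y\<close> and
  \<open>x + y\<close>. A product of norms of vectors depending linearly on the pair is a form that
  averaging preserves.\<close>

lemma abs_norm_squared_diff_le: "\<bar>(norm x)\<^sup>2 - (norm y)\<^sup>2\<bar> \<le> norm (x - y) * norm (x + y)" for x y :: "complex^'k"
proof -
  have "(norm x)\<^sup>2 - (norm y)\<^sup>2 = (x - y) \<bullet> (x + y)"
    by (simp add: power2_norm_eq_inner inner_diff_left inner_add_right inner_diff_right inner_commute algebra_simps)
  then show ?thesis using Cauchy_Schwarz_ineq2[of "x - y" "x + y"] by simp
qed

lemma proj_dist_eq_wedge:
  fixes x y :: "complex^'k"
  assumes "x \<noteq> 0" "y \<noteq> 0"
  shows "proj_dist (proj_class x) (proj_class y) = wedge_norm x y / (norm x * norm y)"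
proof -
  have pc: "proj_class (complex_of_real (inverse (norm x)) *s x) = proj_class x" if "x \<noteq> 0" for x :: "complex^'k"
    using that by (subst proj_class_eq_iff) (auto intro!: exI[of _ "complex_of_real (norm x)"])
  define x' y' where "x' = complex_of_real (inverse (norm x)) *s x" and "y' = complex_of_real (inverse (norm y)) *s y"
  have n: "norm x' = 1" "norm y' = 1"
    using assms by (simp_all add: x'_def y'_def norm_vec_scale norm_inverse)
  have "proj_dist (proj_class x) (proj_class y) = proj_dist (proj_class x') (proj_class y')"
    using pc assms by (simp add: x'_def y'_def)
  also have "\<dots> = sqrt ((wedge_norm x' y')\<^sup>2)"
    unfolding proj_dist_proj_class[OF n] wedge_norm_squared n by simp
  also have "\<dots> = wedge_norm x' y'" by simp
  also have "\<dots> = wedge_norm x y / (norm x * norm y)"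
    unfolding x'_def y'_def wedge_norm_scale_left
    by (subst wedge_norm_commute, unfold wedge_norm_scale_left, subst wedge_norm_commute)
      (simp add: field_simps norm_inverse norm_divide)
  finally show ?thesis .
qed

lemma proj_dist_unit:
  assumes "norm x = 1" "norm y = 1"
  shows "proj_dist (proj_class x) (proj_class y) = wedge_norm x y"
  using assms by (subst proj_dist_eq_wedge) auto

lemma proj_dist_nonneg: "0 \<le> proj_dist p q" and proj_dist_le_1: "proj_dist p q \<le> 1"
proof -
  have "proj_dist p q = wedge_norm (unit_rep p) (unit_rep q)"
    using proj_dist_unit[of "unit_rep p" "unit_rep q"] unit_rep by metis
  then show "0 \<le> proj_dist p q" "proj_dist p q \<le> 1"
    using wedge_norm_le[of "unit_rep p" "unit_rep q"] by (simp_all add: unit_rep)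
qed

text \<open>The representatives are chosen with a nonnegative inner product; then
  \<open>\<parallel>x - y\<parallel>\<^sup>2 \<parallel>x + y\<parallel>\<^sup>2 = (2 - 2\<langle>x, y\<rangle>)(2 + 2\<langle>x, y\<rangle>)\<close>.\<close>

lemma aligned_representatives:
  obtains x y where "norm x = 1" "norm y = 1" "proj_class x = p" "proj_class y = q"
    "wedge_norm x y = proj_dist p q" "norm (x - y) * norm (x + y) = 2 * proj_dist p q"
proof -
  define x u where "x = unit_rep p" and "u = unit_rep q"
  have n: "norm x = 1" "norm u = 1" "proj_class x = p" "proj_class u = q"
    by (simp_all add: x_def u_def unit_rep)
  define a where "a = cinner x u"
  define c where "c = (if a = 0 then 1 else cnj (sgn a))"
  have c: "cmod c = 1" "c * a = complex_of_real (cmod a)"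
    by (auto simp: c_def norm_sgn)
      (simp add: sgn_eq complex_norm_square[symmetric] power2_eq_square mult.commute flip: complex_norm_square)
  define y where "y = c *s u"
  have y: "norm y = 1" by (simp add: y_def norm_vec_scale c n)
  have nz: "u \<noteq> 0" "y \<noteq> 0" using n(2) y by auto
  have yq: "proj_class y = q"
    unfolding n(4)[symmetric] using nz c(1)
    by (subst proj_class_eq_iff) (auto simp: y_def intro!: exI[of _ "inverse c"])
  have xy: "cinner x y = complex_of_real (cmod a)" by (simp add: y_def cinner_scale_right a_def[symmetric] c)
  have w: "wedge_norm x y = proj_dist p q"
    using proj_dist_unit[OF n(1) y] n(3) yq by simp
  have "norm (x - y) * norm (x + y) = 2 * proj_dist p q"
  proof (rule power2_eq_imp_eq)
    have "(norm (x - y) * norm (x + y))\<^sup>2 = (2 - 2 * cmod a) * (2 + 2 * cmod a)"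
      by (simp add: power_mult_distrib norm_diff_squared norm_add_squared n y xy)
    also have "\<dots> = 4 * (1 - (cmod a)\<^sup>2)" by (simp add: algebra_simps power2_eq_square)
    also have "\<dots> = (2 * wedge_norm x y)\<^sup>2" by (simp add: power_mult_distrib wedge_norm_squared n y xy)
    finally show "(norm (x - y) * norm (x + y))\<^sup>2 = (2 * proj_dist p q)\<^sup>2" by (simp add: w)
  qed (simp_all add: proj_dist_nonneg)
  with n y yq w show ?thesis by (intro that[of x y]) auto
qed

lemma proj_dist_pos: "p \<noteq> q \<Longrightarrow> 0 < proj_dist p q"
proof -
  assume pq: "p \<noteq> q"
  obtain x y where xy: "norm x = 1" "norm y = 1" "proj_class x = p" "proj_class y = q"
    "wedge_norm x y = proj_dist p q" "norm (x - y) * norm (x + y) = 2 * proj_dist p q"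
    by (rule aligned_representatives)
  have "proj_dist p q \<noteq> 0"
  proof
    assume "proj_dist p q = 0"
    then have "x = y \<or> x = - y" using xy(6) by (simp add: eq_neg_iff_add_eq_0)
    then have "y = 1 *s x \<or> y = (-1) *s x" by (auto simp: vec_eq_iff)
    moreover have "x \<noteq> 0" "y \<noteq> 0" using xy(1,2) by auto
    ultimately have "proj_class x = proj_class y" by (subst proj_class_eq_iff) blast+
    then show False using xy pq by simp
  qed
  then show ?thesis using proj_dist_nonneg[of p q] by simp
qed

section \<open>Hoelder balls in the supremum norm\<close>

definition sup_norm :: "('p \<Rightarrow> complex) \<Rightarrow> real" where
  "sup_norm f = enn2real (sup_enorm f)"

definition holder_const :: "real \<Rightarrow> (('k::finite) proj \<Rightarrow> complex) \<Rightarrow> real" where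
  "holder_const \<alpha> f = enn2real (holder_seminorm \<alpha> f)"

lemma holder_spaceD:
  assumes "f \<in> holder_space \<alpha>"
  shows "cmod (f p) \<le> sup_norm f"
    and "cmod (f p - f q) \<le> holder_const \<alpha> f * proj_dist p q powr \<alpha>"
    and "holder_norm \<alpha> f = sup_norm f + holder_const \<alpha> f"
    and "0 \<le> sup_norm f" "0 \<le> holder_const \<alpha> f"
proof -
  have fin: "sup_enorm f < \<infinity>" "holder_seminorm \<alpha> f < \<infinity>"
    using assms by (auto simp: holder_space_def holder_enorm_def)
  show "0 \<le> sup_norm f" "0 \<le> holder_const \<alpha> f" by (simp_all add: sup_norm_def holder_const_def)
  show "holder_norm \<alpha> f = sup_norm f + holder_const \<alpha> f"
    using fin by (simp add: holder_norm_def holder_enorm_def sup_norm_def holder_const_def enn2real_plus)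
  have "ennreal (cmod (f p)) \<le> sup_enorm f" unfolding sup_enorm_def by (rule SUP_upper) simp
  then have "enn2real (ennreal (cmod (f p))) \<le> sup_norm f" unfolding sup_norm_def
    using fin by (intro enn2real_mono) auto
  then show "cmod (f p) \<le> sup_norm f" by simp
  show "cmod (f p - f q) \<le> holder_const \<alpha> f * proj_dist p q powr \<alpha>"
  proof (cases "p = q")
    case False
    have "ennreal (cmod (f p - f q) / proj_dist p q powr \<alpha>) \<le> holder_seminorm \<alpha> f"
      unfolding holder_seminorm_def using False by (intro SUP_upper2[of "(p, q)"]) auto
    then have "enn2real (ennreal (cmod (f p - f q) / proj_dist p q powr \<alpha>)) \<le> holder_const \<alpha> f"
      unfolding holder_const_def using fin by (intro enn2real_mono) auto
    then have "cmod (f p - f q) / proj_dist p q powr \<alpha> \<le> holder_const \<alpha> f" by simp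
    then show ?thesis using proj_dist_pos[OF False] by (simp add: pos_divide_le_eq)
  qed (simp add: holder_const_def)
qed

lemma holder_spaceI:
  assumes "\<And>p. cmod (f p) \<le> c" "\<And>p q. p \<noteq> q \<Longrightarrow> cmod (f p - f q) \<le> A * proj_dist p q powr \<alpha>" "0 \<le> A"
  shows "f \<in> holder_space \<alpha>" "holder_norm \<alpha> f \<le> c + A"
proof -
  have c: "0 \<le> c" using assms(1)[of undefined] norm_ge_zero order_trans by blast
  have 1: "sup_enorm f \<le> ennreal c" unfolding sup_enorm_def by (intro SUP_least ennreal_leI assms)
  have 2: "holder_seminorm \<alpha> f \<le> ennreal A"
    unfolding holder_seminorm_def
  proof (rule SUP_least, clarify)
    fix p q :: "'a proj" assume "p \<noteq> q"
    then show "ennreal (cmod (f p - f q) / proj_dist p q powr \<alpha>) \<le> ennreal A"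
      using assms(2)[of p q] proj_dist_pos[of p q] by (intro ennreal_leI) (simp add: pos_divide_le_eq)
  qed
  have 3: "holder_enorm \<alpha> f \<le> ennreal (c + A)"
    using add_mono[OF 1 2] c assms(3) by (simp add: holder_enorm_def)
  then show "f \<in> holder_space \<alpha>" unfolding holder_space_def using le_less_trans by fastforce
  show "holder_norm \<alpha> f \<le> c + A"
    using enn2real_mono[OF 3] c assms(3) by (simp add: holder_norm_def del: ennreal_plus)
qed

text \<open>Arzela-Ascoli is applied to the pullbacks to the unit sphere, and the limit is read off
  at unit representatives.\<close>

lemma holder_compact:
  fixes fs :: "nat \<Rightarrow> ('k::finite) proj \<Rightarrow> complex"
  assumes \<alpha>: "0 < \<alpha>" and fs: "\<And>n. fs n \<in> holder_space \<alpha>" "\<And>n. holder_norm \<alpha> (fs n) \<le> B"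
  shows "\<exists>f s. f \<in> holder_space \<alpha> \<and> holder_norm \<alpha> f \<le> B \<and> strict_mono (s :: nat \<Rightarrow> nat) \<and>
    uniform_limit UNIV (\<lambda>n. fs (s n)) f sequentially"
proof -
  have cB: "sup_norm (fs n) \<le> B" "holder_const \<alpha> (fs n) \<le> B - sup_norm (fs n)" "0 \<le> sup_norm (fs n)" for n
    using holder_spaceD(3-5)[OF fs(1)[of n]] fs(2)[of n] by auto
  have B: "0 \<le> B" using cB(1,3)[of 0] by simp
  have AB: "holder_const \<alpha> (fs n) \<le> B" for n using cB(2,3)[of n] by simp
  obtain g k where k: "strict_mono (k :: nat \<Rightarrow> nat)"
    and g: "\<And>e. 0 < e \<Longrightarrow> \<exists>N. \<forall>n x. n \<ge> N \<and> x \<in> sphere 0 1 \<longrightarrow> cmod (fs (k n) (proj_class x) - g x) < e"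
  proof (rule Arzela_Ascoli[of "sphere (0 :: complex^'k) 1" "\<lambda>n x. fs n (proj_class x)" B])
    show "compact (sphere (0 :: complex^'k) 1)" by simp
    show "cmod (fs n (proj_class x)) \<le> B" for n x
      using holder_spaceD(1)[OF fs(1)] cB(1) order_trans by blast
    fix x :: "complex^'k" and e :: real assume x: "x \<in> sphere 0 1" and e: "0 < e"
    \<comment> \<open>Solves \<open>d powr \<alpha> = e / (B + 1)\<close>; with \<open>B + 1\<close>
      the product with \<open>B\<close> stays below \<open>e\<close>, also for
      \<open>B = 0\<close>.\<close>
    define d where "d = (e / (B + 1)) powr (1 / \<alpha>)"
    have "d > 0" using e B by (simp add: d_def)
    have "cmod (fs n (proj_class x) - fs n (proj_class y)) < e" if "y \<in> sphere 0 1" "norm (x - y) < d" for n y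
    proof -
      have xy: "norm x = 1" "norm y = 1" using x that by auto
      have "wedge_norm x y = wedge_norm x ((y - x) + 1 *s x)" by simp
      also have "\<dots> = wedge_norm x (y - x)" by (rule wedge_norm_shear)
      also have "\<dots> \<le> norm (x - y)" using wedge_norm_le[of x "y - x"] xy by (simp add: norm_minus_commute)
      finally have le: "proj_dist (proj_class x) (proj_class y) \<le> norm (x - y)"
        by (simp add: proj_dist_unit[OF xy])
      have "cmod (fs n (proj_class x) - fs n (proj_class y))
          \<le> holder_const \<alpha> (fs n) * proj_dist (proj_class x) (proj_class y) powr \<alpha>"
        by (rule holder_spaceD(2)[OF fs(1)])
      also have "\<dots> \<le> B * d powr \<alpha>"
        using AB le that(2) \<alpha> B proj_dist_nonneg holder_spaceD(5)[OF fs(1)]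
        by (intro mult_mono powr_mono2) (auto intro: order_trans less_imp_le)
      also have "\<dots> = B * (e / (B + 1))" using \<alpha> e B by (simp add: d_def powr_powr)
      also have "\<dots> < e" using e B by (simp add: field_simps)
      finally show ?thesis .
    qed
    with \<open>d > 0\<close> show "\<exists>d>0. \<forall>n y. y \<in> sphere 0 1 \<and> norm (x - y) < d \<longrightarrow>
        cmod (fs n (proj_class x) - fs n (proj_class y)) < e" by blast
  qed blast
  define f where "f p = g (unit_rep p)" for p
  have lim: "uniform_limit UNIV (\<lambda>n. fs (k n)) f sequentially"
    unfolding uniform_limit_sequentially_iff
  proof (intro allI impI)
    fix e :: real assume "e > 0"
    then obtain N where N: "\<And>n x. n \<ge> N \<Longrightarrow> x \<in> sphere 0 1 \<Longrightarrow> cmod (fs (k n) (proj_class x) - g x) < e"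
      using g by blast
    have "dist (fs (k n) p) (f p) < e" if "n \<ge> N" for n p
      using N[OF that, of "unit_rep p"] by (simp add: unit_rep f_def dist_norm)
    then show "\<exists>N. \<forall>n\<ge>N. \<forall>p\<in>UNIV. dist (fs (k n) p) (f p) < e" by blast
  qed
  \<comment> \<open>Bounding the two parts of the norm separately would only give
    \<open>2 * B\<close>. Along a further subsequence the supremum norms converge to
    \<open>c\<close>, which leaves \<open>B - c\<close> for the Hoelder constant of the
    limit.\<close>
  have "bounded (range (\<lambda>n. sup_norm (fs (k n))))"
    using cB(1,3) by (auto simp: bounded_iff intro!: exI[of _ B])
  then obtain c r where r: "strict_mono (r :: nat \<Rightarrow> nat)" and c: "(\<lambda>n. sup_norm (fs (k (r n)))) \<longlonglongrightarrow> c"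
    using bounded_imp_convergent_subsequence[of "\<lambda>n. sup_norm (fs (k n))"] by (auto simp: comp_def)
  have fr: "(\<lambda>n. fs (k (r n)) p) \<longlonglongrightarrow> f p" for p
    using LIMSEQ_subseq_LIMSEQ[OF tendsto_uniform_limitI[OF lim] r, of p] by (simp add: comp_def)
  have 1: "cmod (f p) \<le> c" for p
    by (rule LIMSEQ_le[OF tendsto_norm[OF fr] c]) (use holder_spaceD(1)[OF fs(1)] in auto)
  have 2: "cmod (f p - f q) \<le> (B - c) * proj_dist p q powr \<alpha>" for p q
  proof (rule LIMSEQ_le)
    show "(\<lambda>n. cmod (fs (k (r n)) p - fs (k (r n)) q)) \<longlonglongrightarrow> cmod (f p - f q)"
      by (intro tendsto_intros fr)
    show "(\<lambda>n. (B - sup_norm (fs (k (r n)))) * proj_dist p q powr \<alpha>) \<longlonglongrightarrow> (B - c) * proj_dist p q powr \<alpha>"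
      by (intro tendsto_intros c)
    have "cmod (fs (k (r n)) p - fs (k (r n)) q) \<le> (B - sup_norm (fs (k (r n)))) * proj_dist p q powr \<alpha>" for n
      using holder_spaceD(2)[OF fs(1)[of "k (r n)"], of p q] cB(2)[of "k (r n)"]
      by (meson mult_right_mono order_trans powr_ge_zero)
    then show "\<exists>N. \<forall>n\<ge>N. cmod (fs (k (r n)) p - fs (k (r n)) q)
        \<le> (B - sup_norm (fs (k (r n)))) * proj_dist p q powr \<alpha>" by blast
  qed
  have "c \<le> B" by (rule LIMSEQ_le_const2[OF c]) (use cB(1) in auto)
  then have "f \<in> holder_space \<alpha>" "holder_norm \<alpha> f \<le> c + (B - c)"
    using holder_spaceI[OF 1 2] by auto
  then show ?thesis using k lim by auto
qed

section \<open>Averages of the wedge norm\<close>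

lemma linear_matrix_vector_left: "linear (\<lambda>v :: complex^'n^'m. v *v x)"
  by (intro linearI) (simp_all add: vec_eq_iff matrix_vector_mult_def sum.distrib algebra_simps scaleR_sum_right)

lemma continuous_matrix_vector_left: "continuous_on S (\<lambda>v :: complex^'n^'m. v *v x)"
  by (rule linear_continuous_on[OF iffD1[OF linear_conv_bounded_linear linear_matrix_vector_left]])

text \<open>The properties of the wedge norm that are inherited by its averages over the measure.\<close>

definition bivector_gauge :: "(complex^'k \<Rightarrow> complex^'k \<Rightarrow> real) \<Rightarrow> bool" where
  "bivector_gauge G \<longleftrightarrow>
     (\<forall>x y. 0 \<le> G x y \<and> G x y \<le> norm x * norm y) \<and>
     (\<forall>x y z. G (x + y) z \<le> G x z + G y z) \<and>
     (\<forall>x y. G y x = G x y) \<and>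
     (\<forall>x y c. G (c *s x) y = cmod c * G x y) \<and>
     (\<forall>x y c. G x (y + c *s x) = G x y)"

lemma bivector_gaugeD:
  assumes "bivector_gauge G"
  shows "0 \<le> G x y" "G x y \<le> norm x * norm y" "G (x + z) y \<le> G x y + G z y" "G y x = G x y"
    "G (c *s x) y = cmod c * G x y" "G x (y + c *s x) = G x y"
  using assms unfolding bivector_gauge_def by blast+

lemma bivector_gauge_wedge_norm: "bivector_gauge wedge_norm"
  unfolding bivector_gauge_def
  by (intro conjI allI wedge_norm_nonneg wedge_norm_le wedge_norm_add_left wedge_norm_commute
      wedge_norm_scale_left wedge_norm_shear)

lemma bivector_gauge_scale_right: "bivector_gauge G \<Longrightarrow> G x (c *s y) = cmod c * G x y"
  using bivector_gaugeD(4,5) by metis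

text \<open>One argument is changed at a time. The estimate gives joint continuity, the source of
  measurability and of the later compactness argument.\<close>

lemma bivector_gauge_diff_le:
  assumes "bivector_gauge G"
  shows "G x y - G x' y' \<le> norm (x - x') * norm y + norm x' * norm (y - y')"
proof -
  note G = bivector_gaugeD[OF assms]
  have "G x y \<le> G (x - x') y + G x' y" using G(3)[of "x - x'" x' y] by simp
  also have "G x' y \<le> G x' (y - y') + G x' y'"
    using G(3)[of "y - y'" y' x'] unfolding G(4)[of _ x'] by simp
  finally have "G x y - G x' y' \<le> G (x - x') y + G x' (y - y')" by simp
  also have "\<dots> \<le> norm (x - x') * norm y + norm x' * norm (y - y')" by (intro add_mono G)
  finally show ?thesis .
qed

lemma bivector_gauge_continuous:
  assumes "bivector_gauge G" "continuous_on S f" "continuous_on S g"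
  shows "continuous_on S (\<lambda>t. G (f t) (g t))"
  unfolding continuous_on_def
proof
  fix s assume s: "s \<in> S"
  have fg: "(f \<longlongrightarrow> f s) (at s within S)" "(g \<longlongrightarrow> g s) (at s within S)"
    using assms(2,3) s by (auto simp: continuous_on_def)
  let ?h = "\<lambda>t. norm (f t - f s) * norm (g t) + norm (f s) * norm (g t - g s)
    + (norm (f s - f t) * norm (g s) + norm (f t) * norm (g s - g t))"
  have "(?h \<longlongrightarrow> norm (f s - f s) * norm (g s) + norm (f s) * norm (g s - g s)
    + (norm (f s - f s) * norm (g s) + norm (f s) * norm (g s - g s))) (at s within S)"
    by (intro tendsto_intros fg)
  then have lim: "(?h \<longlongrightarrow> 0) (at s within S)" by simp
  have le: "\<bar>G (f t) (g t) - G (f s) (g s)\<bar> \<le> ?h t" for t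
    using bivector_gauge_diff_le[OF assms(1), of "f t" "g t" "f s" "g s"]
      bivector_gauge_diff_le[OF assms(1), of "f s" "g s" "f t" "g t"]
    by (intro abs_leI) (simp_all add: add_increasing add_increasing2)
  have "((\<lambda>t. G (f t) (g t) - G (f s) (g s)) \<longlongrightarrow> 0) (at s within S)"
    by (rule Lim_null_comparison[OF always_eventually lim]) (use le in simp)
  then show "((\<lambda>t. G (f t) (g t)) \<longlongrightarrow> G (f s) (g s)) (at s within S)" by (rule LIM_zero_cancel)
qed

text \<open>Gram-Schmidt: a shear makes the second vector orthogonal to the first without changing
  either side, and homogeneity reduces to orthonormal pairs, where the wedge norm is 1.\<close>

lemma bivector_gauge_le_wedge_norm:
  assumes "bivector_gauge G"
  shows "G x y \<le> wedge_norm x y"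
    and "(\<And>u v. norm u = 1 \<Longrightarrow> norm v = 1 \<Longrightarrow> cinner u v = 0 \<Longrightarrow> G u v \<le> K) \<Longrightarrow> 0 \<le> K \<Longrightarrow>
      G x y \<le> K * wedge_norm x y"
proof -
  note G = bivector_gaugeD[OF assms]
  have "G x y \<le> K * wedge_norm x y"
    if K: "\<And>u v. norm u = 1 \<Longrightarrow> norm v = 1 \<Longrightarrow> cinner u v = 0 \<Longrightarrow> G u v \<le> K" and "0 \<le> K" for K
  proof (cases "x = 0")
    case True
    have "0 \<le> K * wedge_norm x y" using \<open>0 \<le> K\<close> by simp
    moreover have "G x y \<le> 0" using G(2)[of x y] True by simp
    ultimately show ?thesis by (rule order_trans[rotated])
  next
    case False
    define c where "c = - cinner x y / cinner x x"
    define z where "z = y + c *s x"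
    have "cinner x z = cinner x y + c * cinner x x" by (simp add: z_def cinner_add_right cinner_scale_right)
    then have "cinner x z = 0" using False by (simp add: c_def cinner_self)
    have Gz: "G x y = G x z" "wedge_norm x y = wedge_norm x z"
      by (simp_all add: z_def G(6) wedge_norm_shear)
    have w: "wedge_norm x z = norm x * norm z" using \<open>cinner x z = 0\<close> by (rule wedge_norm_orthogonal)
    show ?thesis
    proof (cases "z = 0")
      case True
      then have "G x y \<le> 0" using G(2)[of x z] Gz by simp
      also have "0 \<le> K * wedge_norm x y" using \<open>0 \<le> K\<close> by simp
      finally show ?thesis .
    next
      case z: False
      define u v where "u = complex_of_real (inverse (norm x)) *s x" and "v = complex_of_real (inverse (norm z)) *s z"
      have uv: "norm u = 1" "norm v = 1" "cinner u v = 0"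
        using False z \<open>cinner x z = 0\<close>
        by (simp_all add: u_def v_def norm_vec_scale norm_inverse cinner_scale_left cinner_scale_right norm_divide)
      have "x = complex_of_real (norm x) *s u" "z = complex_of_real (norm z) *s v"
        using False z by (simp_all add: u_def v_def)
      then have "G x z = norm x * (norm z * G u v)"
        by (metis G(5) bivector_gauge_scale_right[OF assms] norm_of_real abs_norm_cancel)
      also have "\<dots> \<le> norm x * (norm z * K)" by (intro mult_left_mono K uv) auto
      finally show ?thesis unfolding Gz w by (simp add: mult_ac)
    qed
  qed
  note * = this
  then show "(\<And>u v. norm u = 1 \<Longrightarrow> norm v = 1 \<Longrightarrow> cinner u v = 0 \<Longrightarrow> G u v \<le> K) \<Longrightarrow> 0 \<le> K \<Longrightarrow>
      G x y \<le> K * wedge_norm x y" by blast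
  have "G u v \<le> 1" if "norm u = 1" "norm v = 1" for u v using G(2)[of u v] that by simp
  then show "G x y \<le> wedge_norm x y" using *[of 1] by simp
qed

section \<open>Averaging over the measure\<close>

locale kraus_measure =
  fixes \<mu> :: "(complex^'k^'k) measure"
  assumes sets: "sets \<mu> = sets borel"
    and norm_squared: "\<And>x. integrable \<mu> (\<lambda>v. (norm (v *v x))\<^sup>2)" "\<And>x. (\<integral>v. (norm (v *v x))\<^sup>2 \<partial>\<mu>) = (norm x)\<^sup>2"
begin

lemma space: "space \<mu> = UNIV"
  using sets_eq_imp_space_eq[OF sets] by simp

lemma continuous_measurable: "continuous_on UNIV h \<Longrightarrow> h \<in> borel_measurable \<mu>"
  using borel_measurable_continuous_onI measurable_cong_sets[OF sets refl] by blast

lemma integrable_of_continuous: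
  fixes h :: "complex^'k^'k \<Rightarrow> 'b :: {banach, second_countable_topology}"
  assumes "continuous_on UNIV h" "\<And>v. norm (h v) \<le> c * ((norm (v *v x))\<^sup>2 + (norm (v *v y))\<^sup>2)"
  shows "integrable \<mu> h"
proof (rule Bochner_Integration.integrable_bound)
  show "integrable \<mu> (\<lambda>v. c * ((norm (v *v x))\<^sup>2 + (norm (v *v y))\<^sup>2))"
    by (intro integrable_mult_right Bochner_Integration.integrable_add norm_squared)
  show "h \<in> borel_measurable \<mu>" by (rule continuous_measurable[OF assms(1)])
  show "AE v in \<mu>. norm (h v) \<le> norm (c * ((norm (v *v x))\<^sup>2 + (norm (v *v y))\<^sup>2))"
    using assms(2) by (intro AE_I2) (metis abs_ge_self order_trans real_norm_def)
qed

lemma norm_product_le: "norm a * norm b \<le> (norm a)\<^sup>2 + (norm b)\<^sup>2" for a b :: "'b :: real_normed_vector"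
proof -
  have "2 * (norm a * norm b) \<le> (norm a)\<^sup>2 + (norm b)\<^sup>2"
    using sum_squares_bound[of "norm a" "norm b"] by (simp add: mult.assoc)
  moreover have "norm a * norm b \<le> 2 * (norm a * norm b)" by simp
  ultimately show ?thesis by (rule order_trans[rotated])
qed

lemma integrable_norm_product: "integrable \<mu> (\<lambda>v. norm (v *v x) * norm (v *v y))"
proof (rule integrable_of_continuous)
  show "continuous_on UNIV (\<lambda>v. norm (v *v x) * norm (v *v y))"
    by (intro continuous_intros continuous_matrix_vector_left)
  show "norm (norm (v *v x) * norm (v *v y)) \<le> 1 * ((norm (v *v x))\<^sup>2 + (norm (v *v y))\<^sup>2)" for v
    using norm_product_le[of "v *v x" "v *v y"] by simp
qed

lemma integral_norm_product_le: "(\<integral>v. norm (v *v x) * norm (v *v y) \<partial>\<mu>) \<le> norm x * norm y"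
proof (cases "x = 0 \<or> y = 0")
  case True
  then show ?thesis by auto
next
  case False
  \<comment> \<open>The weight for which the two terms of the arithmetic-geometric mean inequality
    have equal integrals.\<close>
  define r where "r = norm y / norm x"
  have r: "r > 0" using False by (simp add: r_def)
  have "norm (v *v x) * norm (v *v y) \<le> r / 2 * (norm (v *v x))\<^sup>2 + 1 / (2 * r) * (norm (v *v y))\<^sup>2" for v
  proof -
    have "0 \<le> (r * norm (v *v x) - norm (v *v y))\<^sup>2 / (2 * r)" using r by simp
    also have "\<dots> = r / 2 * (norm (v *v x))\<^sup>2 + 1 / (2 * r) * (norm (v *v y))\<^sup>2 - norm (v *v x) * norm (v *v y)"
      using r by (simp add: power2_eq_square field_simps)
    finally show ?thesis by simp
  qed
  then have "(\<integral>v. norm (v *v x) * norm (v *v y) \<partial>\<mu>)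
      \<le> (\<integral>v. r / 2 * (norm (v *v x))\<^sup>2 + 1 / (2 * r) * (norm (v *v y))\<^sup>2 \<partial>\<mu>)"
    by (intro integral_mono integrable_norm_product Bochner_Integration.integrable_add integrable_mult_right norm_squared)
  also have "\<dots> = r / 2 * (norm x)\<^sup>2 + 1 / (2 * r) * (norm y)\<^sup>2"
    by (subst Bochner_Integration.integral_add) (simp_all add: norm_squared)
  also have "\<dots> = norm x * norm y"
    using False by (simp add: r_def power2_eq_square field_simps)
  finally show ?thesis .
qed

definition avg :: "(complex^'k \<Rightarrow> complex^'k \<Rightarrow> real) \<Rightarrow> complex^'k \<Rightarrow> complex^'k \<Rightarrow> real" where
  "avg G x y = (\<integral>v. G (v *v x) (v *v y) \<partial>\<mu>)"

lemma gauge_continuous_left: "bivector_gauge G \<Longrightarrow> continuous_on UNIV (\<lambda>v. G (v *v x) (v *v y))"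
  by (intro bivector_gauge_continuous continuous_matrix_vector_left)

lemma integrable_gauge: "bivector_gauge G \<Longrightarrow> integrable \<mu> (\<lambda>v. G (v *v x) (v *v y))"
proof (rule integrable_of_continuous)
  assume G: "bivector_gauge G"
  show "continuous_on UNIV (\<lambda>v. G (v *v x) (v *v y))" by (rule gauge_continuous_left[OF G])
  show "norm (G (v *v x) (v *v y)) \<le> 1 * ((norm (v *v x))\<^sup>2 + (norm (v *v y))\<^sup>2)" for v
    using bivector_gaugeD(1,2)[OF G, of "v *v x" "v *v y"] norm_product_le[of "v *v x" "v *v y"] by simp
qed

text \<open>The upper bound is Cauchy-Schwarz combined with the normalisation; the other properties
  hold for each \<open>v\<close> and are integrated.\<close>

lemma bivector_gauge_avg:
  assumes "bivector_gauge G"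
  shows "bivector_gauge (avg G)"
proof -
  note G = bivector_gaugeD[OF assms] and int = integrable_gauge[OF assms]
  have "avg G x y \<le> norm x * norm y" for x y
    unfolding avg_def
    by (rule order_trans[OF integral_mono integral_norm_product_le]) (intro int integrable_norm_product G)+
  moreover have "0 \<le> avg G x y" for x y unfolding avg_def by (intro Bochner_Integration.integral_nonneg G)
  moreover have "avg G (x + z) y \<le> avg G x y + avg G z y" for x y z
    unfolding avg_def Bochner_Integration.integral_add[OF int int, symmetric] matrix_vector_right_distrib
    by (intro integral_mono Bochner_Integration.integrable_add G int[of "x + z", unfolded matrix_vector_right_distrib] int)
  moreover have "avg G y x = avg G x y" for x y unfolding avg_def by (simp only: G(4)[of "_ *v y"])
  moreover have "avg G (c *s x) y = cmod c * avg G x y" for x y c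
    unfolding avg_def by (simp add: matrix_vector_mult_scale G(5))
  moreover have "avg G x (y + c *s x) = avg G x y" for x y c
    unfolding avg_def by (simp add: matrix_vector_mult_scale matrix_vector_right_distrib G(6))
  ultimately show ?thesis unfolding bivector_gauge_def by blast
qed

lemma avg_mono:
  assumes "bivector_gauge G" "bivector_gauge G'" "\<And>x y. G x y \<le> K * G' x y"
  shows "avg G x y \<le> K * avg G' x y"
proof -
  have "avg G x y \<le> (\<integral>v. K * G' (v *v x) (v *v y) \<partial>\<mu>)"
    unfolding avg_def by (intro integral_mono integrable_mult_right integrable_gauge assms)
  then show ?thesis by (simp add: avg_def)
qed

text \<open>This is F_n of the overview, obtained by integrating over the first matrix of the
  product and recursing.\<close>

definition avg_wedge :: "nat \<Rightarrow> complex^'k \<Rightarrow> complex^'k \<Rightarrow> real" where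
  "avg_wedge n = (avg ^^ n) wedge_norm"

lemma avg_wedge_0: "avg_wedge 0 = wedge_norm" and avg_wedge_Suc: "avg_wedge (Suc n) = avg (avg_wedge n)"
  by (simp_all add: avg_wedge_def)

lemma bivector_gauge_avg_wedge: "bivector_gauge (avg_wedge n)"
  by (induction n) (simp_all add: avg_wedge_0 avg_wedge_Suc bivector_gauge_wedge_norm bivector_gauge_avg)

text \<open>The wedge norm is the largest gauge, which settles the first step; monotonicity of
  averaging does the rest.\<close>

lemma avg_wedge_Suc_le: "avg_wedge (Suc n) x y \<le> avg_wedge n x y"
proof (induction n arbitrary: x y)
  case 0
  show ?case using bivector_gauge_le_wedge_norm(1)[OF bivector_gauge_avg_wedge[of "Suc 0"]] by (simp only: avg_wedge_0)
next
  case (Suc n)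
  have "avg (avg_wedge (Suc n)) x y \<le> 1 * avg (avg_wedge n) x y"
    by (rule avg_mono[OF bivector_gauge_avg_wedge bivector_gauge_avg_wedge]) (simp add: Suc.IH)
  then show ?case by (simp add: avg_wedge_Suc)
qed

lemma avg_wedge_antimono: "m \<le> n \<Longrightarrow> avg_wedge n x y \<le> avg_wedge m x y"
  by (induction rule: dec_induct) (use avg_wedge_Suc_le order_trans in blast)+

text \<open>Each complete block of \<open>n\<close> averages contributes a factor \<open>K\<close>;
  the incomplete block is bounded by the wedge norm.\<close>

lemma avg_wedge_geometric:
  assumes "\<And>x y. avg_wedge n x y \<le> K * wedge_norm x y" "0 \<le> K"
  shows "avg_wedge j x y \<le> K ^ (j div n) * wedge_norm x y"
proof -
  have 1: "avg_wedge (n + j) x y \<le> K * avg_wedge j x y" for j x y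
  proof (induction j arbitrary: x y)
    case (Suc j)
    have "avg (avg_wedge (n + j)) x y \<le> K * avg (avg_wedge j) x y"
      by (rule avg_mono[OF bivector_gauge_avg_wedge bivector_gauge_avg_wedge Suc.IH])
    then show ?case by (simp add: avg_wedge_Suc)
  qed (use assms(1) in \<open>simp add: avg_wedge_0\<close>)
  have 2: "avg_wedge (n * k + r) x y \<le> K ^ k * avg_wedge r x y" for k r
  proof (induction k)
    case (Suc k)
    have "avg_wedge (n * Suc k + r) x y \<le> K * avg_wedge (n * k + r) x y" using 1[of "n * k + r"] by (simp add: add.assoc)
    also have "\<dots> \<le> K * (K ^ k * avg_wedge r x y)" using assms(2) Suc by (intro mult_left_mono)
    finally show ?case by simp
  qed simp
  have "avg_wedge j x y = avg_wedge (n * (j div n) + j mod n) x y" by simp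
  also have "\<dots> \<le> K ^ (j div n) * avg_wedge (j mod n) x y" by (rule 2)
  also have "\<dots> \<le> K ^ (j div n) * wedge_norm x y"
    using assms(2) by (intro mult_left_mono bivector_gauge_le_wedge_norm(1)[OF bivector_gauge_avg_wedge]) auto
  finally show ?thesis .
qed

section \<open>The support of the measure and the case of equality\<close>

definition supp :: "(complex^'k^'k) set" where
  "supp = - \<Union>{U. open U \<and> emeasure \<mu> U = 0}"

text \<open>By the Lindeloef property countably many open null sets already cover the complement of
  the support.\<close>

lemma AE_supp: "AE v in \<mu>. v \<in> supp"
proof -
  obtain \<U> where \<U>: "\<U> \<subseteq> {U. open U \<and> emeasure \<mu> U = 0}" "countable \<U>" "\<Union>\<U> = \<Union>{U. open U \<and> emeasure \<mu> U = 0}"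
    using Lindelof[of "{U :: (complex^'k^'k) set. open U \<and> emeasure \<mu> U = 0}"] by blast
  have "(\<Union>U\<in>\<U>. U) \<in> null_sets \<mu>"
    using \<U> sets by (intro null_sets_UN') (auto simp: null_sets_def)
  then show ?thesis
    by (rule AE_I') (use \<U>(3) in \<open>auto simp: supp_def\<close>)
qed

lemma AE_imp_supp:
  fixes h :: "complex^'k^'k \<Rightarrow> real"
  assumes "AE v in \<mu>. h v = 0" "continuous_on UNIV h" "v \<in> supp"
  shows "h v = 0"
proof (rule ccontr)
  assume "h v \<noteq> 0"
  have "open (h -` (- {0}))" by (intro open_vimage open_Compl closed_singleton assms(2))
  moreover have "emeasure \<mu> (h -` (- {0})) = 0"
  proof -
    have "h -` (- {0}) \<in> sets \<mu>" using calculation sets by simp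
    then show ?thesis using assms(1) by (subst AE_iff_measurable[symmetric, of _ _ "\<lambda>v. h v = 0"]) (auto simp: space)
  qed
  ultimately show False using assms(3) \<open>h v \<noteq> 0\<close> unfolding supp_def by blast
qed

lemma avg_wedge_le_mean: "avg_wedge n x y \<le> ((norm x)\<^sup>2 + (norm y)\<^sup>2) / 2"
  using bivector_gaugeD(2)[OF bivector_gauge_avg_wedge, of n x y] sum_squares_bound[of "norm x" "norm y"] by simp

text \<open>The mean of \<open>\<parallel>x\<parallel>\<^sup>2\<close> and \<open>\<parallel>y\<parallel>\<^sup>2\<close> is invariant under averaging, so equality in
  \<open>avg_wedge_le_mean\<close> passes to almost every, hence by continuity to every matrix of the support.\<close>

lemma avg_wedge_extremal:
  assumes "avg_wedge n x y = ((norm x)\<^sup>2 + (norm y)\<^sup>2) / 2" "\<And>i. i < n \<Longrightarrow> w i \<in> supp"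
  shows "wedge_norm (mat_prod n w *v x) (mat_prod n w *v y)
    = ((norm (mat_prod n w *v x))\<^sup>2 + (norm (mat_prod n w *v y))\<^sup>2) / 2"
proof -
  have *: "avg_wedge j (mat_prod i w *v x) (mat_prod i w *v y)
      = ((norm (mat_prod i w *v x))\<^sup>2 + (norm (mat_prod i w *v y))\<^sup>2) / 2" if "i + j = n" for i j
    using that
  proof (induction i arbitrary: j)
    case 0
    then show ?case using assms(1) by simp
  next
    case (Suc i)
    define a b where "a = mat_prod i w *v x" and "b = mat_prod i w *v y"
    \<comment> \<open>The defect is nonnegative and continuous; its integral vanishes because the
      mean of squares is invariant and equality holds one level up.\<close>
    let ?h = "\<lambda>v. ((norm (v *v a))\<^sup>2 + (norm (v *v b))\<^sup>2) / 2 - avg_wedge j (v *v a) (v *v b)"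
    have eq: "avg_wedge (Suc j) a b = ((norm a)\<^sup>2 + (norm b)\<^sup>2) / 2"
      using Suc.IH[of "Suc j"] Suc.prems by (simp add: a_def b_def)
    have int1: "integrable \<mu> (\<lambda>v. ((norm (v *v a))\<^sup>2 + (norm (v *v b))\<^sup>2) / 2)"
      by (intro integrable_divide Bochner_Integration.integrable_add norm_squared)
    have int2: "integrable \<mu> (\<lambda>v. avg_wedge j (v *v a) (v *v b))" by (intro integrable_gauge bivector_gauge_avg_wedge)
    have "(\<integral>v. ?h v \<partial>\<mu>) = 0"
      using eq by (subst Bochner_Integration.integral_diff[OF int1 int2]) (simp add: norm_squared avg_wedge_Suc avg_def)
    moreover have "integrable \<mu> ?h" by (intro Bochner_Integration.integrable_diff int1 int2)
    moreover have "AE v in \<mu>. 0 \<le> ?h v" by (intro AE_I2) (simp add: avg_wedge_le_mean[simplified])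
    ultimately have "AE v in \<mu>. ?h v = 0" by (subst integral_nonneg_eq_0_iff_AE[symmetric])
    moreover have "continuous_on UNIV ?h"
      by (intro continuous_intros continuous_matrix_vector_left gauge_continuous_left bivector_gauge_avg_wedge) simp
    ultimately have "?h (w i) = 0" using assms(2)[of i] Suc.prems by (intro AE_imp_supp) auto
    then show ?case by (simp add: a_def b_def matrix_vector_mul_assoc)
  qed
  show ?thesis using *[of n 0] by (simp add: avg_wedge_0)
qed

end

section \<open>Purification\<close>

lemma sets_power_measure: "sets (power_measure M n) = sets (PiM {..<n} (\<lambda>_. M))"
  by (cases n) simp_all

text \<open>If the iterated integral fails to define a measure, \<open>\<Otimes>\<^sub>M\<close> is the zero measure, and the bound
  still holds.\<close>

lemma emeasure_pair_measure_le:
  assumes "X \<in> sets (A \<Otimes>\<^sub>M B)"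
  shows "emeasure (A \<Otimes>\<^sub>M B) X \<le> (\<integral>\<^sup>+w. \<integral>\<^sup>+v. indicator X (w, v) \<partial>B \<partial>A)"
  unfolding pair_measure_def emeasure_measure_of_conv by simp

text \<open>The argument must survive a factor that is not \<sigma>-finite. The set of words leaving
  \<open>S\<close> has sections of measure zero for almost every prefix, and an upper bound for its
  product measure suffices.\<close>

lemma AE_power_measure:
  assumes S: "AE v in M. v \<in> S" "S \<in> sets M"
  shows "AE w in power_measure M n. \<forall>i<n. w i \<in> S"
proof (induction n)
  case (Suc n)
  let ?A = "power_measure M n" and ?f = "\<lambda>(w, v). w(n := v)"
  let ?N = "PiM {..<Suc n} (\<lambda>_. M)"
  have f: "?f \<in> ?A \<Otimes>\<^sub>M M \<rightarrow>\<^sub>M ?N"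
    using measurable_add_dim[of n "{..<n}" "\<lambda>_. M"]
    by (simp add: lessThan_Suc cong: measurable_cong_sets sets_pair_measure_cong)
      (subst measurable_cong_sets[OF sets_pair_measure_cong[OF sets_power_measure refl] refl], simp)
  have good: "{w \<in> space ?N. \<forall>i<Suc n. w i \<in> S} = Pi\<^sub>E {..<Suc n} (\<lambda>_. S)"
    using sets.sets_into_space[OF S(2)] 
    unfolding space_PiM set_eq_iff mem_Collect_eq PiE_iff Ball_def lessThan_iff by blast
  have goodS: "{w \<in> space ?N. \<forall>i<Suc n. w i \<in> S} \<in> sets ?N"
    unfolding good using S(2) by (intro sets_PiM_I_finite) auto
  define X where "X = ?f -` (space ?N - {w \<in> space ?N. \<forall>i<Suc n. w i \<in> S}) \<inter> space (?A \<Otimes>\<^sub>M M)"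
  have X: "X \<in> sets (?A \<Otimes>\<^sub>M M)"
    unfolding X_def by (rule measurable_sets[OF f sets.Diff[OF sets.top goodS]])
  have "emeasure (?A \<Otimes>\<^sub>M M) X \<le> (\<integral>\<^sup>+w. \<integral>\<^sup>+v. indicator X (w, v) \<partial>M \<partial>?A)"
    by (rule emeasure_pair_measure_le[OF X])
  also have "\<dots> = (\<integral>\<^sup>+w. 0 \<partial>?A)"
  proof (rule nn_integral_cong_AE, rule AE_mp[OF Suc.IH], rule AE_I2, rule impI)
    fix w assume w: "\<forall>i<n. w i \<in> S"
    have "(\<integral>\<^sup>+v. indicator X (w, v) \<partial>M) = (\<integral>\<^sup>+v. 0 \<partial>M)"
      by (rule nn_integral_cong_AE, rule AE_mp[OF S(1)])
        (use w in \<open>auto simp: X_def indicator_def less_Suc_eq\<close>)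
    then show "(\<integral>\<^sup>+v. indicator X (w, v) \<partial>M) = 0" by simp
  qed
  finally have "X \<in> null_sets (?A \<Otimes>\<^sub>M M)" using X by (simp add: null_sets_def)
  then have "AE x in ?A \<Otimes>\<^sub>M M. \<forall>i<Suc n. ?f x i \<in> S"
    by (rule AE_I') (use measurable_space[OF f] in \<open>auto simp: X_def\<close>)
  then show ?case
    unfolding power_measure.simps(2) by (rule iffD2[OF AE_distr_iff[OF f goodS]])
qed simp

text \<open>All rows are multiples of one vector \<open>w\<close>, so the matrix is an outer product
  and its values lie on one line.\<close>

lemma rank_1_imp_range:
  fixes A :: "complex^'n^'m"
  assumes "rank A = 1"
  obtains c where "\<forall>u. \<exists>t. A *v u = t *s c"
proof -
  obtain B where B: "rows A \<subseteq> vec.span B" "card B = vec.dim (rows A)"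
    using vec.basis_exists[of "rows A"] by metis
  then have "card B = 1" using assms by (simp add: row_rank_def_gen)
  then obtain w where w: "B = {w}" by (rule card_1_singletonE)
  have "\<exists>k. row i A = k *s w" for i
    using B(1) unfolding w vec.span_singleton rows_def by blast
  then obtain c where c: "\<And>i. row i A = c i *s w" by metis
  have "A *v u = (\<Sum>j\<in>UNIV. w $ j * u $ j) *s (\<chi> i. c i)" for u
  proof -
    have "A $ i $ j = c i * w $ j" for i j
      using arg_cong[OF c[of i], of "\<lambda>x. x $ j"] by (simp add: row_def)
    then show ?thesis
      by (simp add: vec_eq_iff matrix_vector_mult_def sum_distrib_left mult_ac)
  qed
  then show ?thesis by (intro that[of "\<chi> i. c i"]) blast
qed

context kraus_measure
begin

lemma supp_sets: "supp \<in> sets \<mu>"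
proof -
  have "closed supp" unfolding supp_def by (intro closed_Compl open_Union) auto
  then show ?thesis using sets by simp
qed

text \<open>\<open>P\<close> projects onto the plane of \<open>x\<close> and \<open>y\<close>.
  Products of support matrices send this pair to orthogonal vectors of equal length, so (Pur)
  applies to \<open>P\<close> and would give it rank one.\<close>

lemma purification_contradiction:
  assumes pur: "purification \<mu>"
    and x: "norm x = 1" and y: "norm y = 1" and xy: "cinner x y = 0" and F1: "\<And>n. avg_wedge n x y = 1"
  shows False
proof -
  define P :: "complex^'k^'k" where "P = (\<chi> i j. x $ i * cnj (x $ j) + y $ i * cnj (y $ j))"
  have P: "P *v u = cinner x u *s x + cinner y u *s y" for u
    by (simp add: vec_eq_iff P_def matrix_vector_mult_def cinner_def sum_distrib_left sum_distrib_right
        sum.distrib algebra_simps)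
  have yx: "cinner y x = 0" using xy cinner_commute[of y x] by simp
  have 1: "cinner x x = 1" "cinner y y = 1" using x y by (simp_all add: cinner_self)
  have Pxy: "P *v x = x" "P *v y = y" by (simp_all add: P 1 xy yx)
  have nz: "x \<noteq> 0" "y \<noteq> 0" using x y by auto
  have "P ** P = P"
    unfolding matrix_eq
  proof
    fix u
    show "P ** P *v u = P *v u"
      by (simp add: matrix_vector_mul_assoc[symmetric])
        (simp add: P cinner_add_right cinner_scale_right 1 xy yx)
  qed
  moreover have "madj P = P" by (simp add: madj_def P_def vec_eq_iff mult.commute)
  ultimately have "orth_projector P" by (simp add: orth_projector_def)
  moreover have "P \<noteq> 0" using Pxy(1) nz(1) by auto
  moreover have "AE w in power_measure \<mu> n.
      \<exists>c. P ** madj (mat_prod n w) ** mat_prod n w ** P = (\<chi> i j. c * P $ i $ j)" for n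
  proof (rule AE_mp[OF AE_power_measure[OF AE_supp supp_sets, of n]], rule AE_I2, rule impI)
    fix w :: "nat \<Rightarrow> complex^'k^'k" assume w: "\<forall>i<n. w i \<in> supp"
    let ?W = "mat_prod n w"
    define a b where "a = ?W *v x" and "b = ?W *v y"
    have ext: "wedge_norm a b = ((norm a)\<^sup>2 + (norm b)\<^sup>2) / 2"
      unfolding a_def b_def using w by (intro avg_wedge_extremal) (simp_all add: F1 x y)
    \<comment> \<open>Equality makes the arithmetic mean of the squares at most the product of the
      norms, which forces equal norms; the Gram determinant then gives orthogonality.\<close>
    have "(norm a - norm b)\<^sup>2 \<le> 0"
      using wedge_norm_le[of a b] unfolding ext by (simp add: power2_diff)
    then have ab: "norm b = norm a" by simp
    have "(wedge_norm a b)\<^sup>2 = ((norm a)\<^sup>2)\<^sup>2" unfolding ext ab by simp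
    then have "(cmod (cinner a b))\<^sup>2 = 0"
      unfolding wedge_norm_squared ab by (simp add: power2_eq_square)
    then have cab: "cinner a b = 0" "cinner b a = 0" using cinner_commute[of b a] by auto
    define c where "c = complex_of_real ((norm a)\<^sup>2)"
    have "P ** madj ?W ** ?W ** P = (\<chi> i j. c * P $ i $ j)"
      unfolding matrix_eq
    proof
      fix u
      have "?W *v (P *v u) = cinner x u *s a + cinner y u *s b"
        by (simp add: P a_def b_def matrix_vector_right_distrib matrix_vector_mult_scale)
      then have "P ** madj ?W ** ?W ** P *v u = P *v (madj ?W *v (cinner x u *s a + cinner y u *s b))"
        by (simp add: matrix_vector_mul_assoc[symmetric])
      also have "\<dots> = c *s (P *v u)"
        unfolding P[of "madj ?W *v _"] cinner_madj a_def[symmetric] b_def[symmetric]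
        by (simp add: P cinner_add_right cinner_scale_right cab cinner_self ab c_def vec.scale_right_distrib mult.commute)
      also have "\<dots> = (\<chi> i j. c * P $ i $ j) *v u"
        by (simp add: vec_eq_iff matrix_vector_mult_def sum_distrib_left mult.assoc)
      finally show "P ** madj ?W ** ?W ** P *v u = (\<chi> i j. c * P $ i $ j) *v u" .
    qed
    then show "\<exists>c. P ** madj ?W ** ?W ** P = (\<chi> i j. c * P $ i $ j)" by blast
  qed
  ultimately have "rank P = 1" using pur unfolding purification_def by blast
  then obtain c where "\<forall>u. \<exists>t. P *v u = t *s c" by (rule rank_1_imp_range)
  then obtain s t where st: "x = s *s c" "y = t *s c" using Pxy by metis
  then have "cinner x y = cnj s * t * cinner c c" by (simp add: cinner_scale_left cinner_scale_right mult_ac)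
  moreover have "s \<noteq> 0" "t \<noteq> 0" "c \<noteq> 0" using st nz by auto
  ultimately show False using xy by (simp add: cinner_self)
qed

definition orthonormal_pairs :: "((complex^'k) \<times> (complex^'k)) set" where
  "orthonormal_pairs = {z. norm (fst z) = 1 \<and> norm (snd z) = 1 \<and> cinner (fst z) (snd z) = 0}"

lemma compact_orthonormal_pairs: "compact orthonormal_pairs"
proof -
  have "closed orthonormal_pairs"
    unfolding orthonormal_pairs_def cinner_def
    by (intro closed_Collect_conj closed_Collect_eq continuous_intros)
  moreover have "orthonormal_pairs \<subseteq> cball 0 1 \<times> cball 0 1"
    by (auto simp: orthonormal_pairs_def mem_Times_iff)
  ultimately show ?thesis
    using compact_Int_closed[OF compact_Times[OF compact_cball compact_cball], of orthonormal_pairs 0 1 0 1]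
    by (simp add: Int_absorb1)
qed

lemma continuous_avg_wedge: "continuous_on S (\<lambda>z. avg_wedge n (fst z) (snd z))"
  by (intro bivector_gauge_continuous bivector_gauge_avg_wedge continuous_intros)

text \<open>A Dini argument: the sets where no contraction has happened after \<open>n\<close> steps
  are compact and decreasing, and a common point contradicts (Pur).\<close>

lemma contraction:
  assumes pur: "purification \<mu>"
  shows "\<exists>n K. 0 < K \<and> K < 1 \<and> (\<forall>x y. avg_wedge n x y \<le> K * wedge_norm x y)"
proof -
  define E where "E n = orthonormal_pairs \<inter> {z. 1 \<le> avg_wedge n (fst z) (snd z)}" for n
  have comp: "compact (E n)" for n
    unfolding E_def
    by (intro compact_Int_closed compact_orthonormal_pairs closed_Collect_le continuous_avg_wedge continuous_intros)
  have avg_wedge_le_1: "avg_wedge n (fst z) (snd z) \<le> 1" if "z \<in> orthonormal_pairs" for n z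
    using bivector_gaugeD(2)[OF bivector_gauge_avg_wedge, of n "fst z" "snd z"] that by (simp add: orthonormal_pairs_def)
  have "\<exists>n. E n = {}"
  proof (rule ccontr)
    assume "\<nexists>n. E n = {}"
    then have "\<Inter>(range E) \<noteq> {}"
    proof (intro compact_nest comp)
      show "E n \<subseteq> E m" if "m \<le> n" for m n
        unfolding E_def using avg_wedge_antimono[OF that] order_trans by blast
    qed auto
    then obtain z where z: "\<And>n. z \<in> E n" by blast
    have "avg_wedge n (fst z) (snd z) = 1" for n
      using z[of n] avg_wedge_le_1[of z n] by (simp add: E_def)
    moreover have "z \<in> orthonormal_pairs" using z[of 0] by (simp add: E_def)
    ultimately show False
      using purification_contradiction[OF pur, of "fst z" "snd z"] by (simp add: orthonormal_pairs_def)
  qed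
  then obtain n where n: "E n = {}" ..
  \<comment> \<open>For k = 1 there are no orthonormal pairs and 1/2 serves. Otherwise the supremum
    is attained, hence below 1; the maximum with 1/2 keeps \<open>K\<close> positive.\<close>
  have "\<exists>K. 0 < K \<and> K < 1 \<and> (\<forall>z\<in>orthonormal_pairs. avg_wedge n (fst z) (snd z) \<le> K)"
  proof (cases "orthonormal_pairs = {}")
    case False
    obtain z where z: "z \<in> orthonormal_pairs"
        "\<And>u. u \<in> orthonormal_pairs \<Longrightarrow> avg_wedge n (fst u) (snd u) \<le> avg_wedge n (fst z) (snd z)"
      using continuous_attains_sup[OF compact_orthonormal_pairs False continuous_avg_wedge[of _ n]] by blast
    have "avg_wedge n (fst z) (snd z) < 1" using n z(1) by (auto simp: E_def not_le)
    then show ?thesis using z(2) by (intro exI[of _ "max (1/2) (avg_wedge n (fst z) (snd z))"]) (auto intro: max.coboundedI2)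
  qed (auto intro!: exI[of _ "1/2"])
  then obtain K where K: "0 < K" "K < 1" "\<And>z. z \<in> orthonormal_pairs \<Longrightarrow> avg_wedge n (fst z) (snd z) \<le> K" by blast
  have "avg_wedge n u v \<le> K" if "norm u = 1" "norm v = 1" "cinner u v = 0" for u v
    using K(3)[of "(u, v)"] that by (simp add: orthonormal_pairs_def)
  then have "avg_wedge n x y \<le> K * wedge_norm x y" for x y
    using K(1) by (intro bivector_gauge_le_wedge_norm(2)[OF bivector_gauge_avg_wedge]) auto
  with K show ?thesis by blast
qed

end

section \<open>The Markov operator\<close>

text \<open>The homogeneous extension of \<open>f\<close> turns the Markov operator into the
  average \<open>x \<mapsto> \<integral> lift f (v x) d\<mu>(v)\<close>.\<close>

definition lift :: "(('k::finite) proj \<Rightarrow> complex) \<Rightarrow> complex^'k \<Rightarrow> complex" where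
  "lift f x = (if x = 0 then 0 else f (proj_class x) * complex_of_real ((norm x)\<^sup>2))"

lemma lift_unit: "norm x = 1 \<Longrightarrow> lift f x = f (proj_class x)"
  by (auto simp: lift_def)

lemma lift_scale: "lift f (c *s x) = complex_of_real ((cmod c)\<^sup>2) * lift f x"
proof (cases "c = 0 \<or> x = 0")
  case False
  then have "proj_class (c *s x) = proj_class x"
    by (subst proj_class_eq_iff) (auto intro!: exI[of _ "inverse c"])
  then show ?thesis using False by (simp add: lift_def norm_vec_scale power_mult_distrib)
qed (auto simp: lift_def)

lemma lift_add: "lift (f + g) x = lift f x + lift g x"
  by (simp add: lift_def distrib_right)

lemma lift_fscale: "lift (fscale c f) x = c * lift f x"
  by (simp add: lift_def fscale_def)

lemma norm_lift_le: "(\<And>p. cmod (f p) \<le> c) \<Longrightarrow> cmod (lift f x) \<le> c * (norm x)\<^sup>2"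
  by (auto simp: lift_def norm_mult norm_power intro!: mult_right_mono)

text \<open>The increment splits into one of \<open>f\<close> and one of the squared norm. The
  factor \<open>norm x * norm y\<close> in the denominator of the projective distance, raised to
  \<alpha>, leaves the exponent \<open>1 - \<alpha>\<close>.\<close>

lemma lift_diff_le:
  assumes c: "\<And>p. cmod (f p) \<le> c" and A: "\<And>p q. cmod (f p - f q) \<le> A * proj_dist p q powr \<alpha>" "0 \<le> A"
  shows "cmod (lift f x - lift f y)
    \<le> A * (wedge_norm x y powr \<alpha> * (norm x * norm y) powr (1 - \<alpha>)) + c * (norm (x - y) * norm (x + y))"
proof -
  \<comment> \<open>Taking \<open>x\<close> as the shorter vector makes
    \<open>(norm x)\<^sup>2\<close> at most \<open>norm x * norm y\<close>.\<close>
  have le: "cmod (lift f x - lift f y)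
      \<le> A * (wedge_norm x y powr \<alpha> * (norm x * norm y) powr (1 - \<alpha>)) + c * (norm (x - y) * norm (x + y))"
    if xy: "norm x \<le> norm y" for x y
  proof (cases "x = 0")
    case True
    have "cmod (lift f x - lift f y) \<le> c * (norm y)\<^sup>2"
      using norm_lift_le[of f c y, OF c] True by (simp add: lift_def)
    then show ?thesis using True by (simp add: power2_eq_square)
  next
    case False
    then have nz: "x \<noteq> 0" "y \<noteq> 0" using xy by auto
    define w p q where "w = norm x * norm y" and "p = proj_class x" and "q = proj_class y"
    have w: "w > 0" using nz by (simp add: w_def)
    have d: "proj_dist p q = wedge_norm x y / w"
      unfolding p_def q_def w_def by (rule proj_dist_eq_wedge[OF nz])
    have "lift f x - lift f y = (f p - f q) * complex_of_real ((norm x)\<^sup>2)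
        + f q * complex_of_real ((norm x)\<^sup>2 - (norm y)\<^sup>2)"
      using nz by (simp add: lift_def p_def q_def algebra_simps)
    then have "cmod (lift f x - lift f y) \<le> cmod (f p - f q) * (norm x)\<^sup>2 + cmod (f q) * \<bar>(norm x)\<^sup>2 - (norm y)\<^sup>2\<bar>"
      by (metis (no_types, lifting) norm_mult norm_of_real norm_triangle_ineq abs_power2)
    also have "\<dots> \<le> (A * proj_dist p q powr \<alpha>) * w + c * (norm (x - y) * norm (x + y))"
    proof (intro add_mono mult_mono A c abs_norm_squared_diff_le)
      show "(norm x)\<^sup>2 \<le> w" using xy by (simp add: w_def power2_eq_square mult_left_mono)
      show "0 \<le> c" using c[of p] norm_ge_zero order_trans by blast
    qed (use A(2) in auto)
    also have "(A * proj_dist p q powr \<alpha>) * w = A * (wedge_norm x y powr \<alpha> * w powr (1 - \<alpha>))"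
      using w by (simp add: d powr_divide powr_diff)
    finally show ?thesis unfolding w_def .
  qed
  show ?thesis
  proof (cases "norm x \<le> norm y")
    case False
    then show ?thesis
      using le[of y x] by (simp add: norm_minus_commute wedge_norm_commute add.commute mult.commute)
  qed (rule le)
qed

lemma continuous_lift:
  assumes f: "f \<in> holder_space \<alpha>" and \<alpha>: "0 < \<alpha>" "\<alpha> \<le> 1"
  shows "continuous_on UNIV (lift f)"
  unfolding continuous_on_def
proof
  fix a :: "complex^'a"
  note H = holder_spaceD[OF f]
  let ?A = "holder_const \<alpha> f" and ?c = "sup_norm f"
  let ?h = "\<lambda>x. ?A * (wedge_norm x a powr \<alpha> * (1 + norm x * norm a)) + ?c * (norm (x - a) * norm (x + a))"
  have "continuous_on UNIV (\<lambda>x. wedge_norm x a)"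
    by (intro bivector_gauge_continuous bivector_gauge_wedge_norm continuous_intros)
  then have "((\<lambda>x. wedge_norm x a) \<longlongrightarrow> 0) (at a)"
    unfolding continuous_on_def by (metis UNIV_I wedge_norm_self)
  then have "((\<lambda>x. wedge_norm x a powr \<alpha>) \<longlongrightarrow> 0) (at a)"
    using \<alpha>(1) by (intro tendsto_zero_powrI[OF _ tendsto_const]) auto
  then have "(?h \<longlongrightarrow> ?A * (0 * (1 + norm a * norm a)) + ?c * (norm (a - a) * norm (a + a))) (at a)"
    by (intro tendsto_intros)
  then have h0: "(?h \<longlongrightarrow> 0) (at a)" by simp
  \<comment> \<open>A continuous majorant: for \<alpha> = 1 the expression \<open>w powr 0\<close>
    jumps at \<open>w = 0\<close>, where \<open>powr\<close> has value 0.\<close>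
  have "w powr (1 - \<alpha>) \<le> 1 + w" if "0 \<le> w" for w :: real
  proof (cases "w \<le> 1")
    case True
    have "w powr (1 - \<alpha>) \<le> 1" using True that \<alpha> by (intro powr_le1) auto
    then show ?thesis using that by simp
  next
    case False
    have "w powr (1 - \<alpha>) \<le> w powr 1" using False \<alpha> by (intro powr_mono) auto
    then show ?thesis using False by simp
  qed
  then have "?A * (wedge_norm x a powr \<alpha> * (norm x * norm a) powr (1 - \<alpha>)) + ?c * (norm (x - a) * norm (x + a)) \<le> ?h x" for x
    using H(5) by (intro add_right_mono mult_left_mono) auto
  then have le: "cmod (lift f x - lift f a) \<le> ?h x" for x
    using lift_diff_le[of f, OF H(1,2,5), of x a] order_trans by blast
  have "((\<lambda>x. lift f x - lift f a) \<longlongrightarrow> 0) (at a)"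
    by (rule Lim_null_comparison[OF always_eventually h0]) (use le in blast)
  then show "(lift f \<longlongrightarrow> lift f a) (at a within UNIV)" by (rule LIM_zero_cancel)
qed

text \<open>For positive arguments the right-hand side is tangent to the geometric mean along the
  ray \<open>u = U * w\<close>, so varying \<open>U\<close> recovers the geometric mean as an
  infimum.\<close>

lemma weighted_young:
  fixes u w U \<alpha> :: real
  assumes "0 \<le> u" "0 \<le> w" "0 < U" "0 < \<alpha>" "\<alpha> \<le> 1"
  shows "u powr \<alpha> * w powr (1 - \<alpha>) \<le> \<alpha> * U powr (\<alpha> - 1) * u + (1 - \<alpha>) * U powr \<alpha> * w"
proof (cases "u = 0 \<or> w = 0")
  case True
  then show ?thesis using assms by auto
next
  case False
  then have uw: "u / U > 0" "w > 0" using assms by auto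
  have "u powr \<alpha> * w powr (1 - \<alpha>) = U powr \<alpha> * ((u / U) powr \<alpha> * w powr (1 - \<alpha>))"
    using assms by (simp add: powr_divide)
  also have "\<dots> \<le> U powr \<alpha> * (\<alpha> * (u / U) + (1 - \<alpha>) * w)"
    using assms uw by (intro mult_left_mono Youngs_inequality_0) auto
  also have "\<dots> = \<alpha> * U powr (\<alpha> - 1) * u + (1 - \<alpha>) * U powr \<alpha> * w"
    using assms(3) by (simp add: powr_diff field_simps)
  finally show ?thesis .
qed

text \<open>A Hoelder bound with the geometric mean \<open>G(x, y)\<^sup>\<alpha> (\<parallel>x\<parallel> \<parallel>y\<parallel>)\<^sup>1\<^sup>-\<^sup>\<alpha>\<close>, expressed through all
  the linear functions above it; in this form it is preserved by integration.\<close>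

definition lift_holder_bound ::
    "real \<Rightarrow> real \<Rightarrow> real \<Rightarrow> (complex^'k \<Rightarrow> complex^'k \<Rightarrow> real) \<Rightarrow> (('k::finite) proj \<Rightarrow> complex) \<Rightarrow> bool" where
  "lift_holder_bound \<alpha> A c G g \<longleftrightarrow>
     (\<forall>s\<ge>0. \<forall>t\<ge>0. (\<forall>u\<ge>0. \<forall>w\<ge>0. u powr \<alpha> * w powr (1 - \<alpha>) \<le> s * u + t * w) \<longrightarrow>
       (\<forall>x y. cmod (lift g x - lift g y)
          \<le> A * (s * G x y + t * (norm x * norm y)) + c * (norm (x - y) * norm (x + y))))"

lemma lift_holder_bound_wedge_norm:
  fixes f :: "('k::finite) proj \<Rightarrow> complex"
  assumes f: "\<And>p. cmod (f p) \<le> c" and A: "\<And>p q. cmod (f p - f q) \<le> A * proj_dist p q powr \<alpha>" "0 \<le> A"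
  shows "lift_holder_bound \<alpha> A c wedge_norm f"
  unfolding lift_holder_bound_def
proof (intro allI impI)
  fix s t :: real and x y :: "complex^'k"
  assume st: "\<forall>u\<ge>0. \<forall>w\<ge>0. u powr \<alpha> * w powr (1 - \<alpha>) \<le> s * u + t * w"
  have "A * (wedge_norm x y powr \<alpha> * (norm x * norm y) powr (1 - \<alpha>))
      \<le> A * (s * wedge_norm x y + t * (norm x * norm y))"
    using st A(2) by (intro mult_left_mono) auto
  then show "cmod (lift f x - lift f y)
      \<le> A * (s * wedge_norm x y + t * (norm x * norm y)) + c * (norm (x - y) * norm (x + y))"
    using lift_diff_le[of f, OF f A, of x y] by simp
qed

lemma holder_of_lift_holder_bound:
  assumes g: "lift_holder_bound \<alpha> A c G g" and \<alpha>: "0 < \<alpha>" "\<alpha> \<le> 1"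
    and G: "\<And>x y. G x y \<le> K * wedge_norm x y" and K: "0 < K" and A: "0 \<le> A" and c: "0 \<le> c" and pq: "p \<noteq> q"
  shows "cmod (g p - g q) \<le> (K powr \<alpha> * A + 2 * c) * proj_dist p q powr \<alpha>"
proof -
  define d where "d = proj_dist p q"
  have d: "0 < d" "d \<le> 1" using proj_dist_pos[OF pq] proj_dist_le_1 by (auto simp: d_def)
  obtain x y where xy: "norm x = 1" "norm y = 1" "proj_class x = p" "proj_class y = q"
    "wedge_norm x y = d" "norm (x - y) * norm (x + y) = 2 * d"
    unfolding d_def by (rule aligned_representatives)
  \<comment> \<open>The tangent line is taken at the point that matters: gauge at most
    \<open>K * d\<close>, product of norms 1. The interpolation then loses nothing.\<close>
  define U where "U = K * d"
  have U: "0 < U" using K d by (simp add: U_def)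
  define s t where "s = \<alpha> * U powr (\<alpha> - 1)" and "t = (1 - \<alpha>) * U powr \<alpha>"
  have st: "0 \<le> s" "0 \<le> t" using \<alpha> by (auto simp: s_def t_def)
  have young: "\<forall>u\<ge>0. \<forall>w\<ge>0. u powr \<alpha> * w powr (1 - \<alpha>) \<le> s * u + t * w"
    unfolding s_def t_def using weighted_young[OF _ _ U \<alpha>] by blast
  have "cmod (g p - g q) = cmod (lift g x - lift g y)" using xy by (simp add: lift_unit)
  also have "\<dots> \<le> A * (s * G x y + t * (norm x * norm y)) + c * (norm (x - y) * norm (x + y))"
    using g st young unfolding lift_holder_bound_def by blast
  also have "\<dots> \<le> A * (s * U + t) + c * (2 * d)"
    using G[of x y] st A xy by (simp add: U_def mult_left_mono)
  also have "s * U + t = U powr \<alpha>"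
    using U by (simp add: s_def t_def powr_diff field_simps)
  also have "U powr \<alpha> = K powr \<alpha> * d powr \<alpha>" using K d by (simp add: U_def powr_mult)
  also have "c * (2 * d) \<le> c * (2 * d powr \<alpha>)"
    using powr_mono'[of \<alpha> 1 d] \<alpha> d c by (intro mult_left_mono) auto
  finally show ?thesis unfolding d_def by (simp add: algebra_simps)
qed

context kraus_measure
begin

lemma markov_op_eq: "markov_op \<mu> f p = (\<integral>v. lift f (v *v unit_rep p) \<partial>\<mu>)"
  unfolding markov_op_def lift_def proj_act_def by (rule Bochner_Integration.integral_cong) auto

lemma lift_markov_op: "lift (markov_op \<mu> f) x = (\<integral>v. lift f (v *v x) \<partial>\<mu>)"
proof (cases "x = 0")
  case True
  then show ?thesis by (simp add: lift_def)
next
  case False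
  define u where "u = unit_rep (proj_class x)"
  have u: "norm u = 1" "proj_class u = proj_class x" by (simp_all add: u_def unit_rep)
  then have "u \<noteq> 0" by auto
  then obtain d where d: "x = d *s u" using u(2) False proj_class_eq_iff by blast
  have nd: "norm x = cmod d" using u by (simp add: d norm_vec_scale)
  have "(\<integral>v. lift f (v *v x) \<partial>\<mu>) = complex_of_real ((cmod d)\<^sup>2) * (\<integral>v. lift f (v *v u) \<partial>\<mu>)"
    by (simp add: d matrix_vector_mult_scale lift_scale)
  also have "\<dots> = lift (markov_op \<mu> f) x"
    using False by (simp add: lift_def[of _ x] markov_op_eq u_def nd mult.commute)
  finally show ?thesis ..
qed

lemma integrable_lift:
  assumes "f \<in> holder_space \<alpha>" "0 < \<alpha>" "\<alpha> \<le> 1"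
  shows "integrable \<mu> (\<lambda>v. lift f (v *v x))"
proof (rule integrable_of_continuous)
  show "continuous_on UNIV (\<lambda>v. lift f (v *v x))"
    using continuous_on_compose2[OF continuous_lift[OF assms] continuous_matrix_vector_left] by blast
  show "norm (lift f (v *v x)) \<le> sup_norm f * ((norm (v *v x))\<^sup>2 + (norm (v *v 0))\<^sup>2)" for v
    using norm_lift_le[of f, OF holder_spaceD(1)[OF assms(1)]] by simp
qed

lemma markov_op_contraction:
  assumes f: "f \<in> holder_space \<alpha>" "0 < \<alpha>" "\<alpha> \<le> 1" and c: "\<And>p. cmod (f p) \<le> c"
  shows "cmod (markov_op \<mu> f p) \<le> c"
proof -
  let ?u = "unit_rep p"
  have "cmod (markov_op \<mu> f p) \<le> (\<integral>v. cmod (lift f (v *v ?u)) \<partial>\<mu>)"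
    unfolding markov_op_eq by (rule integral_norm_bound)
  also have "\<dots> \<le> (\<integral>v. c * (norm (v *v ?u))\<^sup>2 \<partial>\<mu>)"
    by (intro integral_mono integrable_norm integrable_lift[OF f] integrable_mult_right norm_squared norm_lift_le c)
  also have "\<dots> = c" by (simp add: norm_squared unit_rep)
  finally show ?thesis .
qed

text \<open>With \<open>s\<close> and \<open>t\<close> fixed, the bound for \<open>v *v x\<close>
  and \<open>v *v y\<close> is integrated term by term; linearity in the pair keeps the last term a
  product of norms, and Cauchy-Schwarz applies to both such products.\<close>

lemma lift_holder_bound_markov_op:
  assumes g: "g \<in> holder_space \<alpha>" "0 < \<alpha>" "\<alpha> \<le> 1" and G: "bivector_gauge G"
    and b: "lift_holder_bound \<alpha> A c G g" and "0 \<le> A" "0 \<le> c"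
  shows "lift_holder_bound \<alpha> A c (avg G) (markov_op \<mu> g)"
  unfolding lift_holder_bound_def
proof (intro allI impI)
  fix s t x y
  assume st: "(0::real) \<le> s" "(0::real) \<le> t" "\<forall>u\<ge>0. \<forall>w\<ge>0. u powr \<alpha> * w powr (1 - \<alpha>) \<le> s * u + t * w"
  have int: "integrable \<mu> (\<lambda>v. lift g (v *v x))" for x by (rule integrable_lift[OF g])
  have i1: "integrable \<mu> (\<lambda>v. s * G (v *v x) (v *v y))"
    by (intro integrable_mult_right integrable_gauge[OF G])
  have i2: "integrable \<mu> (\<lambda>v. t * (norm (v *v x) * norm (v *v y)))"
    by (intro integrable_mult_right integrable_norm_product)
  have i3: "integrable \<mu> (\<lambda>v. A * (s * G (v *v x) (v *v y) + t * (norm (v *v x) * norm (v *v y))))"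
    by (intro integrable_mult_right Bochner_Integration.integrable_add i1 i2)
  have i4: "integrable \<mu> (\<lambda>v. c * (norm (v *v (x - y)) * norm (v *v (x + y))))"
    by (intro integrable_mult_right integrable_norm_product)
  have "cmod (lift (markov_op \<mu> g) x - lift (markov_op \<mu> g) y) = cmod (\<integral>v. lift g (v *v x) - lift g (v *v y) \<partial>\<mu>)"
    unfolding lift_markov_op by (simp add: Bochner_Integration.integral_diff[OF int int])
  also have "\<dots> \<le> (\<integral>v. cmod (lift g (v *v x) - lift g (v *v y)) \<partial>\<mu>)"
    by (rule integral_norm_bound)
  also have "\<dots> \<le> (\<integral>v. A * (s * G (v *v x) (v *v y) + t * (norm (v *v x) * norm (v *v y)))
      + c * (norm (v *v (x - y)) * norm (v *v (x + y))) \<partial>\<mu>)"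
  proof (intro integral_mono integrable_norm Bochner_Integration.integrable_diff int Bochner_Integration.integrable_add i3 i4)
    show "cmod (lift g (v *v x) - lift g (v *v y)) \<le> A * (s * G (v *v x) (v *v y) + t * (norm (v *v x) * norm (v *v y)))
      + c * (norm (v *v (x - y)) * norm (v *v (x + y)))" for v
      using b st unfolding lift_holder_bound_def
      by (simp add: matrix_vector_right_distrib matrix_vector_mult_diff_distrib)
  qed
  also have "\<dots> = A * (s * avg G x y + t * (\<integral>v. norm (v *v x) * norm (v *v y) \<partial>\<mu>))
      + c * (\<integral>v. norm (v *v (x - y)) * norm (v *v (x + y)) \<partial>\<mu>)"
    unfolding Bochner_Integration.integral_add[OF i3 i4]
    by (simp add: Bochner_Integration.integral_add[OF i1 i2] avg_def)
  also have "\<dots> \<le> A * (s * avg G x y + t * (norm x * norm y)) + c * (norm (x - y) * norm (x + y))"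
    using st assms(6,7) by (intro add_mono mult_left_mono integral_norm_product_le order_refl)
  finally show "cmod (lift (markov_op \<mu> g) x - lift (markov_op \<mu> g) y)
      \<le> A * (s * avg G x y + t * (norm x * norm y)) + c * (norm (x - y) * norm (x + y))" .
qed

text \<open>The constants stay those of the initial function; only the gauge evolves. The Hoelder
  bound extracted at each step serves only for membership in the space, hence integrability at the
  next step; feeding it back would add \<open>2 * c\<close> every time.\<close>

lemma markov_op_iterate:
  assumes f: "f \<in> holder_space \<alpha>" and \<alpha>: "0 < \<alpha>" "\<alpha> \<le> 1" and c: "\<And>p. cmod (f p) \<le> c"
  shows "(markov_op \<mu> ^^ n) f \<in> holder_space \<alpha> \<and> (\<forall>p. cmod ((markov_op \<mu> ^^ n) f p) \<le> c) \<and>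
    lift_holder_bound \<alpha> (holder_const \<alpha> f) c (avg_wedge n) ((markov_op \<mu> ^^ n) f)"
proof (induction n)
  case 0
  show ?case
    using f c lift_holder_bound_wedge_norm[OF c holder_spaceD(2,5)[OF f]] by (simp add: avg_wedge_0)
next
  case (Suc n)
  define g where "g = (markov_op \<mu> ^^ n) f"
  have g: "g \<in> holder_space \<alpha>" "\<And>p. cmod (g p) \<le> c" "lift_holder_bound \<alpha> (holder_const \<alpha> f) c (avg_wedge n) g"
    using Suc by (auto simp: g_def)
  have A: "0 \<le> holder_const \<alpha> f" by (rule holder_spaceD(5)[OF f])
  have c0: "0 \<le> c" using c[of undefined] norm_ge_zero order_trans by blast
  have 1: "lift_holder_bound \<alpha> (holder_const \<alpha> f) c (avg_wedge (Suc n)) (markov_op \<mu> g)"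
    unfolding avg_wedge_Suc by (rule lift_holder_bound_markov_op[OF g(1) \<alpha> bivector_gauge_avg_wedge g(3) A c0])
  have 2: "cmod (markov_op \<mu> g p) \<le> c" for p by (rule markov_op_contraction[OF g(1) \<alpha> g(2)])
  have "avg_wedge (Suc n) x y \<le> 1 * wedge_norm x y" for x y
    using bivector_gauge_le_wedge_norm(1)[OF bivector_gauge_avg_wedge] by simp
  from holder_of_lift_holder_bound[OF 1 \<alpha> this zero_less_one A c0]
  have "markov_op \<mu> g \<in> holder_space \<alpha>"
    using A c0 by (intro holder_spaceI[OF 2, where A = "1 powr \<alpha> * holder_const \<alpha> f + 2 * c"]) auto
  then show ?case using 1 2 by (simp add: g_def)
qed

lemma markov_op_doeblin_fortet:
  assumes f: "f \<in> holder_space \<alpha>" and \<alpha>: "0 < \<alpha>" "\<alpha> \<le> 1" and c: "\<And>p. cmod (f p) \<le> c"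
    and K: "0 < K" "\<And>x y. avg_wedge n x y \<le> K * wedge_norm x y"
  shows "holder_norm \<alpha> ((markov_op \<mu> ^^ n) f) \<le> K powr \<alpha> * holder_norm \<alpha> f + 3 * c"
proof -
  have A: "0 \<le> holder_const \<alpha> f" by (rule holder_spaceD(5)[OF f])
  have c0: "0 \<le> c" using c[of undefined] norm_ge_zero order_trans by blast
  note it = markov_op_iterate[OF f \<alpha> c, of n]
  have "holder_norm \<alpha> ((markov_op \<mu> ^^ n) f) \<le> c + (K powr \<alpha> * holder_const \<alpha> f + 2 * c)"
    using it holder_of_lift_holder_bound[OF _ \<alpha> K(2,1) A c0] A c0
    by (intro holder_spaceI(2)) auto
  also have "K powr \<alpha> * holder_const \<alpha> f \<le> K powr \<alpha> * holder_norm \<alpha> f"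
    using holder_spaceD(3,4)[OF f] by (intro mult_left_mono) auto
  finally show ?thesis by simp
qed

lemma markov_op_add:
  assumes "f \<in> holder_space \<alpha>" "g \<in> holder_space \<alpha>" "0 < \<alpha>" "\<alpha> \<le> 1"
  shows "markov_op \<mu> (f + g) = markov_op \<mu> f + markov_op \<mu> g"
proof
  fix p
  show "markov_op \<mu> (f + g) p = (markov_op \<mu> f + markov_op \<mu> g) p"
    unfolding markov_op_eq plus_fun_apply lift_add
    by (intro Bochner_Integration.integral_add integrable_lift[OF _ assms(3,4)] assms)
qed

lemma markov_op_fscale: "markov_op \<mu> (fscale c f) = fscale c (markov_op \<mu> f)"
  by (intro ext) (simp add: markov_op_eq lift_fscale, simp add: fscale_def markov_op_eq)

lemma markov_op_one: "markov_op \<mu> (\<lambda>_. 1) = (\<lambda>_. 1)"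
proof
  fix p
  have "markov_op \<mu> (\<lambda>_. 1) p = (\<integral>v. complex_of_real ((norm (v *v unit_rep p))\<^sup>2) \<partial>\<mu>)"
    unfolding markov_op_eq by (intro Bochner_Integration.integral_cong) (auto simp: lift_def)
  also have "\<dots> = complex_of_real (\<integral>v. (norm (v *v unit_rep p))\<^sup>2 \<partial>\<mu>)" by (rule integral_complex_of_real)
  also have "\<dots> = 1" by (simp add: norm_squared unit_rep)
  finally show "markov_op \<mu> (\<lambda>_. 1) p = 1" .
qed

theorem markov_op_quasi_compact:
  assumes pur: "purification \<mu>" and \<alpha>: "0 < \<alpha>" "\<alpha> \<le> 1"
  shows "quasi_compact (holder_space \<alpha>) (holder_norm \<alpha>) (markov_op \<mu>)"
    and "spectral_radius (holder_space \<alpha>) (holder_norm \<alpha>) (markov_op \<mu>) = 1"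
proof -
  obtain m K where K: "0 < K" "K < 1" and "\<And>x y. avg_wedge m x y \<le> K * wedge_norm x y"
    using contraction[OF pur] by blast
  \<comment> \<open>\<open>Suc m\<close> is a positive divisor, so that \<open>n div Suc m\<close>
    tends to infinity.\<close>
  then have "avg_wedge (Suc m) x y \<le> K * wedge_norm x y" for x y using avg_wedge_Suc_le order_trans by blast
  then have geo: "avg_wedge n x y \<le> K ^ (n div Suc m) * wedge_norm x y" for n x y
    by (rule avg_wedge_geometric) (use K in simp)
  define e where "e n = (K ^ (n div Suc m)) powr \<alpha>" for n
  have pow: "0 < K ^ j" "K ^ j \<le> 1" for j using K by (auto intro: power_le_one)
  interpret doeblin_fortet "holder_space \<alpha>" "holder_norm \<alpha>" "markov_op \<mu>" e 3
  proof
    show "fun_vs.subspace (holder_space \<alpha>)" by (rule subspace_holder_space)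
    show "holder_norm \<alpha> (f + g) \<le> holder_norm \<alpha> f + holder_norm \<alpha> g"
      if "f \<in> holder_space \<alpha>" "g \<in> holder_space \<alpha>" for f g :: "'k proj \<Rightarrow> complex"
      using that enn2real_mono[OF holder_enorm_triangle[of \<alpha> f g]]
      by (simp add: holder_norm_def holder_space_def enn2real_plus)
    show "holder_norm \<alpha> (fscale c f) = cmod c * holder_norm \<alpha> f" for c and f :: "'k proj \<Rightarrow> complex"
      by (simp add: holder_norm_def holder_enorm_fscale enn2real_mult)
    show "0 \<le> holder_norm \<alpha> f" for f :: "'k proj \<Rightarrow> complex" by (simp add: holder_norm_def)
    show "cmod (f p) \<le> holder_norm \<alpha> f" if "f \<in> holder_space \<alpha>" for f and p :: "'k proj"
      using holder_spaceD[OF that] by (simp add: add_increasing2)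
    show "\<exists>f s. f \<in> holder_space \<alpha> \<and> holder_norm \<alpha> f \<le> B \<and> strict_mono (s :: nat \<Rightarrow> nat) \<and>
        uniform_limit UNIV (\<lambda>n. fs (s n)) f sequentially"
      if "\<And>n. fs n \<in> holder_space \<alpha>" "\<And>n. holder_norm \<alpha> (fs n) \<le> B" for B and fs :: "nat \<Rightarrow> 'k proj \<Rightarrow> complex"
      using \<alpha>(1) that by (rule holder_compact)
    show "markov_op \<mu> f \<in> holder_space \<alpha>" if "f \<in> holder_space \<alpha>" for f
      using markov_op_iterate[OF that \<alpha> holder_spaceD(1)[OF that], of 1] by simp
    show "markov_op \<mu> (f + g) = markov_op \<mu> f + markov_op \<mu> g"
      if "f \<in> holder_space \<alpha>" "g \<in> holder_space \<alpha>" for f g using that \<alpha> by (rule markov_op_add)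
    show "markov_op \<mu> (fscale c f) = fscale c (markov_op \<mu> f)" for c f by (rule markov_op_fscale)
    show "cmod (markov_op \<mu> f p) \<le> c" if "f \<in> holder_space \<alpha>" "\<And>p. cmod (f p) \<le> c" for f c p
      using that(1) \<alpha> that(2) by (rule markov_op_contraction)
    show "holder_norm \<alpha> ((markov_op \<mu> ^^ n) f) \<le> e n * holder_norm \<alpha> f + 3 * c"
      if "f \<in> holder_space \<alpha>" "\<And>p. cmod (f p) \<le> c" for f c n
      unfolding e_def by (rule markov_op_doeblin_fortet[OF that(1) \<alpha> that(2) pow(1) geo])
    have "filterlim (\<lambda>n. n div Suc m) at_top sequentially"
      unfolding filterlim_at_top
    proof
      fix Z
      show "\<forall>\<^sub>F n in sequentially. Z \<le> n div Suc m"
        using div_le_mono[of "Z * Suc m" _ "Suc m"]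
        by (intro eventually_sequentiallyI[of "Z * Suc m"]) (metis nonzero_mult_div_cancel_right nat.distinct(1))
    qed
    moreover have "(\<lambda>j. K ^ j) \<longlonglongrightarrow> 0" using K by (intro LIMSEQ_power_zero) simp
    ultimately have "(\<lambda>n. K ^ (n div Suc m)) \<longlonglongrightarrow> 0" by (rule filterlim_compose[rotated])
    then show "e \<longlonglongrightarrow> 0"
      unfolding e_def using \<alpha>(1) pow by (intro tendsto_zero_powrI[OF _ tendsto_const]) (simp_all add: less_imp_le)
    show "0 \<le> e n" for n by (simp add: e_def)
    show "e n \<le> 1" for n
      unfolding e_def using \<alpha>(1) pow[of "n div Suc m"] by (intro powr_le1) (simp_all add: abs_of_pos)
    show "(\<lambda>_. 1) \<in> holder_space \<alpha>" by (rule holder_spaceI(1)[of _ 1 0]) auto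
  qed (simp_all add: markov_op_one)
  show "quasi_compact (holder_space \<alpha>) (holder_norm \<alpha>) (markov_op \<mu>)" by (rule quasi_compact)
  show "spectral_radius (holder_space \<alpha>) (holder_norm \<alpha>) (markov_op \<mu>) = 1" by (rule spectral_radius_eq_1)
qed

end

lemma kraus_measureI:
  fixes \<mu> :: "(complex^'k^'k) measure"
  assumes "sets \<mu> = sets borel" and id: "(\<integral>v. madj v ** v \<partial>\<mu>) = mat 1"
  shows "kraus_measure \<mu>"
proof
  \<comment> \<open>The Bochner integral of a non-integrable function is 0, so its value
    \<open>mat 1\<close> already yields integrability.\<close>
  have int: "integrable \<mu> (\<lambda>v. madj v ** v)"
  proof (rule ccontr)
    assume "\<not> integrable \<mu> (\<lambda>v. madj v ** v)"
    then have "(mat 1 :: complex^'k^'k) = 0" using id not_integrable_integral_eq by metis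
    then show False by (simp add: mat_def vec_eq_iff) (metis zero_neq_one)
  qed
  fix x :: "complex^'k"
  \<comment> \<open>The quadratic form at \<open>x\<close> is a bounded real-linear functional of
    the matrix and therefore commutes with the integral.\<close>
  let ?L = "\<lambda>A :: complex^'k^'k. Re (cinner x (A *v x))"
  have "linear ?L"
    by (intro linearI) (simp_all add: cinner_def matrix_vector_mult_def sum.distrib sum_distrib_left
        scaleR_sum_right algebra_simps)
  then have L: "bounded_linear ?L" by (simp add: linear_conv_bounded_linear)
  have eq: "?L (madj v ** v) = (norm (v *v x))\<^sup>2" for v
    by (simp add: matrix_vector_mul_assoc[symmetric] cinner_madj cinner_self)
  show "integrable \<mu> (\<lambda>v. (norm (v *v x))\<^sup>2)"
    using integrable_bounded_linear[OF L int] unfolding eq .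
  have "(\<integral>v. ?L (madj v ** v) \<partial>\<mu>) = ?L (\<integral>v. madj v ** v \<partial>\<mu>)" by (rule integral_bounded_linear[OF L int])
  then show "(\<integral>v. (norm (v *v x))\<^sup>2 \<partial>\<mu>) = (norm x)\<^sup>2" unfolding eq id by (simp add: cinner_self)
qed (rule assms)

theorem theorem4p2:
  fixes \<mu> :: "(complex^'k^'k) measure" and \<alpha> :: real
  assumes "sets \<mu> = sets borel"
    and "(\<integral>\<^sup>+v. ennreal ((onorm ((*v) v))\<^sup>2) \<partial>\<mu>) < \<infinity>"
    and "(\<integral>v. madj v ** v \<partial>\<mu>) = mat 1"
    and "0 < \<alpha>" and "\<alpha> \<le> 1"
    and "purification \<mu>"
  shows "quasi_compact (holder_space \<alpha>) (holder_norm \<alpha>) (markov_op \<mu>) \<and>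
         spectral_radius (holder_space \<alpha>) (holder_norm \<alpha>) (markov_op \<mu>) = 1"
proof -
  interpret kraus_measure \<mu> using assms(1,3) by (rule kraus_measureI)
  show ?thesis using markov_op_quasi_compact[OF assms(6,4,5)] by simp
qed

end
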